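(* Let $U\subset\mathbb{R}^n$ be open, let $E$ be sub area-minimizing in $U$ and $F$ super area-minimizing in $U$, with $E\subset F$ and $\partial E\cap\partial F\subset\subset U$. Suppose moreover that $\overline{E}\cap U=\overline{E^i}\cap U$, where $E^i$ is the topological interior of $E$. Then, relative to $U$, either $\partial E\cap\partial F=\emptyset$, or else $\partial E=\partial F$ in a neighborhood of $\partial E\cap\partial F$.
   Context: All sets are sets of locally finite perimeter, with perimeter $P(E,U)=\|\nabla\chi_E\|(U)$ (total variation of the distributional gradient of the characteristic function). Sets are normalized by the convention that $E$ is replaced by the representative $E\cup E_1\setminus E_0$, where $E_i=\{x:|E\cap B(x,r)|/|B(x,r)|=i \text{ for all small } r>0\}$, $i=0,1$. $X\subset\subset Y$ means $\overline X$ is a compact subset of the interior of $Y$. For $U$ open and bounded: $E$ is area-minimizing in $U$ if $P(E,U)\le P(F,U)$ whenever $E\Delta F\subset\subset U$; $E$ is super area-minimizing in $U$ if $P(E,U)\le P(E\cup F,U)$ whenever $E\Delta F\subset\subset U$; $E$ is sub area-minimizing in $U$ if $P(E,U)\le P(E\cap F,U)$ whenever $E\Delta F\subset\subset U$. $\partial E$ denotes the topological boundary. *)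

theory Defs
  imports "HOL-Analysis.Analysis"
begin

definition divergence :: "('a::euclidean_space \<Rightarrow> 'a) \<Rightarrow> 'a \<Rightarrow> real" where
  "divergence \<phi> x = (\<Sum>b\<in>Basis. frechet_derivative \<phi> (at x) b \<bullet> b)"

definition test_fields :: "'a::euclidean_space set \<Rightarrow> ('a \<Rightarrow> 'a) set" where
  "test_fields U = {\<phi>. (\<forall>x. \<phi> differentiable (at x))
      \<and> (\<forall>b\<in>Basis. continuous_on UNIV (\<lambda>x. frechet_derivative \<phi> (at x) b))
      \<and> compact (closure {x. \<phi> x \<noteq> 0}) \<and> closure {x. \<phi> x \<noteq> 0} \<subseteq> U
      \<and> (\<forall>x. norm (\<phi> x) \<le> 1)}"

text \<open>Perimeter P(E,U): total variation of the distributional gradient of the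
  characteristic function of E in U.\<close>
definition perimeter :: "'a::euclidean_space set \<Rightarrow> 'a set \<Rightarrow> ereal" where
  "perimeter E U = (SUP \<phi>\<in>test_fields U. ereal (LINT x:E|lebesgue. divergence \<phi> x))"

definition locally_finite_perimeter :: "'a::euclidean_space set \<Rightarrow> bool" where
  "locally_finite_perimeter E \<longleftrightarrow> E \<in> sets lebesgue \<and>
     (\<forall>V. open V \<and> bounded V \<longrightarrow> perimeter E V < \<infinity>)"

definition density_points :: "'a::euclidean_space set \<Rightarrow> real \<Rightarrow> 'a set" where
  "density_points E t = {x. \<exists>r0>0. \<forall>r. 0 < r \<and> r < r0 \<longrightarrow>
       measure lebesgue (E \<inter> ball x r) / measure lebesgue (ball x r) = t}"

definition normalized :: "'a::euclidean_space set \<Rightarrow> bool" where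
  "normalized E \<longleftrightarrow> E = (E \<union> density_points E 1) - density_points E 0"

definition admissible :: "'a::euclidean_space set \<Rightarrow> bool" where
  "admissible E \<longleftrightarrow> locally_finite_perimeter E \<and> normalized E"

definition compactly_contained :: "'a::euclidean_space set \<Rightarrow> 'a set \<Rightarrow> bool" where
  "compactly_contained X Y \<longleftrightarrow> compact (closure X) \<and> closure X \<subseteq> interior Y"

text \<open>Sub/super area-minimizing in an open set U; comparisons are made in
  every bounded open W \<subseteq> U (for bounded U this is the paper's definition).\<close>
definition sub_area_minimizing :: "'a::euclidean_space set \<Rightarrow> 'a set \<Rightarrow> bool" where
  "sub_area_minimizing E U \<longleftrightarrow> (\<forall>F W. admissible F \<and> open W \<and> bounded W \<and> W \<subseteq> U \<and>
      compactly_contained ((E - F) \<union> (F - E)) W \<longrightarrow> perimeter E W \<le> perimeter (E \<inter> F) W)"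

definition super_area_minimizing :: "'a::euclidean_space set \<Rightarrow> 'a set \<Rightarrow> bool" where
  "super_area_minimizing E U \<longleftrightarrow> (\<forall>F W. admissible F \<and> open W \<and> bounded W \<and> W \<subseteq> U \<and>
      compactly_contained ((E - F) \<union> (F - E)) W \<longrightarrow> perimeter E W \<le> perimeter (E \<union> F) W)"

end

(* Write K for the contact set. For small vectors v the translate E + v leaves F only near K, so
   the sub- and superminimality of E and F give P(F \<union> (E + v)) \<le> P(F) =: p. Averaging the
   characteristic functions of F \<union> (E + v) over v gives a function w of variation at most p. Its
   superlevel sets contain F, hence have perimeter at least p, and by coarea w has variation exactly
   p. So no variation cancels in the average: near an exterior point of F, where w is a convolution of
   the characteristic function of E, all translates of E have the same normal, i.e. E is a half-space.
   The hypothesis on the interior of E provides such points after passing to complements, so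
   near a point of K first F and then E is a half-space; as E \<subseteq> F, it is the same one. *)
theory Submission
  imports Defs
begin

text \<open>No regularity theory of minimizers enters: neither reduced boundaries nor monotonicity
  formulas nor an elliptic maximum principle. What replaces them is room to translate. Compactness
  of the contact set lets all small translates be compared on one window around the whole of it,
  because in a shell around it E stays a positive distance away from the complement of F. The
  averaging kernel needs a plateau. A perturbation \<tau> of the field, carried along with the
  translate, is then weighted by exactly 1 from every point near the base point, so that it factors
  out of the double integral over points and translations and leaves a condition on E alone. The
  base point lies outside F because only there the average has a continuous gradient, so that one
  unit vector is an almost optimal field on all small balls around it. The two uses of the flatness
  result feed each other: the half-space found for the complement of F supplies the exterior points
  of F that the argument for E starts from.\<close>

section \<open>Convolution with a compactly supported kernel\<close>

lemma integrable_bounded_support: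
  fixes g :: "'a::euclidean_space \<Rightarrow> 'b::{banach,second_countable_topology}"
  assumes "g \<in> borel_measurable lborel" "\<And>z. norm (g z) \<le> B" "\<And>z. z \<notin> cball c R \<Longrightarrow> g z = 0"
  shows "integrable lborel g"
proof (rule Bochner_Integration.integrable_bound)
  have "emeasure lborel (cball c R) < \<infinity>"
    by (rule emeasure_bounded_finite) (rule bounded_cball)
  then show "integrable lborel (\<lambda>z. indicator (cball c R) z * B :: real)"
    by (intro integrable_mult_left) (auto intro!: integrable_real_indicator)
  show "AE z in lborel. norm (g z) \<le> norm (indicator (cball c R) z * B)"
    using assms(2,3) by (intro AE_I2) (auto simp: indicator_def intro: order_trans[OF _ abs_ge_self])
qed (fact assms)

definition conv :: "('a::euclidean_space \<Rightarrow> real) \<Rightarrow> ('a \<Rightarrow> 'b::euclidean_space) \<Rightarrow> 'a \<Rightarrow> 'b" where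
  "conv k f x = (LBINT z. k (x - z) *\<^sub>R f z)"

lemma compactly_supported_bounded:
  fixes k :: "'a::euclidean_space \<Rightarrow> real"
  assumes k: "continuous_on UNIV k" "\<And>z. R \<le> norm z \<Longrightarrow> k z = 0"
  obtains B where "\<And>z. \<bar>k z\<bar> \<le> B"
proof -
  have "compact (k ` cball 0 (max R 0))"
    by (intro compact_continuous_image continuous_on_subset[OF k(1)]) auto
  then obtain B where B: "\<And>y. y \<in> k ` cball 0 (max R 0) \<Longrightarrow> norm y \<le> B"
    by (meson bounded_iff compact_imp_bounded)
  have "\<bar>k z\<bar> \<le> max B 0" for z
    using B[of "k z"] k(2)[of z] by (cases "norm z \<le> max R 0") (auto simp: le_max_iff_disj)
  then show thesis by (rule that)
qed

lemma conv_integrable: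
  fixes f :: "'a::euclidean_space \<Rightarrow> 'b::euclidean_space"
  assumes k: "continuous_on UNIV k" "\<And>z. R \<le> norm z \<Longrightarrow> k z = 0"
    and f: "f \<in> borel_measurable lborel" "\<And>z. norm (f z) \<le> M"
  shows "integrable lborel (\<lambda>z. k (x - z) *\<^sub>R f z)"
proof -
  obtain B where B: "\<And>z. \<bar>k z\<bar> \<le> B" using compactly_supported_bounded[OF k] by blast
  have [measurable]: "k \<in> borel_measurable borel"
    by (rule borel_measurable_continuous_onI[OF k(1)])
  have [measurable]: "f \<in> borel_measurable borel" using f(1) by simp
  show ?thesis
  proof (rule integrable_bounded_support)
    show "(\<lambda>z. k (x - z) *\<^sub>R f z) \<in> borel_measurable lborel" by measurable
    show "norm (k (x - z) *\<^sub>R f z) \<le> B * M" for z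
      using B[of "x - z"] f(2)[of z] unfolding norm_scaleR by (intro mult_mono order_trans[OF abs_ge_zero B]) auto
    show "k (x - z) *\<^sub>R f z = 0" if "z \<notin> cball x R" for z
      using that k(2)[of "x - z"] by (auto simp: dist_norm)
  qed
qed

lemma conv_continuous:
  fixes f :: "'a::euclidean_space \<Rightarrow> 'b::euclidean_space"
  assumes k: "continuous_on UNIV k" "\<And>z. R \<le> norm z \<Longrightarrow> k z = 0"
    and f: "f \<in> borel_measurable lborel" "\<And>z. norm (f z) \<le> M"
  shows "continuous_on UNIV (conv k f)"
proof -
  obtain B where B: "\<And>z. \<bar>k z\<bar> \<le> B" using compactly_supported_bounded[OF k] by blast
  have [measurable]: "k \<in> borel_measurable borel"
    by (rule borel_measurable_continuous_onI[OF k(1)])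
  have [measurable]: "f \<in> borel_measurable borel" using f(1) by simp
  have "continuous (at x) (conv k f)" for x
  proof (rule continuous_at_sequentiallyI)
    fix u assume u: "u \<longlonglongrightarrow> x"
    then obtain r where r: "\<And>n. norm (u n) \<le> r"
      using convergent_imp_bounded[of u x] by (auto simp: bounded_iff)
    have r0: "norm x \<le> r" by (rule Lim_norm_ubound[OF _ u]) (use r in auto)
    show "(\<lambda>n. conv k f (u n)) \<longlonglongrightarrow> conv k f x"
      unfolding conv_def
    proof (rule integral_dominated_convergence)
      show "(\<lambda>z. k (x - z) *\<^sub>R f z) \<in> borel_measurable lborel" by measurable
      show "(\<lambda>z. k (u n - z) *\<^sub>R f z) \<in> borel_measurable lborel" for n by measurable
      \<comment> \<open>The points \<open>u n\<close> stay in a ball of radius \<open>r\<close>, so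
        all integrands vanish outside one common ball of radius \<open>r + R\<close>, which carries
        the majorant.\<close>
      have "emeasure lborel (cball (0::'a) (r+R)) < \<infinity>"
        by (rule emeasure_bounded_finite) (rule bounded_cball)
      then show "integrable lborel (\<lambda>z::'a. indicator (cball 0 (r+R)) z * (B*M) :: real)"
        by (intro integrable_mult_left) (auto intro!: integrable_real_indicator)
      show "AE z in lborel. norm (k (u n - z) *\<^sub>R f z) \<le> indicator (cball 0 (r+R)) z * (B*M)" for n
      proof (rule AE_I2)
        fix z
        have 1: "norm (k (u n - z) *\<^sub>R f z) \<le> B*M"
          using B[of "u n - z"] f(2)[of z] unfolding norm_scaleR by (intro mult_mono order_trans[OF abs_ge_zero B]) auto
        have 2: "k (u n - z) = 0" if "z \<notin> cball 0 (r+R)"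
        proof -
          have "norm z \<le> norm (u n) + norm (u n - z)" by norm
          then show ?thesis using that r[of n] k(2)[of "u n - z"] by (auto simp: dist_norm)
        qed
        show "norm (k (u n - z) *\<^sub>R f z) \<le> indicator (cball 0 (r+R)) z * (B*M)"
          using 1 2 by (cases "z \<in> cball 0 (r+R)") (auto simp del: mem_cball)
      qed
      have "isCont k y" for y using k(1) by (simp add: continuous_on_eq_continuous_at)
      then have "(\<lambda>n. k (u n - z)) \<longlonglongrightarrow> k (x - z)" for z
        by (rule isCont_tendsto_compose) (intro tendsto_intros u)
      then show "AE z in lborel. (\<lambda>n. k (u n - z) *\<^sub>R f z) \<longlonglongrightarrow> k (x - z) *\<^sub>R f z"
        by (intro AE_I2 tendsto_intros)
    qed
  qed
  then show ?thesis by (simp add: continuous_on_eq_continuous_at)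
qed

text \<open>The gradient is carried along as data, and smoothness is expressed by a uniform
  quadratic Taylor bound. This turns differentiation of a convolution into one estimate, and it
  admits piecewise polynomial kernels that need not be twice differentiable.\<close>

definition kernel :: "('a::euclidean_space \<Rightarrow> real) \<Rightarrow> ('a \<Rightarrow> 'a) \<Rightarrow> bool" where
  "kernel k G \<longleftrightarrow> continuous_on UNIV k \<and> continuous_on UNIV G
     \<and> (\<exists>R. \<forall>z. R \<le> norm z \<longrightarrow> k z = 0 \<and> G z = 0)
     \<and> (\<exists>C. \<forall>z h. norm h \<le> 1 \<longrightarrow> \<bar>k (z + h) - k z - G z \<bullet> h\<bar> \<le> C * (norm h)\<^sup>2)"

lemma has_derivative_quadratic_remainder:
  fixes g :: "'a::euclidean_space \<Rightarrow> 'b::euclidean_space"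
  assumes D: "linear D" and q: "\<And>h. norm h \<le> 1 \<Longrightarrow> norm (g (x + h) - g x - D h) \<le> C * (norm h)\<^sup>2"
  shows "(g has_derivative D) (at x)"
  unfolding has_derivative_at
proof
  show "bounded_linear D" using D by (simp add: linear_conv_bounded_linear)
  have ev: "\<forall>\<^sub>F h::'a in at 0. norm (norm (g (x + h) - g x - D h) / norm h) \<le> norm h * C"
  proof -
    have "\<forall>\<^sub>F h::'a in at 0. h \<in> ball 0 1 - {0}"
      by (metis Diff_iff UNIV_I centre_in_ball eventually_at_in_open open_ball zero_less_one)
    then show ?thesis
    proof eventually_elim
      case (elim h)
      then have "norm (g (x + h) - g x - D h) \<le> C * (norm h)\<^sup>2" by (intro q) auto
      then show ?case using elim by (auto simp: field_simps power2_eq_square)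
    qed
  qed
  have "((\<lambda>h::'a. norm h * C) \<longlongrightarrow> norm (0::'a) * C) (at 0)" by (intro tendsto_intros)
  then show "(\<lambda>h. norm (g (x + h) - g x - D h) / norm h) \<midarrow>0\<rightarrow> 0"
    using Lim_null_comparison[OF ev] by simp
qed

lemma kernel_deriv:
  assumes "kernel k G" shows "(k has_derivative (\<lambda>h. G x \<bullet> h)) (at x)"
proof -
  obtain C where "\<forall>z h. norm h \<le> 1 \<longrightarrow> \<bar>k (z + h) - k z - G z \<bullet> h\<bar> \<le> C * (norm h)\<^sup>2"
    using assms by (auto simp: kernel_def)
  then show ?thesis
    by (intro has_derivative_quadratic_remainder[where C=C]) (auto simp: linear_iff inner_add_right)
qed

lemma conv_gradient_continuous:
  fixes f :: "'a::euclidean_space \<Rightarrow> 'b::euclidean_space"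
  assumes K: "kernel k G" and f: "f \<in> borel_measurable lborel" "\<And>z. norm (f z) \<le> M"
  shows "continuous_on UNIV (conv (\<lambda>z. G z \<bullet> h) f)"
    and "integrable lborel (\<lambda>z. (G (x - z) \<bullet> h) *\<^sub>R f z)"
proof -
  obtain R where R: "\<And>z. R \<le> norm z \<Longrightarrow> G z = 0" using K by (auto simp: kernel_def)
  have "continuous_on UNIV (\<lambda>z. G z \<bullet> h)"
    using K by (auto simp: kernel_def intro!: continuous_intros)
  then show "continuous_on UNIV (conv (\<lambda>z. G z \<bullet> h) f)" "integrable lborel (\<lambda>z. (G (x - z) \<bullet> h) *\<^sub>R f z)"
    using R by (auto intro!: conv_continuous[where R=R, OF _ _ f] conv_integrable[where R=R and k = "\<lambda>z. G z \<bullet> h", OF _ _ f])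
qed

text \<open>The quadratic remainder of the kernel is integrated over the ball of radius
  \<open>R + 1\<close>, outside which all three kernel terms vanish because
  \<open>norm h \<le> 1\<close>. The remainder of the convolution is therefore again quadratic in
  \<open>h\<close>.\<close>

lemma conv_has_derivative:
  fixes f :: "'a::euclidean_space \<Rightarrow> 'b::euclidean_space"
  assumes K: "kernel k G" and f: "f \<in> borel_measurable lborel" "\<And>z. norm (f z) \<le> M"
  shows "(conv k f has_derivative (\<lambda>h. conv (\<lambda>z. G z \<bullet> h) f x)) (at x)"
proof -
  obtain R where R: "\<And>z. R \<le> norm z \<Longrightarrow> k z = 0 \<and> G z = 0" using K by (auto simp: kernel_def)
  obtain C where C: "\<And>z h. norm h \<le> 1 \<Longrightarrow> \<bar>k (z + h) - k z - G z \<bullet> h\<bar> \<le> C * (norm h)\<^sup>2"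
    using K by (auto simp: kernel_def)
  have kc: "continuous_on UNIV k" using K by (auto simp: kernel_def)
  have I: "integrable lborel (\<lambda>z. k (y - z) *\<^sub>R f z)" for y
    using R by (intro conv_integrable[where R=R, OF kc _ f]) auto
  note I2 = conv_gradient_continuous(2)[OF K f]
  have M: "M \<ge> 0" using f(2)[of 0] norm_ge_zero[of "f 0"] by linarith
  have fin: "emeasure lborel (cball x (R + 1)) < \<infinity>"
    by (rule emeasure_bounded_finite) (rule bounded_cball)
  show ?thesis
  proof (rule has_derivative_quadratic_remainder)
    show "linear (\<lambda>h. conv (\<lambda>z. G z \<bullet> h) f x)"
      unfolding conv_def using I2 by (intro linearI) (auto simp: inner_add_right scaleR_left_distrib simp flip: scaleR_scaleR)
    fix h :: 'a assume h: "norm h \<le> 1"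
    have "norm (conv k f (x + h) - conv k f x - conv (\<lambda>z. G z \<bullet> h) f x)
      = norm (LBINT z. (k (x + h - z) - k (x - z) - G (x - z) \<bullet> h) *\<^sub>R f z)"
      unfolding conv_def scaleR_left_diff_distrib using I I2 by (subst Bochner_Integration.integral_diff; simp)+
    also have "\<dots> \<le> (LBINT z. indicator (cball x (R + 1)) z * (C * (norm h)\<^sup>2 * M))"
    proof (rule Bochner_Integration.integral_norm_bound_integral)
      show "integrable lborel (\<lambda>z. (k (x + h - z) - k (x - z) - G (x - z) \<bullet> h) *\<^sub>R f z)"
        unfolding scaleR_left_diff_distrib using I I2 by auto
      show "integrable lborel (\<lambda>z. indicator (cball x (R + 1)) z * (C * (norm h)\<^sup>2 * M) :: real)"
        using fin by (intro integrable_mult_left) (auto intro!: integrable_real_indicator)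
      fix z
      have "norm (k (x + h - z) - k (x - z) - G (x - z) \<bullet> h) \<le> C * (norm h)\<^sup>2"
        using C[OF h, of "x - z"] by (simp add: algebra_simps)
      then have 1: "norm ((k (x + h - z) - k (x - z) - G (x - z) \<bullet> h) *\<^sub>R f z) \<le> C * (norm h)\<^sup>2 * M"
        using f(2)[of z] M unfolding norm_scaleR by (intro mult_mono) (auto intro: order_trans[OF abs_ge_zero])
      have "k (x + h - z) = 0 \<and> k (x - z) = 0 \<and> G (x - z) = 0" if "z \<notin> cball x (R + 1)"
      proof -
        have "norm (x - z) \<le> norm (x + h - z) + norm h" by norm
        then show ?thesis using that h R[of "x + h - z"] R[of "x - z"] by (auto simp: dist_norm)
      qed
      then show "norm ((k (x + h - z) - k (x - z) - G (x - z) \<bullet> h) *\<^sub>R f z)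
          \<le> indicator (cball x (R + 1)) z * (C * (norm h)\<^sup>2 * M)"
        using 1 by (cases "z \<in> cball x (R+1)") (auto simp del: mem_cball)
    qed
    also have "\<dots> = measure lborel (cball x (R + 1)) * (C * (norm h)\<^sup>2 * M)" using fin by simp
    finally show "norm (conv k f (x + h) - conv k f x - conv (\<lambda>z. G z \<bullet> h) f x)
       \<le> (measure lborel (cball x (R + 1)) * C * M) * (norm h)\<^sup>2" by (simp add: algebra_simps)
  qed
qed

lemma conv_cong:
  assumes "\<And>z. k (x - z) \<noteq> 0 \<Longrightarrow> f z = g z"
  shows "conv k f x = conv k g x"
  unfolding conv_def using assms by (intro Bochner_Integration.integral_cong) auto

lemma conv_zero:
  assumes "\<And>z. k (x - z) \<noteq> 0 \<Longrightarrow> f z = 0"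
  shows "conv k f x = 0"
  using conv_cong[of k x f "\<lambda>_. 0"] assms by (simp add: conv_def)

subsection \<open>An explicit kernel\<close>

text \<open>Squaring the truncated paraboloid makes it C1 with Lipschitz gradient across the sphere
  \<open>z \<bullet> z = b\<close>. Only first derivatives of mollified functions are ever taken, so
  this regularity suffices.\<close>

definition pk :: "real \<Rightarrow> 'a::euclidean_space \<Rightarrow> real" where
  "pk b z = (max 0 (b - z \<bullet> z))\<^sup>2"

definition pk_grad :: "real \<Rightarrow> 'a::euclidean_space \<Rightarrow> 'a" where
  "pk_grad b z = (- 4 * max 0 (b - z \<bullet> z)) *\<^sub>R z"

text \<open>The derivative \<open>2 * max 0 s\<close> of the squared positive part is Lipschitz with
  constant 2, so its Taylor remainder is at most \<open>d\<^sup>2\<close>, across the kink as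
  well.\<close>

lemma square_pos_part_remainder:
  fixes s d :: real
  shows "\<bar>(max 0 (s + d))\<^sup>2 - (max 0 s)\<^sup>2 - 2 * max 0 s * d\<bar> \<le> d\<^sup>2"
proof -
  consider "s \<ge> 0" "s + d \<ge> 0" | "s \<ge> 0" "s + d < 0" | "s < 0" "s + d < 0" | "s < 0" "s + d \<ge> 0" by linarith
  then show ?thesis
  proof cases
    case 2
    then have "\<bar>s\<^sup>2 + 2 * s * d\<bar> \<le> d\<^sup>2"
    proof -
      have "s * s \<le> (- d) * (- d)" using 2 by (intro mult_mono) auto
      moreover have "s * d \<le> 0" using 2 by (intro mult_nonneg_nonpos) auto
      moreover have "0 \<le> (s + d) * (s + d)" by simp
      ultimately show ?thesis by (simp add: abs_le_iff algebra_simps power2_eq_square)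
    qed
    then show ?thesis using 2 by (simp add: max_def abs_minus_commute)
  next
    case 4
    then have "(s+d)\<^sup>2 \<le> d\<^sup>2" by (intro power_mono) auto
    then show ?thesis using 4 by (simp add: max_def)
  qed (auto simp: max_def power2_eq_square algebra_simps)
qed

lemma kernel_pk: "kernel (pk b) (pk_grad b :: 'a::euclidean_space \<Rightarrow> 'a)"
  unfolding kernel_def
proof (intro conjI)
  show "continuous_on UNIV (pk b :: 'a \<Rightarrow> real)" "continuous_on UNIV (pk_grad b :: 'a \<Rightarrow> 'a)"
    unfolding pk_def pk_grad_def by (intro continuous_intros)+
  have Z: "max 0 (b - z \<bullet> z) = 0" if "sqrt \<bar>b\<bar> \<le> norm z" for z :: 'a
  proof -
    have "\<bar>b\<bar> \<le> (norm z)\<^sup>2" using that sqrt_le_D by blast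
    then show ?thesis by (simp add: power2_norm_eq_inner)
  qed
  then show "\<exists>R. \<forall>z::'a. R \<le> norm z \<longrightarrow> pk b z = 0 \<and> pk_grad b z = 0"
    by (intro exI[of _ "sqrt \<bar>b\<bar>"]) (auto simp: pk_def pk_grad_def)
  \<comment> \<open>The extra 1 absorbs \<open>norm h\<close>: beyond \<open>R\<close> both
    \<open>z\<close> and \<open>z + h\<close> lie outside the support.\<close>
  define R where "R = sqrt \<bar>b\<bar> + 1"
  have R: "R \<ge> 0" by (auto simp: R_def)
  \<comment> \<open>The first summand comes from the square of the change \<open>d\<close> of
    \<open>b - z \<bullet> z\<close>, which is at most \<open>(2 * R + 1) * norm h\<close>; the
    second from the part \<open>- h \<bullet> h\<close> of \<open>d\<close>, which the linear term
    \<open>pk_grad b z \<bullet> h\<close> leaves out.\<close>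
  define C where "C = (2 * R + 1)\<^sup>2 + 2 * \<bar>b\<bar>"
  have "\<bar>pk b (z + h) - pk b z - pk_grad b z \<bullet> h\<bar> \<le> C * (norm h)\<^sup>2" if h: "norm h \<le> 1" for z h :: 'a
  proof (cases "norm z \<ge> R")
    case True
    have "norm z \<le> norm (z + h) + norm h" by norm
    then have "sqrt \<bar>b\<bar> \<le> norm (z + h)" "sqrt \<bar>b\<bar> \<le> norm z" using True h by (auto simp: R_def)
    then show ?thesis using Z[of z] Z[of "z+h"] by (auto simp: pk_def pk_grad_def C_def)
  next
    case False
    define d where "d = - 2 * (z \<bullet> h) - h \<bullet> h"
    define s where "s = b - z \<bullet> z"
    have 1: "\<bar>d\<bar> \<le> (2 * R + 1) * norm h"
    proof -
      have "\<bar>z \<bullet> h\<bar> \<le> norm z * norm h" by (rule Cauchy_Schwarz_ineq2)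
      also have "\<dots> \<le> R * norm h" using False by (intro mult_right_mono) auto
      finally have "\<bar>z \<bullet> h\<bar> \<le> R * norm h" .
      moreover have "h \<bullet> h \<le> 1 * norm h"
        unfolding power2_norm_eq_inner[symmetric] power2_eq_square using h by (rule mult_right_mono) simp
      moreover have "(2 * R + 1) * norm h = 2 * (R * norm h) + norm h" by (simp add: algebra_simps)
      ultimately show ?thesis using inner_ge_zero[of h] norm_ge_zero[of h] unfolding d_def by linarith
    qed
    have d2: "d\<^sup>2 \<le> ((2 * R + 1) * norm h)\<^sup>2" using 1 abs_ge_zero[of d] by (metis power2_abs power_mono)
    have e: "b - (z + h) \<bullet> (z + h) = s + d" by (simp add: s_def d_def inner_add_left inner_add_right inner_commute)
    have "pk b (z + h) - pk b z - pk_grad b z \<bullet> h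
       = ((max 0 (s + d))\<^sup>2 - (max 0 s)\<^sup>2 - 2 * max 0 s * d) - 2 * max 0 s * (h \<bullet> h)"
      unfolding pk_def pk_grad_def e by (simp add: s_def[symmetric] d_def algebra_simps)
    moreover have "\<bar>2 * max 0 s * (h \<bullet> h)\<bar> \<le> 2 * \<bar>b\<bar> * (norm h)\<^sup>2"
    proof -
      have "max 0 s \<le> \<bar>b\<bar>" using inner_ge_zero[of z] unfolding s_def by linarith
      then show ?thesis by (auto simp: abs_mult power2_norm_eq_inner intro!: mult_right_mono)
    qed
    moreover note square_pos_part_remainder[of s d]
    ultimately have "\<bar>pk b (z + h) - pk b z - pk_grad b z \<bullet> h\<bar> \<le> ((2 * R + 1) * norm h)\<^sup>2 + 2 * \<bar>b\<bar> * (norm h)\<^sup>2"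
      using d2 by linarith
    then show ?thesis by (simp only: C_def power_mult_distrib distrib_right[of _ _ "(norm h)\<^sup>2"])
  qed
  then show "\<exists>C. \<forall>z h :: 'a. norm h \<le> 1 \<longrightarrow> \<bar>pk b (z + h) - pk b z - pk_grad b z \<bullet> h\<bar> \<le> C * (norm h)\<^sup>2" by blast
qed

lemma kernel_lincomb:
  assumes "kernel k G" "kernel k' G'"
  shows "kernel (\<lambda>z. a * k z + b * k' z) (\<lambda>z. a *\<^sub>R G z + b *\<^sub>R G' z)"
proof -
  obtain R where R: "\<And>z. R \<le> norm z \<Longrightarrow> k z = 0 \<and> G z = 0" using assms(1) by (auto simp: kernel_def)
  obtain C where C: "\<And>z h. norm h \<le> 1 \<Longrightarrow> \<bar>k (z + h) - k z - G z \<bullet> h\<bar> \<le> C * (norm h)\<^sup>2"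
    using assms(1) by (auto simp: kernel_def)
  obtain R' where R': "\<And>z. R' \<le> norm z \<Longrightarrow> k' z = 0 \<and> G' z = 0" using assms(2) by (auto simp: kernel_def)
  obtain C' where C': "\<And>z h. norm h \<le> 1 \<Longrightarrow> \<bar>k' (z + h) - k' z - G' z \<bullet> h\<bar> \<le> C' * (norm h)\<^sup>2"
    using assms(2) by (auto simp: kernel_def)
  have "\<bar>(a * k (z + h) + b * k' (z + h)) - (a * k z + b * k' z) - (a *\<^sub>R G z + b *\<^sub>R G' z) \<bullet> h\<bar> \<le> (\<bar>a\<bar> * C + \<bar>b\<bar> * C') * (norm h)\<^sup>2"
    if h: "norm h \<le> 1" for z h
  proof -
    have "(a * k (z + h) + b * k' (z + h)) - (a * k z + b * k' z) - (a *\<^sub>R G z + b *\<^sub>R G' z) \<bullet> h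
      = a * (k (z + h) - k z - G z \<bullet> h) + b * (k' (z + h) - k' z - G' z \<bullet> h)"
      by (simp add: algebra_simps inner_add_left)
    also have "\<bar>\<dots>\<bar> \<le> \<bar>a\<bar> * \<bar>k (z + h) - k z - G z \<bullet> h\<bar> + \<bar>b\<bar> * \<bar>k' (z + h) - k' z - G' z \<bullet> h\<bar>"
      by (metis abs_mult abs_triangle_ineq)
    also have "\<dots> \<le> \<bar>a\<bar> * (C * (norm h)\<^sup>2) + \<bar>b\<bar> * (C' * (norm h)\<^sup>2)"
      by (intro add_mono mult_left_mono C C' h) auto
    finally show ?thesis by (simp add: algebra_simps)
  qed
  then show ?thesis
    using assms R R' unfolding kernel_def
    by (intro conjI exI[of _ "max R R'"] exI[of _ "\<bar>a\<bar> * C + \<bar>b\<bar> * C'"])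
       (auto intro!: continuous_intros)
qed

text \<open>A second difference of the convex function \<open>s \<mapsto> (max 0 s)\<^sup>2\<close>: it is constant where all three
  terms are active, which makes \<^term>\<open>bump r\<close> equal to 1 on the ball of radius \<open>r\<close>.\<close>
definition bump :: "real \<Rightarrow> 'a::euclidean_space \<Rightarrow> real" where
  "bump r z = 1 / (2 * r^4) * (1 * pk (3 * r\<^sup>2) z + (- 2) * pk (2 * r\<^sup>2) z) + 1 / (2 * r^4) * pk (r\<^sup>2) z"

definition bump_grad :: "real \<Rightarrow> 'a::euclidean_space \<Rightarrow> 'a" where
  "bump_grad r z = (1 / (2 * r^4)) *\<^sub>R (1 *\<^sub>R pk_grad (3 * r\<^sup>2) z + (- 2) *\<^sub>R pk_grad (2 * r\<^sup>2) z) + (1 / (2 * r^4)) *\<^sub>R pk_grad (r\<^sup>2) z"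

text \<open>The coefficients 1 and -2 are spelled out in \<open>bump\<close> and
  \<open>bump_grad\<close> so that both unfold to two nested instances of
  \<open>kernel_lincomb\<close>.\<close>

lemma kernel_bump: "kernel (bump r) (bump_grad r)"
  unfolding bump_def [abs_def] bump_grad_def [abs_def] by (intro kernel_lincomb kernel_pk)

lemma bump_minus [simp]: "bump r (- z) = bump r z" "bump_grad r (- z) = - bump_grad r z"
  by (simp_all add: bump_def bump_grad_def pk_def pk_grad_def algebra_simps)

lemma bump_commute: "bump r (x - y) = bump r (y - x)" "bump_grad r (x - y) = - bump_grad r (y - x)"
  using bump_minus[of r "y - x"] by simp_all

lemma bump_props:
  assumes r: "r > 0"
  shows "0 \<le> bump r z" "bump r z \<le> 1"
    "norm z \<le> r \<Longrightarrow> bump r z = 1"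
    "2 * r \<le> norm z \<Longrightarrow> bump r z = 0" "2 * r \<le> norm z \<Longrightarrow> bump_grad r z = 0"
proof -
  define c where "c = r\<^sup>2"
  define t where "t = z \<bullet> z"
  have c: "c > 0" using r by (simp add: c_def)
  have r4: "r^4 = c\<^sup>2" by (simp add: c_def flip: power_mult)
  have b: "bump r z = ((max 0 (3*c-t))\<^sup>2 - 2 * (max 0 (2*c-t))\<^sup>2 + (max 0 (c-t))\<^sup>2) / (2 * c\<^sup>2)"
    by (simp add: bump_def pk_def r4 c_def[symmetric] t_def[symmetric] add_divide_distrib diff_divide_distrib algebra_simps)
  have t: "t \<ge> 0" by (simp add: t_def)
  \<comment> \<open>The kinks at \<open>c\<close>, \<open>2 * c\<close> and \<open>3 * c\<close> cut
    the range of \<open>t\<close> into four intervals; on the first the numerator is the constant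
    \<open>2 * c\<^sup>2\<close>, on the last it is 0.\<close>
  have P: "0 \<le> (max 0 (3*c-t))\<^sup>2 - 2 * (max 0 (2*c-t))\<^sup>2 + (max 0 (c-t))\<^sup>2 
     \<and> (max 0 (3*c-t))\<^sup>2 - 2 * (max 0 (2*c-t))\<^sup>2 + (max 0 (c-t))\<^sup>2 \<le> 2 * c\<^sup>2"
  proof -
    consider "t \<le> c" | "c < t" "t \<le> 2*c" | "2*c < t" "t \<le> 3*c" | "3*c < t" by linarith
    then show ?thesis
    proof cases
      case 2
      have e: "max 0 (3*c-t) = 3*c-t" "max 0 (2*c-t) = 2*c-t" "max 0 (c-t) = 0" using 2 c by auto
      have "t * t \<le> (2 * c) * t" using t 2 by (intro mult_right_mono) auto
      moreover have "0 \<le> c * c" by simp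
      moreover have "2 * c * t \<le> c * c + t * t" using sum_squares_bound[of c t] by (simp add: power2_eq_square)
      moreover have "(3*c-t)\<^sup>2 - 2 * (2*c-t)\<^sup>2 + 0\<^sup>2 = c * c + 2 * c * t - t * t"
        by (simp add: power2_eq_square algebra_simps)
      ultimately show ?thesis unfolding e power2_eq_square[of c] by (intro conjI) linarith+
    next
      case 3
      then have "(3*c-t)\<^sup>2 \<le> c\<^sup>2" by (intro power_mono) auto
      then have "(3*c-t)\<^sup>2 \<le> 2 * c\<^sup>2" using zero_le_power2[of c] by linarith
      then show ?thesis using 3 c by (simp add: max_def)
    qed (use c in \<open>auto simp: max_def power2_eq_square algebra_simps\<close>)
  qed
  then show "0 \<le> bump r z" "bump r z \<le> 1" unfolding b using c by (auto intro!: divide_nonneg_pos simp: pos_divide_le_eq)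
  show "bump r z = 1" if "norm z \<le> r"
  proof -
    have "t \<le> c" using that power_mono[OF that, of 2] by (simp add: t_def c_def power2_norm_eq_inner)
    then show ?thesis unfolding b using c by (simp add: max_def) (simp add: power2_eq_square field_simps)
  qed
  \<comment> \<open>The support has radius \<open>sqrt 3 * r\<close>; the bound \<open>2 * r\<close>
    is a convenient one above it.\<close>
  have Z: "max 0 (3*c-t) = 0 \<and> max 0 (2*c-t) = 0 \<and> max 0 (c-t) = 0" if "2 * r \<le> norm z"
  proof -
    have "4 * c \<le> t" using that r power_mono[OF that, of 2] by (simp add: t_def c_def power2_norm_eq_inner power_mult_distrib)
    then show ?thesis using c by auto
  qed
  show "2 * r \<le> norm z \<Longrightarrow> bump r z = 0" unfolding b using Z by auto
  show "2 * r \<le> norm z \<Longrightarrow> bump_grad r z = 0"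
    unfolding bump_grad_def pk_grad_def using Z by (simp add: c_def t_def)
qed

lemma bump_continuous: "continuous_on UNIV (bump r)" "continuous_on UNIV (bump_grad r)"
  using kernel_bump[of r] by (auto simp: kernel_def)

lemma bump_measurable [measurable]:
  "bump r \<in> borel_measurable borel" "bump_grad r \<in> borel_measurable borel"
  using bump_continuous by (auto intro: borel_measurable_continuous_onI)

lemma bump_integrable: "r > 0 \<Longrightarrow> integrable lborel (bump r)"
  by (rule integrable_bounded_support[where B=1 and c=0 and R="2*r"]) (auto simp: bump_props)

text \<open>The type argument fixes the space of integration, which the radius alone does not
  determine.\<close>

definition bump_mass :: "'a::euclidean_space itself \<Rightarrow> real \<Rightarrow> real" where
  "bump_mass _ r = (LBINT z. bump r (z::'a))"

lemma bump_mass_pos: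
  assumes "r > 0" shows "bump_mass TYPE('a::euclidean_space) r > 0"
proof -
  have "0 < measure lborel (cball (0::'a) r)"
    using assms content_cball_pos[of r 0] by simp
  also have "\<dots> = (LBINT z. indicator (cball (0::'a) r) z)" by simp
  also have "\<dots> \<le> (LBINT z. bump r (z::'a))"
    using assms emeasure_bounded_finite[OF bounded_cball, of "0::'a" r]
    by (intro integral_mono bump_integrable integrable_real_indicator)
       (auto simp: indicator_def bump_props intro: emeasure_bounded_finite)
  finally show ?thesis by (simp add: bump_mass_def)
qed

lemma lborel_integral_translate:
  fixes f :: "'a::euclidean_space \<Rightarrow> 'b::{banach,second_countable_topology}"
  assumes [measurable]: "f \<in> borel_measurable borel"
  shows "(LBINT x. f (c + x)) = (LBINT x. f x)"
proof -
  have "(LBINT x. f x) = (\<integral>x. f x \<partial>distr lborel borel ((+) c))" by (simp add: lborel_distr_plus)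
  also have "\<dots> = (LBINT x. f (c + x))" by (rule integral_distr) auto
  finally show ?thesis ..
qed

lemma lborel_integral_reflect:
  fixes f :: "'a::euclidean_space \<Rightarrow> 'b::{banach,second_countable_topology}"
  assumes [measurable]: "f \<in> borel_measurable borel"
  shows "(LBINT x. f (c - x)) = (LBINT x. f x)"
proof -
  have "(LBINT x. f x) = (\<integral>x. f x \<partial>density (distr lborel borel (\<lambda>x. c + (-1) *\<^sub>R x)) (\<lambda>_. ennreal (\<bar>-1::real\<bar> ^ DIM('a))))"
    by (subst lborel_affine[of "-1" c]) auto
  also have "\<dots> = (\<integral>x. f x \<partial>distr lborel borel (\<lambda>x. c - x))"
    by (simp add: density_1)
  also have "\<dots> = (LBINT x. f (c - x))" by (rule integral_distr) auto
  finally show ?thesis ..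
qed

section \<open>C1 maps, divergence and integration by parts\<close>

text \<open>This is the smoothness clause of \<open>test_fields\<close>, isolated so that cutoff
  functions and vector fields share it.\<close>

definition C1 :: "('a::euclidean_space \<Rightarrow> 'b::real_normed_vector) \<Rightarrow> bool" where
  "C1 f \<longleftrightarrow> (\<forall>x. f differentiable (at x)) \<and>
     (\<forall>b\<in>Basis. continuous_on UNIV (\<lambda>x. frechet_derivative f (at x) b))"

lemma C1I:
  assumes "\<And>x. (f has_derivative D x) (at x)" "\<And>b. b \<in> Basis \<Longrightarrow> continuous_on UNIV (\<lambda>x. D x b)"
  shows "C1 f"
proof -
  have "frechet_derivative f (at x) = D x" for x using assms(1)[of x] frechet_derivative_at by metis
  then show ?thesis using assms by (auto simp: C1_def differentiable_def)
qed

lemma C1_has_derivative: "C1 f \<Longrightarrow> (f has_derivative frechet_derivative f (at x)) (at x)"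
  by (simp add: C1_def frechet_derivative_works[symmetric])

lemma C1_continuous: "C1 f \<Longrightarrow> continuous_on UNIV f"
  by (auto simp: C1_def continuous_on_eq_continuous_at differentiable_imp_continuous_within)

lemma C1_gradient_continuous:
  "C1 f \<Longrightarrow> b \<in> Basis \<Longrightarrow> continuous_on UNIV (\<lambda>x. frechet_derivative f (at x) b)"
  by (auto simp: C1_def)

lemma C1_derivative_continuous:
  assumes "C1 f" "continuous_on UNIV v"
  shows "continuous_on UNIV (\<lambda>x. frechet_derivative f (at x) (v x))"
proof -
  have "frechet_derivative f (at x) (v x) = (\<Sum>b\<in>Basis. (v x \<bullet> b) *\<^sub>R frechet_derivative f (at x) b)" for x
  proof -
    have L: "linear (frechet_derivative f (at x))"
      using C1_has_derivative[OF assms(1)] has_derivative_linear by blast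
    have "frechet_derivative f (at x) (v x) = frechet_derivative f (at x) (\<Sum>b\<in>Basis. (v x \<bullet> b) *\<^sub>R b)"
      by (simp add: euclidean_representation)
    then show ?thesis by (simp add: linear_sum[OF L] linear_cmul[OF L])
  qed
  then show ?thesis
    using assms by (auto intro!: continuous_intros C1_gradient_continuous)
qed

lemma C1_const [simp]: "C1 (\<lambda>_. c)"
  by (rule C1I[of _ "\<lambda>_ _. 0"]) auto

lemma C1_add: "C1 f \<Longrightarrow> C1 g \<Longrightarrow> C1 (\<lambda>x. f x + g x)"
  by (rule C1I[of _ "\<lambda>x h. frechet_derivative f (at x) h + frechet_derivative g (at x) h"])
     (auto intro!: derivative_intros continuous_intros C1_has_derivative C1_gradient_continuous)

lemma C1_diff: "C1 f \<Longrightarrow> C1 g \<Longrightarrow> C1 (\<lambda>x. f x - g x)"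
  by (rule C1I[of _ "\<lambda>x h. frechet_derivative f (at x) h - frechet_derivative g (at x) h"])
     (auto intro!: derivative_intros continuous_intros C1_has_derivative C1_gradient_continuous)

lemma C1_scaleR:
  fixes \<xi> :: "'a::euclidean_space \<Rightarrow> real"
  shows "C1 \<xi> \<Longrightarrow> C1 f \<Longrightarrow> C1 (\<lambda>x. \<xi> x *\<^sub>R f x)"
  by (rule C1I[of _ "\<lambda>x h. \<xi> x *\<^sub>R frechet_derivative f (at x) h + frechet_derivative \<xi> (at x) h *\<^sub>R f x"])
     (auto intro!: has_derivative_scaleR continuous_intros C1_has_derivative C1_gradient_continuous intro: C1_continuous)

lemma C1_translate:
  assumes "C1 f" shows "C1 (\<lambda>x. f (x + c))"
proof (rule C1I)
  show "((\<lambda>x. f (x + c)) has_derivative frechet_derivative f (at (x + c))) (at x)" for x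
    by (rule has_derivative_compose[of "\<lambda>x. x + c" "\<lambda>h. h" x UNIV f, simplified])
       (auto intro!: derivative_eq_intros C1_has_derivative[OF assms])
  show "b \<in> Basis \<Longrightarrow> continuous_on UNIV (\<lambda>x. frechet_derivative f (at (x + c)) b)" for b
    using C1_gradient_continuous[OF assms] by (rule continuous_on_compose2) (auto intro!: continuous_intros)
qed

lemma frechet_derivative_translate:
  assumes "C1 f" shows "frechet_derivative (\<lambda>x. f (x + c)) (at x) = frechet_derivative f (at (x + c))"
proof -
  have "((\<lambda>x. f (x + c)) has_derivative frechet_derivative f (at (x + c))) (at x)"
    by (rule has_derivative_compose[of "\<lambda>x. x + c" "\<lambda>h. h" x UNIV f, simplified])
       (auto intro!: derivative_eq_intros C1_has_derivative[OF assms])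
  then show ?thesis by (metis frechet_derivative_at)
qed

lemma C1_kernel: "kernel k G \<Longrightarrow> C1 k"
  by (rule C1I[OF kernel_deriv]) (auto simp: kernel_def intro!: continuous_intros)

lemma C1_conv:
  assumes "kernel k G" "f \<in> borel_measurable lborel" "\<And>z. norm (f z) \<le> M"
  shows "C1 (conv k f)"
  by (rule C1I[OF conv_has_derivative[OF assms] conv_gradient_continuous(1)[OF assms]])

lemma frechet_derivative_conv:
  assumes "kernel k G" "f \<in> borel_measurable lborel" "\<And>z. norm (f z) \<le> M"
  shows "frechet_derivative (conv k f) (at x) h = conv (\<lambda>z. G z \<bullet> h) f x"
  using conv_has_derivative[OF assms, of x] by (metis frechet_derivative_at)

lemma frechet_derivative_zero_outside:
  assumes "x \<notin> closure {x. f x \<noteq> 0}"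
  shows "frechet_derivative f (at x) = (\<lambda>_. 0)"
proof -
  have "(f has_derivative (\<lambda>_. 0)) (at x)"
  proof (rule has_derivative_transform_within_open[of "\<lambda>_. 0" _ _ _ "- closure {x. f x \<noteq> 0}"])
    show "0 = f y" if "y \<in> - closure {x. f x \<noteq> 0}" for y
      using that subsetD[OF closure_subset, of y "{x. f x \<noteq> 0}"] by auto
  qed (use assms in auto)
  then show ?thesis by (metis frechet_derivative_at)
qed

lemma not_in_closure_support:
  assumes "\<And>x. R < norm x \<Longrightarrow> f x = 0" "R < norm x"
  shows "x \<notin> closure {x. f x \<noteq> 0}"
proof -
  have "closure {x. f x \<noteq> 0} \<subseteq> cball 0 R"
    by (rule closure_minimal) (use assms(1) in \<open>auto simp: not_less[symmetric]\<close>)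
  then show ?thesis using assms(2) by auto
qed

lemma divergence_zero_outside:
  assumes "x \<notin> closure {x. \<phi> x \<noteq> 0}" shows "divergence \<phi> x = 0"
  using frechet_derivative_zero_outside[OF assms] by (simp add: divergence_def)

lemma divergence_continuous: "C1 \<phi> \<Longrightarrow> continuous_on UNIV (divergence \<phi>)"
  unfolding divergence_def[abs_def] by (intro continuous_intros C1_gradient_continuous) auto

lemma divergence_measurable: "C1 \<phi> \<Longrightarrow> divergence \<phi> \<in> borel_measurable borel"
  by (intro borel_measurable_continuous_onI divergence_continuous)

lemma divergence_add:
  assumes "C1 f" "C1 g" shows "divergence (\<lambda>x. f x + g x) x = divergence f x + divergence g x"
proof -
  have "((\<lambda>x. f x + g x) has_derivative (\<lambda>h. frechet_derivative f (at x) h + frechet_derivative g (at x) h)) (at x)"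
    using assms by (intro derivative_intros C1_has_derivative)
  then have "frechet_derivative (\<lambda>x. f x + g x) (at x) = (\<lambda>h. frechet_derivative f (at x) h + frechet_derivative g (at x) h)"
    by (metis frechet_derivative_at)
  then show ?thesis by (simp add: divergence_def inner_add_left sum.distrib)
qed

lemma divergence_scaleR:
  fixes \<xi> :: "'a::euclidean_space \<Rightarrow> real"
  assumes "C1 \<xi>" "C1 f"
  shows "divergence (\<lambda>x. \<xi> x *\<^sub>R f x) x = \<xi> x * divergence f x + frechet_derivative \<xi> (at x) (f x)"
proof -
  have "((\<lambda>x. \<xi> x *\<^sub>R f x) has_derivative (\<lambda>h. \<xi> x *\<^sub>R frechet_derivative f (at x) h + frechet_derivative \<xi> (at x) h *\<^sub>R f x)) (at x)"
    using assms by (intro has_derivative_scaleR C1_has_derivative)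
  then have e: "frechet_derivative (\<lambda>x. \<xi> x *\<^sub>R f x) (at x) = (\<lambda>h. \<xi> x *\<^sub>R frechet_derivative f (at x) h + frechet_derivative \<xi> (at x) h *\<^sub>R f x)"
    by (metis frechet_derivative_at)
  have L: "linear (frechet_derivative \<xi> (at x))"
    using C1_has_derivative[OF assms(1)] has_derivative_linear by blast
  have "frechet_derivative \<xi> (at x) (f x) = frechet_derivative \<xi> (at x) (\<Sum>b\<in>Basis. (f x \<bullet> b) *\<^sub>R b)"
    by (simp add: euclidean_representation)
  also have "\<dots> = (\<Sum>b\<in>Basis. (f x \<bullet> b) * frechet_derivative \<xi> (at x) b)"
    by (simp add: linear_sum[OF L] linear_cmul[OF L])
  finally show ?thesis
    unfolding divergence_def e
    by (simp add: inner_add_left sum.distrib sum_distrib_left algebra_simps)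
qed

lemma divergence_translate:
  assumes "C1 f" shows "divergence (\<lambda>x. f (x + c)) x = divergence f (x + c)"
  by (simp add: divergence_def frechet_derivative_translate[OF assms])

lemma continuous_support_bounded:
  fixes g :: "'a::euclidean_space \<Rightarrow> real"
  assumes c: "continuous_on UNIV g" and z: "\<And>x. R < norm x \<Longrightarrow> g x = 0"
  shows "integrable lborel g" "\<exists>B\<ge>0. \<forall>x. \<bar>g x\<bar> \<le> B"
proof -
  obtain B where B: "\<And>x. \<bar>g x\<bar> \<le> B"
    by (rule compactly_supported_bounded[OF c, of "R + 1"]) (use z in auto)
  show "\<exists>B\<ge>0. \<forall>x. \<bar>g x\<bar> \<le> B" using B order_trans[OF abs_ge_zero B] by blast
  show "integrable lborel g"
    by (rule integrable_bounded_support[of _ B 0 R])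
       (use B z in \<open>auto intro!: borel_measurable_continuous_onI c\<close>)
qed

text \<open>By translation invariance every difference quotient of \<open>u\<close> has integral 0,
  and dominated convergence passes to the derivative. No integration along single coordinates is
  involved.\<close>

lemma integral_partial_derivative_zero:
  fixes u :: "'a::euclidean_space \<Rightarrow> real"
  assumes u: "C1 u" and z: "\<And>x. R < norm x \<Longrightarrow> u x = 0" and b: "b \<in> Basis"
  shows "(LBINT x. frechet_derivative u (at x) b) = 0"
proof -
  define d where "d x = frechet_derivative u (at x) b" for x
  have dc: "continuous_on UNIV d" unfolding d_def using u b by (rule C1_gradient_continuous)
  have dz: "d x = 0" if "R < norm x" for x
    unfolding d_def using frechet_derivative_zero_outside[OF not_in_closure_support[of R, OF z that]] by simp
  obtain B where B: "B \<ge> 0" "\<And>x. \<bar>d x\<bar> \<le> B" using continuous_support_bounded(2)[OF dc dz] by blast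
  have D: "((\<lambda>s. u (x + s *\<^sub>R b)) has_real_derivative d (x + s *\<^sub>R b)) (at s)" for x s
  proof -
    have "((\<lambda>s. u (x + s *\<^sub>R b)) has_derivative (\<lambda>t. frechet_derivative u (at (x + s *\<^sub>R b)) (t *\<^sub>R b))) (at s)"
      by (rule has_derivative_compose[of "\<lambda>s. x + s *\<^sub>R b" "\<lambda>t. t *\<^sub>R b" s UNIV u])
         (auto intro!: derivative_eq_intros C1_has_derivative[OF u])
    moreover have "linear (frechet_derivative u (at (x + s *\<^sub>R b)))"
      using C1_has_derivative[OF u] has_derivative_linear by blast
    ultimately show ?thesis
      unfolding has_field_derivative_def d_def by (simp add: linear_cmul mult_commute_abs)
  qed
  define t where "t n = inverse (real (Suc n))" for n
  have t: "t n > 0" "t n \<le> 1" for n by (auto simp: t_def inverse_le_1_iff)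
  have t0: "t \<longlonglongrightarrow> 0" unfolding t_def by (rule LIMSEQ_inverse_real_of_nat)
  have [measurable]: "u \<in> borel_measurable borel" "d \<in> borel_measurable borel"
    using dc C1_continuous[OF u] by (auto intro: borel_measurable_continuous_onI)
  have ui: "integrable lborel u" by (rule continuous_support_bounded(1)[OF C1_continuous[OF u] z])
  have ui': "integrable lborel (\<lambda>x. u (x + c))" for c
  proof (rule continuous_support_bounded(1)[of _ "R + norm c"])
    show "continuous_on UNIV (\<lambda>x. u (x + c))"
      using C1_continuous[OF u] by (rule continuous_on_compose2) (auto intro!: continuous_intros)
    show "u (x + c) = 0" if "R + norm c < norm x" for x
      using that norm_triangle_ineq4[of "x + c" c] by (intro z) simp
  qed
  have q: "(LBINT x. (u (x + t n *\<^sub>R b) - u x) / t n) = 0" for n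
  proof -
    have "(LBINT x. u (x + t n *\<^sub>R b)) = (LBINT x. u x)"
      using lborel_integral_translate[of u "t n *\<^sub>R b"] by (simp add: add.commute)
    then show ?thesis using ui ui' by simp
  qed
  \<comment> \<open>The mean value theorem turns the quotient into a value of \<open>d\<close> at a
    point within distance 1 of \<open>x\<close>; hence the radius \<open>R + 1\<close>.\<close>
  have bnd: "\<bar>(u (x + t n *\<^sub>R b) - u x) / t n\<bar> \<le> indicator (cball 0 (R + 1)) x * B" for x n
  proof -
    obtain s where s: "0 < s" "s < t n" "u (x + t n *\<^sub>R b) - u (x + 0 *\<^sub>R b) = (t n - 0) * d (x + s *\<^sub>R b)"
      using MVT2[OF t(1)[of n], of "\<lambda>s. u (x + s *\<^sub>R b)" "\<lambda>s. d (x + s *\<^sub>R b)"] D by blast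
    then have e: "(u (x + t n *\<^sub>R b) - u x) / t n = d (x + s *\<^sub>R b)" using t(1)[of n] by (simp add: field_simps)
    have "d (x + s *\<^sub>R b) = 0" if "x \<notin> cball 0 (R + 1)"
    proof (rule dz)
      have "norm x \<le> norm (x + s *\<^sub>R b) + norm (s *\<^sub>R b)"
        using norm_triangle_ineq4[of "x + s *\<^sub>R b" "s *\<^sub>R b"] by simp
      moreover have "norm (s *\<^sub>R b) \<le> 1" using s t(2)[of n] b by simp
      ultimately show "R < norm (x + s *\<^sub>R b)" using that by simp
    qed
    then show ?thesis unfolding e using B by (cases "x \<in> cball 0 (R+1)") (auto simp del: mem_cball)
  qed
  have "(\<lambda>n. LBINT x. (u (x + t n *\<^sub>R b) - u x) / t n) \<longlonglongrightarrow> (LBINT x. d x)"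
  proof (rule integral_dominated_convergence)
    show "integrable lborel (\<lambda>x::'a. indicator (cball 0 (R+1)) x * B :: real)"
      using emeasure_bounded_finite[OF bounded_cball, of "0::'a" "R+1"]
      by (intro integrable_mult_left) (auto intro!: integrable_real_indicator)
    show "AE x in lborel. (\<lambda>n. (u (x + t n *\<^sub>R b) - u x) / t n) \<longlonglongrightarrow> d x"
    proof (rule AE_I2)
      fix x
      have "(\<lambda>h. (u (x + (0 + h) *\<^sub>R b) - u (x + 0 *\<^sub>R b)) / h) \<midarrow>0\<rightarrow> d (x + 0 *\<^sub>R b)"
        using D[of x 0] by (simp only: DERIV_def)
      moreover have "filterlim t (at 0) sequentially"
        unfolding filterlim_at using t0 t(1) by (auto simp: less_imp_neq[symmetric])
      ultimately show "(\<lambda>n. (u (x + t n *\<^sub>R b) - u x) / t n) \<longlonglongrightarrow> d x"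
        using filterlim_compose by fastforce
    qed
  qed (use bnd in auto)
  then have "(\<lambda>n. 0) \<longlonglongrightarrow> (LBINT x. d x)" unfolding q .
  then show ?thesis by (simp add: d_def LIMSEQ_const_iff)
qed

lemma integral_divergence_zero:
  assumes \<phi>: "C1 \<phi>" and z: "\<And>x. R < norm x \<Longrightarrow> \<phi> x = 0"
  shows "(LBINT x. divergence \<phi> x) = 0"
proof -
  have D: "((\<lambda>x. \<phi> x \<bullet> b) has_derivative (\<lambda>h. frechet_derivative \<phi> (at x) h \<bullet> b)) (at x)" for b x
    by (intro derivative_intros C1_has_derivative \<phi>)
  have e: "frechet_derivative (\<lambda>x. \<phi> x \<bullet> b) (at x) = (\<lambda>h. frechet_derivative \<phi> (at x) h \<bullet> b)" for b x
    using D by (metis frechet_derivative_at)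
  have C: "C1 (\<lambda>x. \<phi> x \<bullet> b)" for b
    by (rule C1I[OF D]) (auto intro!: continuous_intros C1_gradient_continuous \<phi>)
  have 0: "(LBINT x. frechet_derivative \<phi> (at x) b \<bullet> b) = 0" if "b \<in> Basis" for b
    using integral_partial_derivative_zero[OF C[of b] _ that, of R] z unfolding e by auto
  have I: "integrable lborel (\<lambda>x. frechet_derivative \<phi> (at x) b \<bullet> b)" if "b \<in> Basis" for b
  proof (rule continuous_support_bounded(1)[of _ R])
    show "continuous_on UNIV (\<lambda>x. frechet_derivative \<phi> (at x) b \<bullet> b)"
      using \<phi> that by (auto intro!: continuous_intros C1_gradient_continuous)
    show "frechet_derivative \<phi> (at x) b \<bullet> b = 0" if "R < norm x" for x
      using frechet_derivative_zero_outside[OF not_in_closure_support[of R, OF z that]] by simp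
  qed
  show ?thesis unfolding divergence_def using 0 I by (simp add: Bochner_Integration.integral_sum)
qed

lemma integration_by_parts:
  fixes \<xi> :: "'a::euclidean_space \<Rightarrow> real"
  assumes \<xi>: "C1 \<xi>" and \<phi>: "C1 \<phi>" and z: "\<And>x. R < norm x \<Longrightarrow> \<phi> x = 0"
  shows "(LBINT x. \<xi> x * divergence \<phi> x) = - (LBINT x. frechet_derivative \<xi> (at x) (\<phi> x))"
    and "integrable lborel (\<lambda>x. \<xi> x * divergence \<phi> x)"
    and "integrable lborel (\<lambda>x. frechet_derivative \<xi> (at x) (\<phi> x))"
proof -
  show 1: "integrable lborel (\<lambda>x. \<xi> x * divergence \<phi> x)"
  proof (rule continuous_support_bounded(1)[of _ R])
    show "continuous_on UNIV (\<lambda>x. \<xi> x * divergence \<phi> x)"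
      using \<phi> \<xi> by (auto intro!: continuous_intros divergence_continuous intro: C1_continuous)
    show "\<xi> x * divergence \<phi> x = 0" if "R < norm x" for x
      using divergence_zero_outside[OF not_in_closure_support[of R, OF z that]] by simp
  qed
  show 2: "integrable lborel (\<lambda>x. frechet_derivative \<xi> (at x) (\<phi> x))"
  proof (rule continuous_support_bounded(1)[of _ R])
    show "continuous_on UNIV (\<lambda>x. frechet_derivative \<xi> (at x) (\<phi> x))"
      by (rule C1_derivative_continuous[OF \<xi> C1_continuous[OF \<phi>]])
    show "frechet_derivative \<xi> (at x) (\<phi> x) = 0" if "R < norm x" for x
      using linear_0[of "frechet_derivative \<xi> (at x)"] C1_has_derivative[OF \<xi>] z[OF that]
      by (metis has_derivative_linear)
  qed
  have "0 = (LBINT x. divergence (\<lambda>x. \<xi> x *\<^sub>R \<phi> x) x)"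
    by (rule integral_divergence_zero[symmetric, of _ R]) (auto intro!: C1_scaleR \<xi> \<phi> simp: z)
  also have "\<dots> = (LBINT x. \<xi> x * divergence \<phi> x) + (LBINT x. frechet_derivative \<xi> (at x) (\<phi> x))"
    using 1 2 by (simp add: divergence_scaleR \<xi> \<phi>)
  finally show "(LBINT x. \<xi> x * divergence \<phi> x) = - (LBINT x. frechet_derivative \<xi> (at x) (\<phi> x))" by simp
qed

section \<open>Test fields and double integrals\<close>

lemma test_fields_iff:
  "\<phi> \<in> test_fields W \<longleftrightarrow> C1 \<phi> \<and> compact (closure {x. \<phi> x \<noteq> 0}) \<and> closure {x. \<phi> x \<noteq> 0} \<subseteq> W \<and> (\<forall>x. norm (\<phi> x) \<le> 1)"
  by (auto simp: test_fields_def C1_def)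

lemma test_fieldsI:
  assumes "C1 \<phi>" "\<And>x. norm (\<phi> x) \<le> 1" "\<And>x. x \<notin> C \<Longrightarrow> \<phi> x = 0" "compact C" "C \<subseteq> W"
  shows "\<phi> \<in> test_fields W"
proof -
  have "closure {x. \<phi> x \<noteq> 0} \<subseteq> C" by (rule closure_minimal) (use assms in \<open>auto intro: compact_imp_closed\<close>)
  then show ?thesis unfolding test_fields_iff using assms
    by (metis bounded_subset closed_closure compact_eq_bounded_closed order_trans)
qed

lemma test_fieldsE:
  assumes "\<phi> \<in> test_fields W"
  obtains R where "C1 \<phi>" "\<And>x. norm (\<phi> x) \<le> 1" "\<And>x. x \<notin> W \<Longrightarrow> \<phi> x = 0" "\<And>x. x \<notin> W \<Longrightarrow> divergence \<phi> x = 0"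
    "R > 0" "\<And>x. R < norm x \<Longrightarrow> \<phi> x = 0" "\<And>x. R < norm x \<Longrightarrow> divergence \<phi> x = 0"
proof -
  obtain R where R: "R > 0" "\<forall>x\<in>closure {x. \<phi> x \<noteq> 0}. norm x \<le> R"
    using assms compact_imp_bounded bounded_pos unfolding test_fields_iff by metis
  have nz: "x \<in> closure {x. \<phi> x \<noteq> 0}" if "\<phi> x \<noteq> 0" for x
    by (rule subsetD[OF closure_subset]) (use that in simp)
  have sub: "closure {x. \<phi> x \<noteq> 0} \<subseteq> W" using assms unfolding test_fields_iff by blast
  show thesis
  proof (rule that[of R])
    show "\<phi> x = 0" if "x \<notin> W" for x using nz sub that by blast
    show "divergence \<phi> x = 0" if "x \<notin> W" for x using divergence_zero_outside sub that by blast
    show "\<phi> x = 0" if "R < norm x" for x using R nz that by fastforce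
    show "divergence \<phi> x = 0" if "R < norm x" for x using R(2) that by (intro divergence_zero_outside) force
  qed (use assms R in \<open>auto simp: test_fields_iff\<close>)
qed

lemma integrable_pair_bounded_support:
  fixes f :: "'a::euclidean_space \<Rightarrow> 'b::euclidean_space \<Rightarrow> real"
  assumes m: "case_prod f \<in> borel_measurable (borel \<Otimes>\<^sub>M borel)" and B: "\<And>x y. \<bar>f x y\<bar> \<le> B"
    and z: "\<And>x y. R < norm x \<Longrightarrow> f x y = 0" "\<And>x y. R < norm y \<Longrightarrow> f x y = 0"
  shows "integrable (lborel \<Otimes>\<^sub>M lborel) (case_prod f)"
  unfolding lborel_prod
proof (rule integrable_bounded_support[of _ B 0 "R + R"])
  show "case_prod f \<in> borel_measurable lborel" using m by (simp add: borel_prod)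
  show "case_prod f p = 0" if "p \<notin> cball 0 (R + R)" for p
  proof (cases p)
    case (Pair x y)
    have "norm (x,y) \<le> norm x + norm y" by (rule norm_Pair_le)
    moreover have "R + R < norm (x,y)" using that Pair by simp
    ultimately show ?thesis using z Pair by (cases "R < norm x") auto
  qed
qed (use B in auto)

subsection \<open>Mollification\<close>

lemma lborel_integrable_translate:
  fixes f :: "'a::euclidean_space \<Rightarrow> 'b::{banach,second_countable_topology}"
  assumes "integrable lborel f"
  shows "integrable lborel (\<lambda>x. f (x - h))"
proof -
  have [measurable]: "f \<in> borel_measurable borel" using borel_measurable_integrable[OF assms] by simp
  have "integrable (distr lborel borel ((+) (- h))) f" using assms by (simp add: lborel_distr_plus)
  then have "integrable lborel (\<lambda>x. f (- h + x))" by (subst (asm) integrable_distr_eq) auto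
  then show ?thesis by (simp add: add.commute)
qed

text \<open>This is the L1 modulus of continuity under translation; its smallness near 0 is what
  makes mollifications converge.\<close>

definition shift_dist :: "('a::euclidean_space \<Rightarrow> real) \<Rightarrow> 'a \<Rightarrow> real" where
  "shift_dist f h = (LBINT x. \<bar>f (x - h) - f x\<bar>)"

lemma shift_dist_close:
  assumes f: "integrable lborel f" and g: "integrable lborel g"
  shows "shift_dist f h \<le> shift_dist g h + 2 * (LBINT x. \<bar>f x - g x\<bar>)"
proof -
  have m: "f \<in> borel_measurable borel" "g \<in> borel_measurable borel"
    using f g borel_measurable_integrable by fastforce+
  have "shift_dist f h \<le> (LBINT x. \<bar>f (x - h) - g (x - h)\<bar> + \<bar>g (x - h) - g x\<bar> + \<bar>f x - g x\<bar>)"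
    unfolding shift_dist_def using f g lborel_integrable_translate[OF f] lborel_integrable_translate[OF g]
    by (intro integral_mono) auto
  also have "\<dots> = (LBINT x. \<bar>f (x - h) - g (x - h)\<bar>) + shift_dist g h + (LBINT x. \<bar>f x - g x\<bar>)"
    unfolding shift_dist_def using f g lborel_integrable_translate[OF f] lborel_integrable_translate[OF g] by simp
  also have "(LBINT x. \<bar>f (x - h) - g (x - h)\<bar>) = (LBINT x. \<bar>f x - g x\<bar>)"
    using lborel_integral_translate[of "\<lambda>x. \<bar>f x - g x\<bar>" "- h"] m by (simp add: add.commute)
  finally show ?thesis by simp
qed

text \<open>Since a translate has the same measure, the symmetric difference with it is twice the
  part of \<open>U\<close> that the translate misses. At a fixed point of an open set that part
  eventually disappears, and dominated convergence applies.\<close>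

lemma shift_dist_open:
  fixes U :: "'a::euclidean_space set"
  assumes U: "open U" "emeasure lborel U < \<infinity>"
  shows "(shift_dist (indicator U) \<longlongrightarrow> 0) (at 0)"
  unfolding tendsto_at_iff_sequentially
proof (intro allI impI)
  fix X :: "nat \<Rightarrow> 'a" assume X: "X \<longlonglongrightarrow> 0"
  let ?i = "indicator U :: 'a \<Rightarrow> real"
  have [measurable]: "U \<in> sets borel" using U by simp
  have iU: "integrable lborel ?i" using U by (auto intro!: integrable_real_indicator)
  have iU2: "integrable lborel (\<lambda>x. ?i x * (1 - ?i (x - h)))" for h
    by (rule Bochner_Integration.integrable_bound[OF iU]) (auto simp: indicator_def)
  have e: "shift_dist ?i h = 2 * (LBINT x. ?i x * (1 - ?i (x - h)))" for h
  proof -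
    have "shift_dist ?i h = (LBINT x. 2 * (?i x * (1 - ?i (x - h))) + (?i (x - h) - ?i x))"
      unfolding shift_dist_def by (intro Bochner_Integration.integral_cong) (auto simp: indicator_def)
    also have "\<dots> = 2 * (LBINT x. ?i x * (1 - ?i (x - h))) + ((LBINT x. ?i (x - h)) - (LBINT x. ?i x))"
      using iU iU2 lborel_integrable_translate[OF iU]
      by (subst Bochner_Integration.integral_add) auto
    also have "(LBINT x. ?i (x - h)) = (LBINT x. ?i x)"
      using lborel_integral_translate[of ?i "- h"] by (simp add: add.commute)
    finally show ?thesis by simp
  qed
  have "(\<lambda>n. LBINT x. ?i x * (1 - ?i (x - X n))) \<longlonglongrightarrow> (\<integral>x. 0 \<partial>(lborel :: 'a measure))"
  proof (rule integral_dominated_convergence[OF _ _ iU])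
    show "AE x in lborel. (\<lambda>n. ?i x * (1 - ?i (x - X n))) \<longlonglongrightarrow> 0"
    proof (rule AE_I2)
      fix x
      show "(\<lambda>n. ?i x * (1 - ?i (x - X n))) \<longlonglongrightarrow> 0"
      proof (cases "x \<in> U")
        case True
        have "(\<lambda>n. x - X n) \<longlonglongrightarrow> x - 0" by (intro tendsto_intros X)
        then have "\<forall>\<^sub>F n in sequentially. x - X n \<in> U" using U(1) True by (simp add: topological_tendstoD)
        then have "\<forall>\<^sub>F n in sequentially. ?i x * (1 - ?i (x - X n)) = 0" by eventually_elim simp
        then show ?thesis by (rule tendsto_eventually)
      qed simp
    qed
  qed (auto simp: indicator_def)
  then show "(shift_dist ?i \<circ> X) \<longlonglongrightarrow> 0" unfolding o_def e by (simp add: tendsto_mult_right_zero)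
qed

text \<open>Continuity of translation in L1, by induction over integrable functions. A set of finite
  measure is approximated from outside by an open one, for which \<open>shift_dist_open\<close> is
  available; approximation errors pass through \<open>shift_dist_close\<close>.\<close>

lemma shift_dist_small:
  assumes f: "integrable lborel f" and e: "\<epsilon> > 0"
  shows "\<exists>\<delta>>0. \<forall>h. norm h < \<delta> \<longrightarrow> shift_dist f h \<le> \<epsilon>"
  using f e
proof (induction arbitrary: \<epsilon> rule: integrable_induct)
  case (base A c)
  have [measurable]: "A \<in> sets borel" using base by simp
  have "A \<in> lmeasurable" using base by (intro fmeasurableI) auto
  define k where "k = \<bar>c\<bar> + 1"
  have k: "k > 0" "\<bar>c\<bar> \<le> k" by (auto simp: k_def)
  \<comment> \<open>The open set contributes \<open>2 * \<eta>\<close>, the approximation of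
    \<open>A\<close> by it another \<open>2 * \<eta>\<close>. Dividing by \<open>k\<close> instead
    of \<open>\<bar>c\<bar>\<close> keeps \<open>\<eta>\<close> defined and positive for
    \<open>c = 0\<close>.\<close>
  define \<eta> where "\<eta> = \<epsilon> / k / 4"
  have \<eta>: "\<eta> > 0" using base k by (auto simp: \<eta>_def)
  obtain T where T: "open T" "A \<subseteq> T" "T - A \<in> lmeasurable" "emeasure lebesgue (T - A) < ennreal \<eta>"
    using sets_lebesgue_outer_open[of A \<eta>] \<eta> \<open>A \<in> lmeasurable\<close> by (auto simp: fmeasurable_def)
  have [measurable]: "T \<in> sets borel" using T by simp
  have "T = A \<union> (T - A)" using T(2) by auto
  then have "T \<in> lmeasurable" using fmeasurable.Un[OF \<open>A \<in> lmeasurable\<close> T(3)] by simp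
  then have Tf: "emeasure lborel T < \<infinity>" by (auto simp: fmeasurable_def)
  have T4: "measure lborel (T - A) < \<eta>"
  proof -
    have "emeasure lborel (T - A) < ennreal \<eta>" using T(4) by simp
    moreover from this have "emeasure lborel (T - A) = ennreal (measure lborel (T - A))"
      by (intro emeasure_eq_ennreal_measure) auto
    ultimately show ?thesis by (simp add: ennreal_less_iff)
  qed
  have iT: "integrable lborel (indicator T :: _ \<Rightarrow> real)" using Tf by (auto intro!: integrable_real_indicator)
  have iA: "integrable lborel (indicator A :: _ \<Rightarrow> real)" using base by (auto intro!: integrable_real_indicator)
  have "(LBINT x. \<bar>indicator A x - indicator T x :: real\<bar>) = (LBINT x. indicator (T - A) x)"
    using T(2) by (intro Bochner_Integration.integral_cong) (auto simp: indicator_def)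
  also have "\<dots> = measure lborel (T - A)" by simp
  also have "\<dots> < \<eta>" by (rule T4)
  finally have 1: "(LBINT x. \<bar>indicator A x - indicator T x :: real\<bar>) < \<eta>" .
  obtain \<delta> where \<delta>: "\<delta> > 0" "\<And>h. h \<noteq> 0 \<Longrightarrow> norm h < \<delta> \<Longrightarrow> \<bar>shift_dist (indicator T) h\<bar> < 2 * \<eta>"
    using shift_dist_open[OF T(1) Tf] \<eta> unfolding LIM_def by (metis diff_zero dist_norm dist_real_def mult_pos_pos zero_less_numeral)
  have "shift_dist (\<lambda>x. indicator A x *\<^sub>R c) h \<le> \<epsilon>" if h: "norm h < \<delta>" for h
  proof -
    have "shift_dist (indicator T) h < 2 * \<eta>"
      using \<delta>(2)[OF _ h] \<eta> by (cases "h = 0") (auto simp: shift_dist_def)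
    then have "shift_dist (indicator A) h \<le> 4 * \<eta>" using shift_dist_close[OF iA iT, of h] 1 by linarith
    moreover have "shift_dist (\<lambda>x. indicator A x *\<^sub>R c) h = \<bar>c\<bar> * shift_dist (indicator A) h"
    proof -
      have "\<bar>indicator A (x - h) *\<^sub>R c - indicator A x *\<^sub>R c\<bar> = \<bar>c\<bar> * \<bar>indicator A (x - h) - indicator A x\<bar>" for x
        unfolding real_scaleR_def abs_mult[symmetric] by (simp add: algebra_simps)
      then show ?thesis unfolding shift_dist_def by simp
    qed
    ultimately have "shift_dist (\<lambda>x. indicator A x *\<^sub>R c) h \<le> \<bar>c\<bar> * (4 * \<eta>)" by (simp add: mult_left_mono)
    also have "\<dots> \<le> k * (4 * \<eta>)" using \<eta> k by (intro mult_right_mono) auto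
    also have "\<dots> = \<epsilon>"
      using k by (simp add: \<eta>_def)
    finally show ?thesis .
  qed
  then show ?case using \<delta>(1) by blast
next
  case (add f g)
  obtain d1 where d1: "d1 > 0" "\<And>h. norm h < d1 \<Longrightarrow> shift_dist f h \<le> \<epsilon> / 2" using add.IH(1)[of "\<epsilon>/2"] add.prems by auto
  obtain d2 where d2: "d2 > 0" "\<And>h. norm h < d2 \<Longrightarrow> shift_dist g h \<le> \<epsilon> / 2" using add.IH(2)[of "\<epsilon>/2"] add.prems by auto
  have "shift_dist (\<lambda>x. f x + g x) h \<le> shift_dist f h + shift_dist g h" for h
  proof -
    have "shift_dist (\<lambda>x. f x + g x) h \<le> (LBINT x. \<bar>f (x - h) - f x\<bar> + \<bar>g (x - h) - g x\<bar>)"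
      unfolding shift_dist_def using add.hyps lborel_integrable_translate[OF add.hyps(1)] lborel_integrable_translate[OF add.hyps(2)]
      by (intro integral_mono) auto
    also have "\<dots> = shift_dist f h + shift_dist g h"
      unfolding shift_dist_def using add.hyps lborel_integrable_translate[OF add.hyps(1)] lborel_integrable_translate[OF add.hyps(2)] by simp
    finally show ?thesis .
  qed
  then have "shift_dist (\<lambda>x. f x + g x) h \<le> \<epsilon>" if "norm h < min d1 d2" for h
    using d1(2)[of h] d2(2)[of h] that by (smt (verit) field_sum_of_halves min_less_iff_conj)
  then show ?case using d1(1) d2(1) by (metis min_less_iff_conj)
next
  case (lim f s)
  have "(\<lambda>i. LBINT x. \<bar>f x - s i x\<bar>) \<longlonglongrightarrow> (\<integral>x. 0 \<partial>(lborel :: 'a measure))"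
  proof (rule integral_dominated_convergence)
    have fm: "f \<in> borel_measurable lborel" "\<And>i. s i \<in> borel_measurable lborel" using lim.hyps by auto
    then show "(\<lambda>x. \<bar>f x - s i x\<bar>) \<in> borel_measurable lborel" for i by measurable
    \<comment> \<open>The induction rule provides approximants bounded by
      \<open>2 * norm (f x)\<close>, hence the factor 3.\<close>
    show "integrable lborel (\<lambda>x. 3 * \<bar>f x\<bar>)" using lim.hyps by auto
    show "AE x in lborel. (\<lambda>i. \<bar>f x - s i x\<bar>) \<longlonglongrightarrow> 0"
    proof (rule AE_I2)
      fix x
      have "(\<lambda>i. \<bar>f x - s i x\<bar>) \<longlonglongrightarrow> \<bar>f x - f x\<bar>" using lim.hyps by (intro tendsto_intros) auto
      then show "(\<lambda>i. \<bar>f x - s i x\<bar>) \<longlonglongrightarrow> 0" by simp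
    qed
    show "AE x in lborel. norm \<bar>f x - s i x\<bar> \<le> 3 * \<bar>f x\<bar>" for i
    proof (rule AE_I2)
      fix x :: 'a
      have "norm (s i x) \<le> 2 * norm (f x)" using lim.hyps by auto
      then show "norm \<bar>f x - s i x\<bar> \<le> 3 * \<bar>f x\<bar>" by simp
    qed
  qed auto
  then have "(\<lambda>i. LBINT x. \<bar>f x - s i x\<bar>) \<longlonglongrightarrow> 0" by simp
  then obtain i where i: "(LBINT x. \<bar>f x - s i x\<bar>) < \<epsilon> / 4"
    using order_tendstoD(2)[of _ 0 sequentially "\<epsilon>/4"] lim.prems by (auto simp: eventually_sequentially)
  obtain \<delta> where \<delta>: "\<delta> > 0" "\<And>h. norm h < \<delta> \<Longrightarrow> shift_dist (s i) h \<le> \<epsilon> / 2" using lim.IH[of "\<epsilon>/2" i] lim.prems by auto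
  have "shift_dist f h \<le> \<epsilon>" if "norm h < \<delta>" for h
    using shift_dist_close[of f "s i" h] lim.hyps \<delta>(2)[OF that] i by auto
  then show ?case using \<delta>(1) by blast
qed

text \<open>The summand with factor 0 gives the normalized bump the shape of a combination of two
  kernels, which \<open>kernel_lincomb\<close> expects.\<close>

definition moll :: "real \<Rightarrow> 'a::euclidean_space \<Rightarrow> real" where
  "moll r z = (1 / bump_mass TYPE('a) r) * bump r z + 0 * bump r z"

definition moll_grad :: "real \<Rightarrow> 'a::euclidean_space \<Rightarrow> 'a" where
  "moll_grad r z = (1 / bump_mass TYPE('a) r) *\<^sub>R bump_grad r z + 0 *\<^sub>R bump_grad r z"

lemma kernel_moll: "kernel (moll r) (moll_grad r)"
  unfolding moll_def[abs_def] moll_grad_def[abs_def] by (intro kernel_lincomb kernel_bump)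

lemma moll_eq: "moll r (z::'a::euclidean_space) = bump r z / bump_mass TYPE('a) r"
  by (simp add: moll_def)

lemma moll_commute: "moll r (x - y) = moll r (y - x)" "moll_grad r (x - y) = - moll_grad r (y - x)"
  using bump_commute[of r x y] by (simp_all add: moll_def moll_grad_def)

lemma moll_props:
  fixes z :: "'a::euclidean_space"
  assumes "r > 0"
  shows "0 \<le> moll r z" "2 * r \<le> norm z \<Longrightarrow> moll r z = 0" "2 * r \<le> norm z \<Longrightarrow> moll_grad r z = 0"
    "integrable lborel (moll r :: 'a \<Rightarrow> real)" "(LBINT z. moll r (z::'a)) = 1"
  using assms bump_mass_pos[where 'a='a, OF assms] bump_integrable[OF assms]
  by (auto simp: moll_eq[abs_def] moll_grad_def bump_props bump_mass_def)

lemma moll_measurable [measurable]: "moll r \<in> borel_measurable borel" "moll_grad r \<in> borel_measurable borel"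
  unfolding moll_def[abs_def] moll_grad_def[abs_def] by measurable

lemma moll_integral_reflect:
  assumes "r > 0" shows "integrable lborel (\<lambda>z. moll r (x - z))" "(LBINT z. moll r (x - z)) = 1"
proof -
  show "(LBINT z. moll r (x - z)) = 1"
    using lborel_integral_reflect[of "moll r" x] moll_props(5)[OF assms] by simp
  \<comment> \<open>The integral of a non-integrable function is 0 by convention, so the value 1
    already proves integrability.\<close>
  then show "integrable lborel (\<lambda>z. moll r (x - z))"
    using not_integrable_integral_eq by fastforce
qed

lemma conv_moll_norm_le:
  fixes f :: "'a::euclidean_space \<Rightarrow> 'b::euclidean_space"
  assumes r: "r > 0" and f: "f \<in> borel_measurable lborel" "\<And>z. norm (f z) \<le> M"
  shows "norm (conv (moll r) f x) \<le> M"
proof -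
  have "norm (conv (moll r) f x) \<le> (LBINT z. moll r (x - z) * M)"
    unfolding conv_def
  proof (rule Bochner_Integration.integral_norm_bound_integral)
    show "integrable lborel (\<lambda>z. moll r (x - z) *\<^sub>R f z)"
      using kernel_moll[of r] moll_props(2)[OF r]
      by (intro conv_integrable[of _ "2 * r" _ M] f) (auto simp: kernel_def)
    show "norm (moll r (x - z) *\<^sub>R f z) \<le> moll r (x - z) * M" for z
      unfolding norm_scaleR abs_of_nonneg[OF moll_props(1)[OF r]]
      by (rule mult_left_mono[OF f(2) moll_props(1)[OF r]])
  qed (use moll_integral_reflect[OF r, of x] in auto)
  also have "\<dots> = M" using moll_integral_reflect[OF r, of x] by simp
  finally show ?thesis .
qed

text \<open>The error at \<open>x\<close> is at most the average of
  \<open>\<bar>f (x - v) - f x\<bar>\<close> with weight \<open>moll r v\<close>. After Fubini this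
  is an average of \<open>shift_dist f v\<close> over \<open>norm v < 2 * r\<close>, which is why
  \<open>r\<close> has to stay below half the radius given by
  \<open>shift_dist_small\<close>.\<close>

lemma conv_moll_close:
  fixes f :: "'a::euclidean_space \<Rightarrow> real"
  assumes f: "f \<in> borel_measurable lborel" "\<And>z. \<bar>f z\<bar> \<le> M" "\<And>z. R < norm z \<Longrightarrow> f z = 0" and e: "\<epsilon> > 0"
  shows "\<exists>\<delta>>0. \<forall>r. 0 < r \<and> r < \<delta> \<longrightarrow> (LBINT x. \<bar>conv (moll r) f x - f x\<bar>) \<le> \<epsilon>
       \<and> integrable lborel (\<lambda>x. conv (moll r) f x - f x)"
proof -
  have M: "M \<ge> 0" using f(2)[of 0] by linarith
  have [measurable]: "f \<in> borel_measurable borel" using f by simp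
  have fi: "integrable lborel f"
    by (rule integrable_bounded_support[of _ M 0 R]) (use f in \<open>auto\<close>)
  obtain \<delta> where \<delta>: "\<delta> > 0" "\<And>h. norm h < \<delta> \<Longrightarrow> shift_dist f h \<le> \<epsilon>" using shift_dist_small[OF fi e] by auto
  have "(LBINT x. \<bar>conv (moll r) f x - f x\<bar>) \<le> \<epsilon> \<and> integrable lborel (\<lambda>x. conv (moll r) f x - f x)"
    if r: "0 < r" "r < \<delta> / 2" for r
  proof -
    have ci: "integrable lborel (conv (moll r) f)"
    proof (rule continuous_support_bounded(1)[of _ "\<bar>R\<bar> + 2 * r"])
      show "continuous_on UNIV (conv (moll r) f)"
        using C1_conv[OF kernel_moll f(1)] f(2) by (auto intro!: C1_continuous)
      fix x :: 'a assume x: "\<bar>R\<bar> + 2 * r < norm x"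
      show "conv (moll r) f x = 0"
      proof (rule conv_zero)
        fix z assume "moll r (x - z) \<noteq> 0"
        then have "norm (x - z) < 2 * r" using moll_props(2)[OF r(1), of "x - z"] by force
        moreover have "norm x \<le> norm (x - z) + norm z" by norm
        ultimately show "f z = 0" using x by (intro f(3)) linarith
      qed
    qed
    obtain B where B: "\<And>z. \<bar>moll r (z::'a)\<bar> \<le> B"
      by (rule compactly_supported_bounded[of "moll r" "2*r"])
         (use kernel_moll[of r] moll_props(2)[OF r(1)] in \<open>auto simp: kernel_def\<close>)
    define H where "H x v = moll r v * \<bar>f (x - v) - f x\<bar>" for x v
    have Hi: "integrable (lborel \<Otimes>\<^sub>M lborel) (case_prod H)"
    proof (rule integrable_pair_bounded_support[where B="B * (2 * M)" and R="\<bar>R\<bar> + 2 * r"])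
      show "case_prod H \<in> borel_measurable (borel \<Otimes>\<^sub>M borel)" unfolding H_def by measurable
      fix x v
      have "\<bar>f (x - v) - f x\<bar> \<le> 2 * M" using f(2)[of "x - v"] f(2)[of x] by linarith
      then show "\<bar>H x v\<bar> \<le> B * (2 * M)" unfolding H_def abs_mult using B[of v] M
        by (intro mult_mono) (auto intro: order_trans[OF abs_ge_zero B])
      show "H x v = 0" if "\<bar>R\<bar> + 2 * r < norm v" for x v :: 'a
        using moll_props(2)[OF r(1), of v] that by (simp add: H_def)
      show "H x v = 0" if x: "\<bar>R\<bar> + 2 * r < norm x" for x v :: 'a
      proof (cases "2 * r \<le> norm v")
        case False
        have "norm x \<le> norm (x - v) + norm v" by norm
        then have "f (x - v) = 0" "f x = 0" using x False r by (auto intro!: f(3))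
        then show ?thesis by (simp add: H_def)
      qed (simp add: H_def moll_props(2)[OF r(1)])
    qed
    have pt: "\<bar>conv (moll r) f x - f x\<bar> \<le> (LBINT v. H x v)" for x
    proof -
      have i1: "integrable lborel (\<lambda>z. moll r (x - z) *\<^sub>R f z)"
        using kernel_moll[of r] moll_props(2)[OF r(1)] f
        by (intro conv_integrable[of _ "2 * r" _ M]) (auto simp: kernel_def)
      have "conv (moll r) f x - f x = (LBINT z. moll r (x - z) * (f z - f x))"
        using i1 moll_integral_reflect[OF r(1), of x] unfolding conv_def by (simp add: right_diff_distrib)
      also have "\<dots> = (LBINT v. moll r v * (f (x - v) - f x))"
        using lborel_integral_reflect[of "\<lambda>z. moll r (x - z) * (f z - f x)" x] by simp
      also have "\<bar>\<dots>\<bar> \<le> (LBINT v. \<bar>moll r v * (f (x - v) - f x)\<bar>)"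
        by (rule integral_abs_bound)
      also have "\<dots> = (LBINT v. H x v)" unfolding H_def abs_mult abs_of_nonneg[OF moll_props(1)[OF r(1)]] ..
      finally show ?thesis .
    qed
    have "(LBINT x. \<bar>conv (moll r) f x - f x\<bar>) \<le> (LBINT x. (LBINT v. H x v))"
      using ci fi pt lborel_pair.integrable_fst[OF Hi] by (intro integral_mono) auto
    also have "\<dots> = (LBINT v. (LBINT x. H x v))" using lborel_pair.Fubini_integral[OF Hi] by simp
    also have "\<dots> = (LBINT v. moll r v * shift_dist f v)"
      unfolding H_def shift_dist_def by simp
    also have "\<dots> \<le> (LBINT v. moll r (v::'a) * \<epsilon>)"
    proof (rule integral_mono)
      have "integrable lborel (\<lambda>v. LBINT x. H x v)" by (rule lborel_pair.integrable_snd[OF Hi])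
      then show "integrable lborel (\<lambda>v. moll r v * shift_dist f v)" by (simp add: H_def shift_dist_def)
      show "integrable lborel (\<lambda>v::'a. moll r v * \<epsilon>)" using moll_props(4)[where 'a='a, OF r(1)] by simp
      show "moll r v * shift_dist f v \<le> moll r v * \<epsilon>" for v
        using moll_props(1,2)[OF r(1), of v] \<delta>(2)[of v] r by (cases "2 * r \<le> norm v") (auto intro!: mult_left_mono)
    qed
    also have "\<dots> = \<epsilon>" using moll_props(4,5)[where 'a='a, OF r(1)] by simp
    finally show ?thesis using ci fi by auto
  qed
  then show ?thesis using \<delta>(1) by (intro exI[of _ "\<delta>/2"]) auto
qed

lemma divergence_conv:
  assumes K: "kernel k G" and f: "f \<in> borel_measurable lborel" "\<And>z. norm (f z) \<le> M"
  shows "divergence (conv k f) x = (LBINT z. G (x - z) \<bullet> f z)"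
proof -
  note I = conv_gradient_continuous(2)[OF K f]
  have "divergence (conv k f) x = (\<Sum>b\<in>Basis. LBINT z. ((G (x - z) \<bullet> b) *\<^sub>R f z) \<bullet> b)"
    unfolding divergence_def frechet_derivative_conv[OF K f] unfolding conv_def by (simp only: integral_inner_left[OF I])
  also have "\<dots> = (LBINT z. (\<Sum>b\<in>Basis. ((G (x - z) \<bullet> b) *\<^sub>R f z) \<bullet> b))"
    by (rule Bochner_Integration.integral_sum[symmetric]) (rule integrable_inner_left, simp add: I)
  also have "\<dots> = (LBINT z. G (x - z) \<bullet> f z)"
  proof (intro Bochner_Integration.integral_cong refl)
    show "(\<Sum>b\<in>Basis. ((G (x - z) \<bullet> b) *\<^sub>R f z) \<bullet> b) = G (x - z) \<bullet> f z" for z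
      unfolding euclidean_inner[of "G (x - z)" "f z"] by simp
  qed
  finally show ?thesis .
qed

text \<open>Because \<open>moll_grad\<close> is odd, Fubini moves the mollification together with
  the derivative from \<open>f\<close> to \<open>g\<close>. A rough \<open>f\<close> can thus be
  tested with a field \<open>g\<close> that is only continuous.\<close>

lemma integral_gradient_conv_moll:
  fixes f :: "'a::euclidean_space \<Rightarrow> real"
  assumes r: "r > 0"
    and f: "f \<in> borel_measurable lborel" "\<And>z. \<bar>f z\<bar> \<le> M" "\<And>z. R < norm z \<Longrightarrow> f z = 0"
    and g: "continuous_on UNIV g" "\<And>x. norm (g x) \<le> L" "\<And>x. R < norm x \<Longrightarrow> g x = 0"
  shows "(LBINT x. frechet_derivative (conv (moll r) f) (at x) (g x))
     = - (LBINT z. f z * divergence (conv (moll r) g) z)"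
proof -
  let ?G = "moll_grad r :: 'a \<Rightarrow> 'a"
  have [measurable]: "f \<in> borel_measurable borel" "g \<in> borel_measurable borel"
    using f g by (auto intro: borel_measurable_continuous_onI)
  have f': "\<And>z. norm (f z) \<le> M" using f(2) by simp
  have M: "M \<ge> 0" using f(2)[of 0] by linarith
  have L: "L \<ge> 0" using g(2)[of 0] norm_ge_zero[of "g 0"] by linarith
  obtain B where B: "\<And>z. \<bar>norm (?G z)\<bar> \<le> B"
    by (rule compactly_supported_bounded[of "\<lambda>z. norm (?G z)" "2*r"])
       (use kernel_moll[of r] moll_props(3)[OF r] in \<open>auto simp: kernel_def intro!: continuous_intros\<close>)
  have B0: "B \<ge> 0" using B[of 0] by linarith
  define H where "H x z = (?G (x - z) \<bullet> g x) * f z" for x z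
  have Hi: "integrable (lborel \<Otimes>\<^sub>M lborel) (case_prod H)"
  proof (rule integrable_pair_bounded_support[where B="B * L * M" and R=R])
    show "case_prod H \<in> borel_measurable (borel \<Otimes>\<^sub>M borel)" unfolding H_def by measurable
    fix x z
    have "\<bar>?G (x - z) \<bullet> g x\<bar> \<le> norm (?G (x - z)) * norm (g x)" by (rule Cauchy_Schwarz_ineq2)
    also have "\<dots> \<le> B * L" using B[of "x - z"] g(2)[of x] B0 by (intro mult_mono) auto
    finally show "\<bar>H x z\<bar> \<le> B * L * M" unfolding H_def abs_mult using f(2)[of z] B0 L by (intro mult_mono) auto
  qed (use f(3) g(3) in \<open>auto simp: H_def\<close>)
  have "(LBINT x. frechet_derivative (conv (moll r) f) (at x) (g x)) = (LBINT x. LBINT z. H x z)"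
    unfolding frechet_derivative_conv[OF kernel_moll f(1) f'] unfolding conv_def H_def by simp
  also have "\<dots> = (LBINT z. LBINT x. H x z)" using lborel_pair.Fubini_integral[OF Hi] by simp
  also have "\<dots> = (LBINT z. - (f z * divergence (conv (moll r) g) z))"
  proof (intro Bochner_Integration.integral_cong refl)
    fix z
    have "(LBINT x. H x z) = (LBINT x. - f z * (?G (z - x) \<bullet> g x))"
    proof (intro Bochner_Integration.integral_cong refl)
      show "H x z = - f z * (?G (z - x) \<bullet> g x)" for x
        unfolding H_def moll_commute(2)[of r x z] by simp
    qed
    also have "\<dots> = - f z * (LBINT x. ?G (z - x) \<bullet> g x)" by (rule integral_mult_right_zero)
    also have "(LBINT x. ?G (z - x) \<bullet> g x) = divergence (conv (moll r) g) z"
      using divergence_conv[OF kernel_moll _ g(2)] by simp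
    finally show "(LBINT x. H x z) = - (f z * divergence (conv (moll r) g) z)" by simp
  qed
  finally show ?thesis by simp
qed

text \<open>A continuous field becomes admissible after mollification, provided that its support
  leaves the margin \<open>2 * r\<close> inside \<open>W\<close>; averaging does not raise the norm
  above 1.\<close>

lemma test_field_conv_moll:
  fixes g :: "'a::euclidean_space \<Rightarrow> 'a"
  assumes r: "r > 0" and g: "continuous_on UNIV g" "\<And>x. norm (g x) \<le> 1" "\<And>x. x \<notin> C \<Longrightarrow> g x = 0"
    and C: "compact C" "(\<Union>x\<in>C. cball x (2 * r)) \<subseteq> W"
  shows "conv (moll r) g \<in> test_fields W"
proof (rule test_fieldsI)
  have gm: "g \<in> borel_measurable lborel" using g(1) by (auto intro: borel_measurable_continuous_onI)
  show "C1 (conv (moll r) g)" by (rule C1_conv[OF kernel_moll gm g(2)])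
  show "norm (conv (moll r) g x) \<le> 1" for x by (rule conv_moll_norm_le[OF r gm g(2)])
  let ?C = "{x + y |x y. x \<in> C \<and> y \<in> cball 0 (2 * r)}"
  show "compact ?C" using C(1) by (intro compact_sums) auto
  show "?C \<subseteq> W"
  proof
    fix p assume "p \<in> ?C"
    then obtain x y where "x \<in> C" "y \<in> cball 0 (2 * r)" "p = x + y" by blast
    then have "p \<in> cball x (2 * r)" by (auto simp: dist_norm)
    then show "p \<in> W" using C(2) \<open>x \<in> C\<close> by blast
  qed
  show "conv (moll r) g x = 0" if x: "x \<notin> ?C" for x
  proof (rule conv_zero)
    fix z assume "moll r (x - z) \<noteq> 0"
    then have "norm (x - z) \<le> 2 * r" using moll_props(2)[OF r, of "x - z"] by force
    then have "z \<notin> C" using x by (auto simp: algebra_simps)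
    then show "g z = 0" by (rule g(3))
  qed
qed

section \<open>Variation bounds and cutting a function at a level\<close>

lemma C1_compose_real:
  fixes g :: "'a::euclidean_space \<Rightarrow> real"
  assumes T: "\<And>t. (T has_real_derivative T' t) (at t)" "continuous_on UNIV T'" and g: "C1 g"
  shows "C1 (\<lambda>x. T (g x))" "frechet_derivative (\<lambda>x. T (g x)) (at x) h = T' (g x) * frechet_derivative g (at x) h"
proof -
  have D: "((\<lambda>x. T (g x)) has_derivative (\<lambda>h. T' (g x) * frechet_derivative g (at x) h)) (at x)" for x
    using has_derivative_compose[OF C1_has_derivative[OF g], of T "(*) (T' (g x))" x]
      T(1)[of "g x"] by (simp add: has_field_derivative_def)
  show "C1 (\<lambda>x. T (g x))"
    by (rule C1I[OF D]) (auto intro!: continuous_intros C1_gradient_continuous g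
          continuous_on_compose2[OF T(2) C1_continuous[OF g]])
  show "frechet_derivative (\<lambda>x. T (g x)) (at x) h = T' (g x) * frechet_derivative g (at x) h"
    using frechet_derivative_at[OF D[of x]] by metis
qed

lemma test_field_integrable:
  fixes f :: "'a::euclidean_space \<Rightarrow> real"
  assumes "\<phi> \<in> test_fields W" and f: "f \<in> borel_measurable lborel" "\<And>x. \<bar>f x\<bar> \<le> M"
  shows "integrable lborel (\<lambda>x. f x * divergence \<phi> x)"
proof -
  obtain R where R: "C1 \<phi>" "\<And>x. R < norm x \<Longrightarrow> divergence \<phi> x = 0" using test_fieldsE[OF assms(1)] by metis
  obtain B where B: "B \<ge> 0" "\<And>x. \<bar>divergence \<phi> x\<bar> \<le> B"
    using continuous_support_bounded(2)[OF divergence_continuous[OF R(1)] R(2)] by blast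
  have [measurable]: "divergence \<phi> \<in> borel_measurable borel" "f \<in> borel_measurable borel"
    using divergence_measurable[OF R(1)] f by auto
  show ?thesis
  proof (rule integrable_bounded_support[of _ "M * B" 0 R])
    show "norm (f x * divergence \<phi> x) \<le> M * B" for x
      using f(2)[of x] B unfolding real_norm_def abs_mult by (intro mult_mono) (auto intro: order_trans[OF abs_ge_zero])
  qed (use R in auto)
qed

text \<open>An upper bound for the variation in \<open>W\<close> of a function, stated without
  forming the supremum, so that estimates stay in the reals. For indicators of Borel sets it bounds
  the perimeter, see \<open>perimeter_le_iff\<close>.\<close>

definition var_le :: "('a::euclidean_space \<Rightarrow> real) \<Rightarrow> 'a set \<Rightarrow> real \<Rightarrow> bool" where
  "var_le f W c \<longleftrightarrow> (\<forall>\<phi>\<in>test_fields W. (LBINT x. f x * divergence \<phi> x) \<le> c)"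

lemma zero_test_field: "(\<lambda>_. 0) \<in> test_fields W"
  by (rule test_fieldsI[of _ "{}"]) auto

text \<open>One branch of a hyperbola replaces the kink of the positive part at \<open>a\<close>.
  Its slope lies in the unit interval, which is what lets the slopes serve as convex weights of two
  test fields.\<close>

lemma smooth_pos_part:
  fixes a \<epsilon> :: real
  assumes e: "\<epsilon> > 0"
  defines "q \<equiv> \<lambda>t. sqrt ((t - a)\<^sup>2 + \<epsilon>\<^sup>2)"
  shows "((\<lambda>t. (t - a + q t) / 2) has_real_derivative (1 + (t - a) / q t) / 2) (at t)"
    and "continuous_on UNIV (\<lambda>t. (1 + (t - a) / q t) / 2)"
    and "0 \<le> (1 + (t - a) / q t) / 2" "(1 + (t - a) / q t) / 2 \<le> 1"
    and "\<bar>(t - a + q t) / 2 - max (t - a) 0\<bar> \<le> \<epsilon>"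
proof -
  have pos: "(t - a)\<^sup>2 + \<epsilon>\<^sup>2 > 0" for t using e by (simp add: add_nonneg_pos)
  have q0: "q t > 0" for t using pos[of t] by (simp add: q_def)
  show "((\<lambda>t. (t - a + q t) / 2) has_real_derivative (1 + (t - a) / q t) / 2) (at t)"
    unfolding q_def using pos[of t] q0[of t]
    by (auto intro!: derivative_eq_intros simp: divide_simps q_def)
  have "q t \<noteq> 0" for t using q0[of t] by simp
  then show "continuous_on UNIV (\<lambda>t. (1 + (t - a) / q t) / 2)"
    unfolding q_def by (intro continuous_intros) auto
  have "\<bar>t - a\<bar> \<le> q t" unfolding q_def by (rule real_le_rsqrt) (use e in simp)
  then have "\<bar>(t - a) / q t\<bar> \<le> 1" using q0[of t] by (simp add: abs_divide)
  moreover have "0 \<le> (1 + u) / 2 \<and> (1 + u) / 2 \<le> 1" if "\<bar>u\<bar> \<le> 1" for u :: real using that by auto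
  ultimately show "0 \<le> (1 + (t - a) / q t) / 2" "(1 + (t - a) / q t) / 2 \<le> 1" by blast+
  have "q t \<le> \<bar>t - a\<bar> + \<epsilon>"
    unfolding q_def by (rule real_le_lsqrt) (use e in \<open>auto simp: power2_eq_square algebra_simps\<close>)
  with \<open>\<bar>t - a\<bar> \<le> q t\<close> show "\<bar>(t - a + q t) / 2 - max (t - a) 0\<bar> \<le> \<epsilon>"
    by (auto simp: max_def abs_if field_simps split: if_splits)
qed

text \<open>The coarea inequality for a single level: cutting \<open>f\<close> at height \<open>a\<close> does not create variation.
  For a smooth \<open>g\<close> the two competitors are combined into the single field
  \<open>T1'(g) \<phi>1 + T2'(g) \<phi>2\<close>, where \<open>T1 + T2 = id\<close>; mollifying this field transfers the bound to \<open>f\<close>.\<close>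
lemma variation_split:
  fixes f :: "'a::euclidean_space \<Rightarrow> real"
  assumes W: "open W"
    and f: "f \<in> borel_measurable lborel" "\<And>z. \<bar>f z\<bar> \<le> M" "\<And>z. R < norm z \<Longrightarrow> f z = 0"
    and c: "var_le f W c" and \<phi>1: "\<phi>1 \<in> test_fields W" and \<phi>2: "\<phi>2 \<in> test_fields W"
  shows "(LBINT x. min (f x) a * divergence \<phi>1 x) + (LBINT x. max (f x - a) 0 * divergence \<phi>2 x) \<le> c"
proof -
  have [measurable]: "f \<in> borel_measurable borel" using f by simp
  have M: "M \<ge> 0" using f(2)[of 0] by linarith
  obtain R1 where R1: "C1 \<phi>1" "\<And>x. norm (\<phi>1 x) \<le> 1" "\<And>x. R1 < norm x \<Longrightarrow> \<phi>1 x = 0" "\<And>x. R1 < norm x \<Longrightarrow> divergence \<phi>1 x = 0"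
    using test_fieldsE[OF \<phi>1] by metis
  obtain R2 where R2: "C1 \<phi>2" "\<And>x. norm (\<phi>2 x) \<le> 1" "\<And>x. R2 < norm x \<Longrightarrow> \<phi>2 x = 0" "\<And>x. R2 < norm x \<Longrightarrow> divergence \<phi>2 x = 0"
    using test_fieldsE[OF \<phi>2] by metis
  obtain B1 where B1: "B1 \<ge> 0" "\<And>x. \<bar>divergence \<phi>1 x\<bar> \<le> B1"
    using continuous_support_bounded(2)[OF divergence_continuous[OF R1(1)] R1(4)] by blast
  obtain B2 where B2: "B2 \<ge> 0" "\<And>x. \<bar>divergence \<phi>2 x\<bar> \<le> B2"
    using continuous_support_bounded(2)[OF divergence_continuous[OF R2(1)] R2(4)] by blast
  have di: "integrable lborel (\<lambda>x. \<bar>divergence \<phi>1 x\<bar>)" "integrable lborel (\<lambda>x. \<bar>divergence \<phi>2 x\<bar>)"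
    using continuous_support_bounded(1)[OF divergence_continuous[OF R1(1)] R1(4)]
       continuous_support_bounded(1)[OF divergence_continuous[OF R2(1)] R2(4)] by auto
  define C where "C = closure {x. \<phi>1 x \<noteq> 0} \<union> closure {x. \<phi>2 x \<noteq> 0}"
  have C: "compact C" "C \<subseteq> W" using \<phi>1 \<phi>2 by (auto simp: C_def test_fields_iff)
  have Cz: "\<phi>1 x = 0" "\<phi>2 x = 0" if "x \<notin> C" for x
    using that closure_subset[of "{x. \<phi>1 x \<noteq> 0}"] closure_subset[of "{x. \<phi>2 x \<noteq> 0}"] by (auto simp: C_def)
  obtain \<rho> where \<rho>: "\<rho> > 0" "(\<Union>x\<in>C. ball x \<rho>) \<subseteq> W"
    using compact_subset_open_imp_ball_epsilon_subset[OF C(1) W C(2)] by blast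
  \<comment> \<open>Two errors are collected: replacing \<open>f\<close> by its mollification is
    small in L1 and is multiplied by the sup bounds \<open>B1\<close>, \<open>B2\<close>; replacing
    the positive part by \<open>T2\<close> is uniformly small and is multiplied by the
    integrals.\<close>
  define K where "K = B1 + B2 + (LBINT x. \<bar>divergence \<phi>1 x\<bar>) + (LBINT x. \<bar>divergence \<phi>2 x\<bar>)"
  have K: "K \<ge> 0" unfolding K_def using B1 B2 by (intro add_nonneg_nonneg integral_nonneg_AE) auto
  let ?I = "(LBINT x. min (f x) a * divergence \<phi>1 x) + (LBINT x. max (f x - a) 0 * divergence \<phi>2 x)"
  have main: "?I \<le> c + K * \<epsilon>" if e: "\<epsilon> > 0" for \<epsilon>
  proof -
    obtain \<delta> where \<delta>: "\<delta> > 0" "\<And>r. 0 < r \<Longrightarrow> r < \<delta> \<Longrightarrow> (LBINT x. \<bar>conv (moll r) f x - f x\<bar>) \<le> \<epsilon>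
       \<and> integrable lborel (\<lambda>x. conv (moll r) f x - f x)" using conv_moll_close[of f M R \<epsilon>] f e by auto
    \<comment> \<open>The first bound makes the mollification of \<open>f\<close> L1-close to
      \<open>f\<close>; the second keeps the support of the mollified field inside
      \<open>W\<close>.\<close>
    define r where "r = min (\<delta> / 2) (\<rho> / 4)"
    have r: "0 < r" "r < \<delta>" "2 * r < \<rho>" using \<delta>(1) \<rho>(1) by (auto simp: r_def)
    define g where "g = conv (moll r) f"
    have g: "C1 g" unfolding g_def by (rule C1_conv[OF kernel_moll f(1), of M]) (use f in auto)
    have [measurable]: "g \<in> borel_measurable borel" using C1_continuous[OF g] by (rule borel_measurable_continuous_onI)
    have gM: "\<bar>g x\<bar> \<le> M" for x using conv_moll_norm_le[OF r(1) f(1), of M x] f(2) by (simp add: g_def)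
    have close: "(LBINT x. \<bar>g x - f x\<bar>) \<le> \<epsilon>" "integrable lborel (\<lambda>x. \<bar>g x - f x\<bar>)" using \<delta>(2)[OF r(1,2)] by (auto simp: g_def)
    define q where "q t = sqrt ((t - a)\<^sup>2 + \<epsilon>\<^sup>2)" for t
    define T2 where "T2 t = (t - a + q t) / 2" for t
    define D2 where "D2 t = (1 + (t - a) / q t) / 2" for t
    have T2: "(T2 has_real_derivative D2 t) (at t)" "continuous_on UNIV D2" "0 \<le> D2 t" "D2 t \<le> 1"
        "\<bar>T2 t - max (t - a) 0\<bar> \<le> \<epsilon>" for t
      unfolding T2_def[abs_def] D2_def[abs_def] q_def by (rule smooth_pos_part[OF e])+
    have T1: "((\<lambda>t. t - T2 t) has_real_derivative (1 - D2 t)) (at t)" "continuous_on UNIV (\<lambda>t. 1 - D2 t)" for t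
      using T2(1,2) by (auto intro!: derivative_eq_intros continuous_intros)
    note c1 = C1_compose_real[OF T1 g] and c2 = C1_compose_real[OF T2(1,2) g]
    define \<psi> where "\<psi> x = (1 - D2 (g x)) *\<^sub>R \<phi>1 x + D2 (g x) *\<^sub>R \<phi>2 x" for x
    have D2g: "continuous_on UNIV (\<lambda>x. D2 (g x))" by (rule continuous_on_compose2[OF T2(2) C1_continuous[OF g]]) auto
    have \<psi>c: "continuous_on UNIV \<psi>" unfolding \<psi>_def[abs_def]
      by (intro continuous_intros D2g C1_continuous R1 R2)
    have \<psi>1: "norm (\<psi> x) \<le> 1" for x
    proof -
      have "norm (\<psi> x) \<le> (1 - D2 (g x)) * 1 + D2 (g x) * 1"
        unfolding \<psi>_def using T2(3,4)[of "g x"] R1(2)[of x] R2(2)[of x]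
        by (intro order_trans[OF norm_triangle_ineq] add_mono) (auto simp: mult_left_le)
      then show ?thesis by simp
    qed
    have \<psi>0: "\<psi> x = 0" if "x \<notin> C" for x using Cz[OF that] by (simp add: \<psi>_def)
    have "conv (moll r) \<psi> \<in> test_fields W"
    proof (rule test_field_conv_moll[OF r(1) \<psi>c \<psi>1 \<psi>0 C(1)])
      show "(\<Union>x\<in>C. cball x (2 * r)) \<subseteq> W" using \<rho>(2) r(3) by fastforce
    qed
    then have "(LBINT z. f z * divergence (conv (moll r) \<psi>) z) \<le> c" using c by (simp add: var_le_def)
    moreover have "(LBINT x. frechet_derivative g (at x) (\<psi> x)) = - (LBINT z. f z * divergence (conv (moll r) \<psi>) z)"
      unfolding g_def
      by (rule integral_gradient_conv_moll[OF r(1) f(1,2), of "max R (max R1 R2)" \<psi> 1])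
         (use f(3) R1(3) R2(3) \<psi>c \<psi>1 in \<open>auto simp: \<psi>_def\<close>)
    \<comment> \<open>By the chain rule both truncations have the gradient of \<open>g\<close> as
      gradient, multiplied by their weight, so that the two pairings add up to one pairing with
      \<psi>.\<close>
    moreover have "(LBINT x. (g x - T2 (g x)) * divergence \<phi>1 x) + (LBINT x. T2 (g x) * divergence \<phi>2 x)
       = - (LBINT x. frechet_derivative g (at x) (\<psi> x))"
    proof -
      note p1 = integration_by_parts[OF c1(1) R1(1) R1(3), simplified] and p2 = integration_by_parts[OF c2(1) R2(1) R2(3), simplified]
      have L: "linear (frechet_derivative g (at x))" for x
        using C1_has_derivative[OF g] has_derivative_linear by blast
      have "(LBINT x. frechet_derivative g (at x) (\<psi> x)) =
         (LBINT x. frechet_derivative (\<lambda>x. g x - T2 (g x)) (at x) (\<phi>1 x) + frechet_derivative (\<lambda>x. T2 (g x)) (at x) (\<phi>2 x))"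
        unfolding c1(2) c2(2) \<psi>_def by (simp add: linear_add[OF L] linear_cmul[OF L])
      also have "\<dots> = (LBINT x. frechet_derivative (\<lambda>x. g x - T2 (g x)) (at x) (\<phi>1 x)) + (LBINT x. frechet_derivative (\<lambda>x. T2 (g x)) (at x) (\<phi>2 x))"
        using p1(3) p2(3) by (rule Bochner_Integration.integral_add)
      finally show ?thesis using p1(1) p2(1) by simp
    qed
    ultimately have le: "(LBINT x. (g x - T2 (g x)) * divergence \<phi>1 x) + (LBINT x. T2 (g x) * divergence \<phi>2 x) \<le> c" by simp
    have err: "(LBINT x. u x * divergence \<phi> x) - (LBINT x. v x * divergence \<phi> x) \<le> B * \<epsilon> + \<epsilon> * (LBINT x. \<bar>divergence \<phi> x\<bar>)"
      if uv: "integrable lborel (\<lambda>x. u x * divergence \<phi> x)" "integrable lborel (\<lambda>x. v x * divergence \<phi> x)"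
        "\<And>x. \<bar>u x - v x\<bar> \<le> \<bar>g x - f x\<bar> + \<epsilon>" and B: "B \<ge> 0" "\<And>x. \<bar>divergence \<phi> x\<bar> \<le> B"
        and di: "integrable lborel (\<lambda>x. \<bar>divergence \<phi> x\<bar>)" for u v \<phi> B
    proof -
      have "(LBINT x. u x * divergence \<phi> x) - (LBINT x. v x * divergence \<phi> x) = (LBINT x. u x * divergence \<phi> x - v x * divergence \<phi> x)"
        using uv by simp
      also have "\<dots> \<le> (LBINT x. B * \<bar>g x - f x\<bar> + \<epsilon> * \<bar>divergence \<phi> x\<bar>)"
      proof (rule integral_mono)
        fix x
        have "u x * divergence \<phi> x - v x * divergence \<phi> x \<le> \<bar>u x - v x\<bar> * \<bar>divergence \<phi> x\<bar>"
          by (metis abs_ge_self abs_mult left_diff_distrib)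
        also have "\<dots> \<le> (\<bar>g x - f x\<bar> + \<epsilon>) * \<bar>divergence \<phi> x\<bar>" by (intro mult_right_mono uv) auto
        also have "\<dots> \<le> B * \<bar>g x - f x\<bar> + \<epsilon> * \<bar>divergence \<phi> x\<bar>"
          using mult_left_mono[OF B(2)[of x], of "\<bar>g x - f x\<bar>"] by (simp add: algebra_simps)
        finally show "u x * divergence \<phi> x - v x * divergence \<phi> x \<le> B * \<bar>g x - f x\<bar> + \<epsilon> * \<bar>divergence \<phi> x\<bar>" .
      qed (use uv di close in auto)
      also have "\<dots> = B * (LBINT x. \<bar>g x - f x\<bar>) + \<epsilon> * (LBINT x. \<bar>divergence \<phi> x\<bar>)"
        using di close by simp
      also have "\<dots> \<le> B * \<epsilon> + \<epsilon> * (LBINT x. \<bar>divergence \<phi> x\<bar>)" using close B by (simp add: mult_left_mono)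
      finally show ?thesis .
    qed
    have mi: "integrable lborel (\<lambda>x. min (f x) a * divergence \<phi>1 x)"
    proof (rule test_field_integrable[OF \<phi>1, of _ "M + \<bar>a\<bar>"])
      show "\<bar>min (f x) a\<bar> \<le> M + \<bar>a\<bar>" for x using f(2)[of x] M by linarith
    qed simp
    have ma: "integrable lborel (\<lambda>x. max (f x - a) 0 * divergence \<phi>2 x)"
    proof (rule test_field_integrable[OF \<phi>2, of _ "M + \<bar>a\<bar>"])
      show "\<bar>max (f x - a) 0\<bar> \<le> M + \<bar>a\<bar>" for x using f(2)[of x] M by linarith
    qed simp
    have e1: "(LBINT x. min (f x) a * divergence \<phi>1 x) - (LBINT x. (g x - T2 (g x)) * divergence \<phi>1 x)
        \<le> B1 * \<epsilon> + \<epsilon> * (LBINT x. \<bar>divergence \<phi>1 x\<bar>)"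
    proof (rule err[OF mi integration_by_parts(2)[OF c1(1) R1(1) R1(3), simplified] _ B1 di(1)])
      fix x show "\<bar>min (f x) a - (g x - T2 (g x))\<bar> \<le> \<bar>g x - f x\<bar> + \<epsilon>"
        using T2(5)[of "g x"] by (auto simp: min_def max_def abs_if split: if_splits)
    qed
    have e2: "(LBINT x. max (f x - a) 0 * divergence \<phi>2 x) - (LBINT x. T2 (g x) * divergence \<phi>2 x)
        \<le> B2 * \<epsilon> + \<epsilon> * (LBINT x. \<bar>divergence \<phi>2 x\<bar>)"
    proof (rule err[OF ma integration_by_parts(2)[OF c2(1) R2(1) R2(3), simplified] _ B2 di(2)])
      fix x show "\<bar>max (f x - a) 0 - T2 (g x)\<bar> \<le> \<bar>g x - f x\<bar> + \<epsilon>"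
        using T2(5)[of "g x"] by (auto simp: min_def max_def abs_if split: if_splits)
    qed
    show ?thesis using e1 e2 le by (simp add: K_def algebra_simps)
  qed
  show ?thesis
  proof (rule field_le_epsilon)
    fix e :: real assume e: "e > 0"
    have "?I \<le> c + K * (e / (K + 1))" by (rule main) (use e K in auto)
    also have "K * (e / (K + 1)) \<le> e" using e K by (simp add: field_simps)
    finally show "?I \<le> c + e" by simp
  qed
qed

subsection \<open>Coarea inequality\<close>

lemma divergence_zero [simp]: "divergence (\<lambda>_. 0) x = 0"
  by (rule divergence_zero_outside) simp

text \<open>By \<^term>\<open>variation_split\<close>, the variation of the truncations \<open>min w b\<close> grows at least at rate
  \<open>q\<close> in \<open>b\<close>.\<close>
lemma coarea_inequality:
  fixes w :: "'a::euclidean_space \<Rightarrow> real"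
  assumes W: "open W"
    and w: "w \<in> borel_measurable lborel" "\<And>x. 0 \<le> w x" "\<And>x. w x \<le> 1" "\<And>z. R < norm z \<Longrightarrow> w z = 0"
    and c: "var_le w W c" and q: "0 \<le> q"
    and lev: "\<And>s. 0 \<le> s \<Longrightarrow> s < 1 \<Longrightarrow> \<not> var_le (indicator {x. s < w x}) W q"
  shows "q \<le> c"
proof -
  have [measurable]: "w \<in> borel_measurable borel" using w by simp
  define J where "J b \<phi> = (LBINT x. min (w x) b * divergence \<phi> x)" for b \<phi>
  define m where "m b = (SUP \<phi>\<in>test_fields W. J b \<phi>)" for b
  have Jc: "J b \<phi> \<le> c" if "\<phi> \<in> test_fields W" for b \<phi>
    using variation_split[OF W w(1) _ _ c that zero_test_field, of 1 R b] w by (simp add: J_def)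
  have bdd: "bdd_above (J b ` test_fields W)" for b using Jc by (auto simp: bdd_above_def)
  have ne: "test_fields W \<noteq> {}" using zero_test_field by blast
  have mc: "m b \<le> c" for b unfolding m_def by (rule cSUP_least[OF ne Jc])
  \<comment> \<open>The function \<open>min w b\<close> has variation at most \<open>m b\<close> and
    is cut at \<open>a\<close>. Its lower part is \<open>min w a\<close>, whose pairings have
    supremum \<open>m a\<close>.\<close>
  have key: "m a + (LBINT x. max (min (w x) b - a) 0 * divergence \<phi>2 x) \<le> m b"
    if ab: "0 \<le> a" "a \<le> b" and p2: "\<phi>2 \<in> test_fields W" for a b \<phi>2
  proof -
    have v: "var_le (\<lambda>x. min (w x) b) W (m b)"
      unfolding var_le_def J_def[symmetric] m_def using cSUP_upper[OF _ bdd] by blast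
    have "m a \<le> m b - (LBINT x. max (min (w x) b - a) 0 * divergence \<phi>2 x)"
      unfolding m_def[of a]
    proof (rule cSUP_least[OF ne])
      fix \<phi>1 assume p1: "\<phi>1 \<in> test_fields W"
      have "(LBINT x. min (min (w x) b) a * divergence \<phi>1 x) + (LBINT x. max (min (w x) b - a) 0 * divergence \<phi>2 x) \<le> m b"
      proof (rule variation_split[OF W _ _ _ v p1 p2, of 1 R])
        show "\<bar>min (w z) b\<bar> \<le> 1" for z using w(2,3)[of z] ab by linarith
        show "min (w z) b = 0" if "R < norm z" for z using w(4)[OF that] ab by simp
      qed simp
      moreover have "min (min (w x) b) a = min (w x) a" for x using ab by linarith
      ultimately show "J a \<phi>1 \<le> m b - (LBINT x. max (min (w x) b - a) 0 * divergence \<phi>2 x)"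
        by (simp add: J_def)
    qed
    then show ?thesis by simp
  qed
  have mono: "m a \<le> m b" if "0 \<le> a" "a \<le> b" for a b using key[OF that zero_test_field] by simp
  \<comment> \<open>The slices of \<open>w\<close> between \<open>a\<close> and \<open>b n\<close>,
    divided by their thickness, tend to the indicator of the superlevel set at \<open>a\<close>. A
    field whose pairing with that set exceeds \<open>q\<close> therefore also gains at rate
    \<open>q\<close> on a thin slice.\<close>
  have ext: "\<exists>b. a < b \<and> b \<le> 1 \<and> m a + q * (b - a) \<le> m b" if a: "0 \<le> a" "a < 1" for a
  proof -
    obtain \<phi> where \<phi>: "\<phi> \<in> test_fields W" "q < (LBINT x. indicator {x. a < w x} x * divergence \<phi> x)"
      using lev[OF a] by (auto simp: var_le_def not_le)
    define b where "b n = a + (1 - a) * inverse (real (Suc n))" for n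
    have b: "a < b n" "b n \<le> 1" for n
    proof -
      have "inverse (real (Suc n)) \<le> 1" by (simp add: inverse_le_1_iff)
      then have "(1 - a) * inverse (real (Suc n)) \<le> (1 - a) * 1" using a by (intro mult_left_mono) auto
      then have "a + (1 - a) * inverse (real (Suc n)) \<le> a + (1 - a)" by (intro add_left_mono) (simp only: mult_1_right)
      then show "b n \<le> 1" unfolding b_def by (simp only: add_diff_cancel_left' diff_add_cancel add.commute[of a])
      show "a < b n" unfolding b_def using a by simp
    qed
    have "b \<longlonglongrightarrow> a + (1 - a) * 0" unfolding b_def by (intro tendsto_intros LIMSEQ_inverse_real_of_nat)
    then have b0: "b \<longlonglongrightarrow> a" by simp
    define u where "u n x = max (min (w x) (b n) - a) 0 / (b n - a)" for n x
    have u01: "0 \<le> u n x" "u n x \<le> 1" for n x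
      using b(1)[of n] by (auto simp: u_def divide_simps)
    have [measurable]: "u n \<in> borel_measurable borel" for n unfolding u_def by measurable
    obtain R' where R': "C1 \<phi>" "\<And>x. R' < norm x \<Longrightarrow> divergence \<phi> x = 0" using test_fieldsE[OF \<phi>(1)] by metis
    have [measurable]: "divergence \<phi> \<in> borel_measurable borel" using divergence_measurable[OF R'(1)] .
    have "(\<lambda>n. LBINT x. u n x * divergence \<phi> x) \<longlonglongrightarrow> (LBINT x. indicator {x. a < w x} x * divergence \<phi> x)"
    proof (rule integral_dominated_convergence)
      show "integrable lborel (\<lambda>x. \<bar>divergence \<phi> x\<bar>)"
        using continuous_support_bounded(1)[OF divergence_continuous[OF R'(1)] R'(2)] by simp
      show "AE x in lborel. norm (u n x * divergence \<phi> x) \<le> \<bar>divergence \<phi> x\<bar>" for n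
        using u01[of n] by (auto simp: abs_mult intro!: mult_left_le_one_le)
      show "AE x in lborel. (\<lambda>n. u n x * divergence \<phi> x) \<longlonglongrightarrow> indicator {x. a < w x} x * divergence \<phi> x"
      proof (intro AE_I2 tendsto_intros)
        fix x
        show "(\<lambda>n. u n x) \<longlonglongrightarrow> indicator {x. a < w x} x"
        proof (cases "a < w x")
          case True
          then have "\<forall>\<^sub>F n in sequentially. b n < w x" by (rule order_tendstoD(2)[OF b0])
          then have "\<forall>\<^sub>F n in sequentially. u n x = indicator {x. a < w x} x"
          proof eventually_elim
            case (elim n)
            then show ?case using True b(1)[of n] by (simp add: u_def)
          qed
          then show ?thesis by (rule tendsto_eventually)
        qed (auto simp: u_def)
      qed
    qed auto
    from order_tendstoD(1)[OF this \<phi>(2)]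
    obtain n where n: "q < (LBINT x. u n x * divergence \<phi> x)"
      by (auto simp: eventually_sequentially)
    have "(LBINT x. max (min (w x) (b n) - a) 0 * divergence \<phi> x) = (LBINT x. (b n - a) * (u n x * divergence \<phi> x))"
      using b(1)[of n] by (intro Bochner_Integration.integral_cong) (auto simp: u_def)
    also have "\<dots> = (b n - a) * (LBINT x. u n x * divergence \<phi> x)" by simp
    also have "\<dots> \<ge> (b n - a) * q" using n b(1)[of n] by (intro mult_left_mono) auto
    finally show ?thesis using key[OF a(1) _ \<phi>(1), of "b n"] b[of n]
      by (intro exI[of _ "b n"]) (auto simp: mult.commute)
  qed
  have m0: "0 \<le> m b" for b
    unfolding m_def using cSUP_upper[OF zero_test_field[of W] bdd[of b]] by (simp add: J_def)
  \<comment> \<open>Continuous induction on the unit interval: monotonicity of \<open>m\<close>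
    shows that the supremum belongs to \<open>S\<close>, and \<open>ext\<close> moves any point
    below 1 further up.\<close>
  define S where "S = {t. 0 \<le> t \<and> t \<le> 1 \<and> q * t \<le> m t}"
  define s where "s = Sup S"
  have S0: "0 \<in> S" using m0 by (simp add: S_def)
  have Sb: "bdd_above S" by (auto simp: S_def bdd_above_def)
  have s01: "0 \<le> s" "s \<le> 1" unfolding s_def using S0 Sb by (auto intro!: cSup_upper cSup_least simp: S_def)
  have "q * s \<le> m s"
  proof (cases "q = 0")
    case False
    then have "q > 0" using q by simp
    have "s \<le> m s / q" unfolding s_def
    proof (rule cSup_least)
      fix t assume t: "t \<in> S"
      then have "t \<le> s" unfolding s_def by (rule cSup_upper[OF _ Sb])
      then have "q * t \<le> m (Sup S)" using t mono[of t s] by (auto simp: S_def s_def)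
      then show "t \<le> m (Sup S) / q" using \<open>q > 0\<close> by (simp add: field_simps)
    qed (use S0 in auto)
    then show ?thesis using \<open>q > 0\<close> by (simp add: field_simps)
  qed (simp add: m0)
  moreover have "s = 1"
  proof (rule ccontr)
    assume "s \<noteq> 1"
    then obtain b where b: "s < b" "b \<le> 1" "m s + q * (b - s) \<le> m b" using ext[of s] s01 by auto
    then have "b \<in> S" using \<open>q * s \<le> m s\<close> s01 by (auto simp: S_def algebra_simps)
    then have "b \<le> s" unfolding s_def by (rule cSup_upper[OF _ Sb])
    then show False using b by simp
  qed
  ultimately show ?thesis using mc[of 1] by simp
qed

subsection \<open>Perimeter\<close>

lemma divergence_set_integral_lborel:
  assumes "\<phi> \<in> test_fields W" "E \<in> sets borel"
  shows "(LINT x:E|lebesgue. divergence \<phi> x) = (LBINT x. indicator E x * divergence \<phi> x)"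
proof -
  have [measurable]: "divergence \<phi> \<in> borel_measurable borel" "E \<in> sets borel"
    using assms test_fieldsE[OF assms(1)] divergence_measurable by blast+
  have "(\<lambda>x. indicator E x * divergence \<phi> x) \<in> borel_measurable lborel" by measurable
  then show ?thesis unfolding set_lebesgue_integral_def by (simp add: integral_completion)
qed

lemma perimeter_le_iff:
  assumes "E \<in> sets borel"
  shows "perimeter E W \<le> ereal c \<longleftrightarrow> var_le (indicator E) W c"
  unfolding perimeter_def var_le_def SUP_le_iff using divergence_set_integral_lborel[OF _ assms] by auto

lemma perimeter_cong_AE:
  assumes E: "E \<in> sets lebesgue" "E' \<in> sets lebesgue" and ae: "AE x in lebesgue. x \<in> W \<longrightarrow> (x \<in> E \<longleftrightarrow> x \<in> E')"
  shows "perimeter E W = perimeter E' W"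
  unfolding perimeter_def
proof (rule SUP_cong[OF refl])
  fix \<phi> :: "'a \<Rightarrow> 'a" assume \<phi>: "\<phi> \<in> test_fields W"
  then obtain R where R: "C1 \<phi>" "\<And>x. x \<notin> W \<Longrightarrow> divergence \<phi> x = 0" using test_fieldsE[OF \<phi>] by metis
  have [measurable]: "divergence \<phi> \<in> borel_measurable lebesgue" "E \<in> sets lebesgue" "E' \<in> sets lebesgue"
    using divergence_measurable[OF R(1)] E by (auto intro: measurable_completion)
  show "ereal (LINT x:E|lebesgue. divergence \<phi> x) = ereal (LINT x:E'|lebesgue. divergence \<phi> x)"
    unfolding set_lebesgue_integral_def ereal.inject
    by (rule integral_cong_AE) (use ae R(2) in \<open>auto elim!: eventually_mono simp: indicator_def\<close>)
qed

lemma perimeter_nonneg: "0 \<le> perimeter E W"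
proof -
  have "ereal (LINT x:E|lebesgue. divergence (\<lambda>_. 0) x) \<le> perimeter E W"
    unfolding perimeter_def by (rule SUP_upper[OF zero_test_field])
  then show ?thesis by (simp add: set_lebesgue_integral_def zero_ereal_def)
qed

text \<open>The representative is taken inside \<open>E\<close> and not just almost equal to it:
  points of the Borel set are then true points of \<open>E\<close>, and balls that avoid
  \<open>E\<close> also avoid the representative.\<close>

lemma lebesgue_borel_AE:
  assumes "E \<in> sets lebesgue"
  obtains E' where "E' \<in> sets borel" "E' \<subseteq> E" "E - E' \<in> null_sets lebesgue" "AE x in lebesgue. x \<in> E \<longleftrightarrow> x \<in> E'"
proof -
  obtain C T where C: "fsigma C" "T \<in> null_sets lebesgue" "C \<union> T = E" "disjnt C T"
    using lebesgue_set_almost_fsigma[OF assms] by blast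
  show thesis
  proof (rule that)
    show "C \<in> sets borel" using C(1) by (cases rule: fsigma.cases) (auto intro!: borel_closed)
    show "C \<subseteq> E" using C by auto
    have "E - C = T" using C(3,4) by (auto simp: disjnt_def)
    then show "E - C \<in> null_sets lebesgue" using C(2) by simp
    have "AE x in lebesgue. x \<notin> T" using C(2) by (rule AE_not_in)
    then show "AE x in lebesgue. x \<in> E \<longleftrightarrow> x \<in> C" by eventually_elim (use C(3) in auto)
  qed
qed

text \<open>This rests on submodularity, P(E union F) + P(E inter F) \<le> P(E) + P(F). It comes
  from cutting the sum of the two indicators at height 1: the part below is the union, the part
  above the intersection. The hypothesis \<open>le\<close> then cancels two terms.\<close>

lemma perimeter_union_le:
  fixes E F :: "'a::euclidean_space set"
  assumes W: "open W" "bounded W" and EF: "E \<in> sets lebesgue" "F \<in> sets lebesgue"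
    and fin: "perimeter E W < \<infinity>" "perimeter F W < \<infinity>"
    and le: "perimeter E W \<le> perimeter (E \<inter> F) W"
  shows "perimeter (E \<union> F) W \<le> perimeter F W"
proof -
  obtain E' where E': "E' \<in> sets borel" "AE x in lebesgue. x \<in> E \<longleftrightarrow> x \<in> E'" using lebesgue_borel_AE[OF EF(1)] by metis
  obtain F' where F': "F' \<in> sets borel" "AE x in lebesgue. x \<in> F \<longleftrightarrow> x \<in> F'" using lebesgue_borel_AE[OF EF(2)] by metis
  have [measurable]: "E' \<in> sets borel" "F' \<in> sets borel" "W \<in> sets borel" using E' F' W by auto
  have L: "E' \<in> sets lebesgue" "F' \<in> sets lebesgue" using E' F' by auto
  have ae: "AE x in lebesgue. (x \<in> E \<longleftrightarrow> x \<in> E') \<and> (x \<in> F \<longleftrightarrow> x \<in> F')"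
    using E'(2) F'(2) by eventually_elim auto
  have pe: "perimeter E W = perimeter E' W" "perimeter F W = perimeter F' W" 
    "perimeter (E \<inter> F) W = perimeter (E' \<inter> F') W" "perimeter (E \<union> F) W = perimeter (E' \<union> F') W"
    using EF L by (auto intro!: perimeter_cong_AE eventually_mono[OF ae])
  obtain a where a: "perimeter E' W = ereal a" using fin(1) perimeter_nonneg[of E' W] unfolding pe by (cases "perimeter E' W") auto
  obtain b where b: "perimeter F' W = ereal b" using fin(2) perimeter_nonneg[of F' W] unfolding pe by (cases "perimeter F' W") auto
  have va: "var_le (indicator E') W a" "var_le (indicator F') W b"
    using a b by (simp_all flip: perimeter_le_iff)
  obtain R where R: "\<And>x. x \<in> W \<Longrightarrow> norm x \<le> R" using W(2) by (auto simp: bounded_iff)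
  \<comment> \<open>The factor \<open>indicator W\<close> gives \<open>f\<close> the bounded support
    that \<open>variation_split\<close> asks for; fields supported in \<open>W\<close> do not notice
    it.\<close>
  define f where "f x = indicator W x * (indicator E' x + indicator F' x :: real)" for x
  have vf: "var_le f W (a + b)" unfolding var_le_def
  proof
    fix \<phi> assume \<phi>: "\<phi> \<in> test_fields W"
    then have z: "divergence \<phi> x = 0" if "x \<notin> W" for x using test_fieldsE[OF \<phi>] that by metis
    have i: "integrable lborel (\<lambda>x. indicator A x * divergence \<phi> x)" if "A \<in> sets borel" for A
      by (rule test_field_integrable[OF \<phi>, of _ 1]) (use that in \<open>auto simp: indicator_def\<close>)
    have "(LBINT x. f x * divergence \<phi> x) = (LBINT x. indicator E' x * divergence \<phi> x + indicator F' x * divergence \<phi> x)"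
      by (rule Bochner_Integration.integral_cong) (auto simp: f_def indicator_def z)
    also have "\<dots> = (LBINT x. indicator E' x * divergence \<phi> x) + (LBINT x. indicator F' x * divergence \<phi> x)"
      using i E' F' by simp
    also have "\<dots> \<le> a + b" using va \<phi> by (intro add_mono) (auto simp: var_le_def)
    finally show "(LBINT x. f x * divergence \<phi> x) \<le> a + b" .
  qed
  have sum: "(LBINT x. indicator (E' \<union> F') x * divergence \<phi>1 x) + (LBINT x. indicator (E' \<inter> F') x * divergence \<phi>2 x) \<le> a + b"
    if p: "\<phi>1 \<in> test_fields W" "\<phi>2 \<in> test_fields W" for \<phi>1 \<phi>2
  proof -
    have z: "divergence \<phi>1 x = 0" "divergence \<phi>2 x = 0" if "x \<notin> W" for x
      using test_fieldsE[OF p(1)] test_fieldsE[OF p(2)] that by metis+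
    have "(LBINT x. min (f x) 1 * divergence \<phi>1 x) + (LBINT x. max (f x - 1) 0 * divergence \<phi>2 x) \<le> a + b"
    proof (rule variation_split[OF W(1) _ _ _ vf p, of 2 R])
      show "f \<in> borel_measurable lborel" unfolding f_def by measurable
      show "f z = 0" if "R < norm z" for z using R[of z] that by (auto simp: f_def indicator_def)
    qed (auto simp: f_def indicator_def)
    moreover have "(LBINT x. min (f x) 1 * divergence \<phi>1 x) = (LBINT x. indicator (E' \<union> F') x * divergence \<phi>1 x)"
      by (rule Bochner_Integration.integral_cong) (auto simp: f_def indicator_def z)
    moreover have "(LBINT x. max (f x - 1) 0 * divergence \<phi>2 x) = (LBINT x. indicator (E' \<inter> F') x * divergence \<phi>2 x)"
      by (rule Bochner_Integration.integral_cong) (auto simp: f_def indicator_def z)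
    ultimately show ?thesis by simp
  qed
  have "var_le (indicator (E' \<union> F')) W b"
    unfolding var_le_def
  proof
    fix \<phi>1 assume p1: "\<phi>1 \<in> test_fields W"
    show "(LBINT x. indicator (E' \<union> F') x * divergence \<phi>1 x) \<le> b"
    proof (rule field_le_epsilon)
      fix e :: real assume e: "e > 0"
      \<comment> \<open>Since the intersection has perimeter at least \<open>a\<close>, some \<phi>2
        uses up almost all of the share \<open>a\<close> of the total \<open>a + b\<close> and
        leaves \<open>b\<close> to the union.\<close>
      have "ereal a \<le> perimeter (E' \<inter> F') W" using le unfolding pe a .
      moreover have "ereal (a - e) < ereal a" using e by simp
      ultimately have "\<not> perimeter (E' \<inter> F') W \<le> ereal (a - e)" by (meson not_le order_less_le_trans)
      then obtain \<phi>2 where p2: "\<phi>2 \<in> test_fields W" "a - e < (LBINT x. indicator (E' \<inter> F') x * divergence \<phi>2 x)"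
        by (subst (asm) perimeter_le_iff) (auto simp: var_le_def not_le)
      show "(LBINT x. indicator (E' \<union> F') x * divergence \<phi>1 x) \<le> b + e" using sum[OF p1 p2(1)] p2(2) by linarith
    qed
  qed
  then have "perimeter (E' \<union> F') W \<le> ereal b" by (subst perimeter_le_iff) auto
  then show ?thesis unfolding pe b .
qed

lemma divergence_set_integrable:
  assumes "\<phi> \<in> test_fields W" "E \<in> sets lebesgue"
  shows "set_integrable lebesgue E (divergence \<phi>)"
proof -
  obtain R where R: "C1 \<phi>" "\<And>x. R < norm x \<Longrightarrow> divergence \<phi> x = 0" using test_fieldsE[OF assms(1)] by metis
  have "integrable lborel (divergence \<phi>)" by (rule continuous_support_bounded(1)[OF divergence_continuous[OF R(1)] R(2)])
  then have "integrable lebesgue (divergence \<phi>)" using divergence_measurable[OF R(1)] by (subst integrable_completion) auto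
  then show ?thesis unfolding set_integrable_def by (rule integrable_mult_indicator[OF assms(2)])
qed

lemma divergence_set_integral_add:
  assumes "\<phi> \<in> test_fields W" "\<psi> \<in> test_fields V" "E \<in> sets lebesgue"
  shows "(LINT x:E|lebesgue. divergence (\<lambda>x. \<phi> x + \<psi> x) x) = (LINT x:E|lebesgue. divergence \<phi> x) + (LINT x:E|lebesgue. divergence \<psi> x)"
proof -
  have "C1 \<phi>" "C1 \<psi>" using assms by (auto simp: test_fields_iff)
  then have "(LINT x:E|lebesgue. divergence (\<lambda>x. \<phi> x + \<psi> x) x) = (LINT x:E|lebesgue. divergence \<phi> x + divergence \<psi> x)"
    by (simp add: divergence_add)
  also have "\<dots> = (LINT x:E|lebesgue. divergence \<phi> x) + (LINT x:E|lebesgue. divergence \<psi> x)"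
    using assms by (intro set_integral_add divergence_set_integrable)
  finally show ?thesis .
qed

lemma perimeter_upper:
  "\<phi> \<in> test_fields W \<Longrightarrow> ereal (LINT x:E|lebesgue. divergence \<phi> x) \<le> perimeter E W"
  unfolding perimeter_def by (rule SUP_upper)

text \<open>The divergence of a compactly supported field integrates to 0 over the whole space, so
  testing \<open>- E\<close> with a field amounts to testing \<open>E\<close> with its
  negative.\<close>

lemma perimeter_complement_le:
  fixes E :: "'a::euclidean_space set"
  assumes E: "E \<in> sets lebesgue"
  shows "perimeter (- E) W \<le> perimeter E W"
  unfolding perimeter_def[of "- E"]
proof (rule SUP_least)
  fix \<phi> :: "'a \<Rightarrow> 'a" assume \<phi>: "\<phi> \<in> test_fields W"
  obtain R where R: "C1 \<phi>" "\<And>x. R < norm x \<Longrightarrow> \<phi> x = 0" "\<And>x. R < norm x \<Longrightarrow> divergence \<phi> x = 0" using test_fieldsE[OF \<phi>] by metis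
  have E': "- E \<in> sets lebesgue" using sets.compl_sets[OF E] by (simp add: Compl_eq_Diff_UNIV)
  have "(LINT x:E|lebesgue. divergence \<phi> x) + (LINT x:-E|lebesgue. divergence \<phi> x) = (LINT x:E \<union> -E|lebesgue. divergence \<phi> x)"
    by (rule set_integral_Un[symmetric]) (auto intro!: divergence_set_integrable[OF \<phi>] E E')
  also have "\<dots> = (LBINT x. divergence \<phi> x)"
    using divergence_set_integral_lborel[OF \<phi>, of UNIV] by simp
  also have "\<dots> = 0" by (rule integral_divergence_zero[OF R(1,2)])
  finally have 1: "(LINT x:-E|lebesgue. divergence \<phi> x) = - (LINT x:E|lebesgue. divergence \<phi> x)" by simp
  let ?n = "\<lambda>x. (-1) *\<^sub>R \<phi> x"
  have "closure {x. \<phi> x \<noteq> 0} = closure {x. ?n x \<noteq> 0}" by simp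
  then have n: "?n \<in> test_fields W" using \<phi> C1_scaleR[OF C1_const R(1), of "-1"] unfolding test_fields_iff by auto
  have "divergence ?n x = - divergence \<phi> x" for x
  proof -
    have "frechet_derivative (\<lambda>_. -1::real) (at x) = (\<lambda>_. 0)" by (rule frechet_derivative_const)
    then show ?thesis using divergence_scaleR[OF C1_const R(1), of "-1" x] by simp
  qed
  then have "(LINT x:E|lebesgue. divergence ?n x) = - (LINT x:E|lebesgue. divergence \<phi> x)"
    by (simp add: set_lebesgue_integral_def)
  with perimeter_upper[OF n, of E] 1 show "ereal (LINT x:-E|lebesgue. divergence \<phi> x) \<le> perimeter E W" by simp
qed

lemma lebesgue_compl: "E \<in> sets lebesgue \<Longrightarrow> - E \<in> sets lebesgue"
  using sets.compl_sets[of E lebesgue] by (simp add: Compl_eq_Diff_UNIV)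

lemma perimeter_complement:
  assumes "E \<in> sets lebesgue" shows "perimeter (- E) W = perimeter E W"
  using perimeter_complement_le[OF assms, of W] perimeter_complement_le[OF lebesgue_compl[OF assms], of W] by simp

section \<open>Cutoff functions and gluing\<close>

lemma smooth_cutoff:
  fixes C :: "'a::euclidean_space set"
  assumes C: "compact C" "open W" "C \<subseteq> W"
  obtains \<xi> :: "'a \<Rightarrow> real" and V D where "C1 \<xi>" "\<And>x. 0 \<le> \<xi> x" "\<And>x. \<xi> x \<le> 1" "open V" "C \<subseteq> V" "\<And>x. x \<in> V \<Longrightarrow> \<xi> x = 1"
    "compact D" "D \<subseteq> W" "\<And>x. x \<notin> D \<Longrightarrow> \<xi> x = 0"
proof -
  obtain e where e: "e > 0" "(\<Union>x\<in>C. cball x e) \<subseteq> W"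
    using compact_subset_open_imp_cball_epsilon_subset[OF C] by blast
  \<comment> \<open>The indicator of the neighbourhood of radius \<open>4 * r\<close> is mollified
    with a kernel of support radius \<open>2 * r\<close>. The result is 1 on the neighbourhood of
    radius \<open>r\<close> and vanishes beyond \<open>6 * r = e\<close>.\<close>
  define r where "r = e / 6"
  have r: "r > 0" using e by (simp add: r_def)
  define N where "N = (\<Union>x\<in>C. ball x (4 * r))"
  have [measurable]: "N \<in> sets borel" unfolding N_def by (intro borel_open open_UN) auto
  let ?f = "indicator N :: 'a \<Rightarrow> real"
  define \<xi> where "\<xi> = conv (moll r) ?f"
  define D where "D = {x + y |x y. x \<in> C \<and> y \<in> cball 0 e}"
  have fm: "?f \<in> borel_measurable lborel" by measurable
  have f1: "norm (?f z) \<le> 1" for z by (simp add: indicator_def)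
  have near: "norm (x - z) < 2 * r" if "moll r (x - z) \<noteq> 0" for x z :: 'a
    using moll_props(2)[OF r, of "x - z"] that by force
  show thesis
  proof (rule that)
    show "C1 \<xi>" unfolding \<xi>_def by (rule C1_conv[OF kernel_moll fm f1])
    show "\<xi> x \<le> 1" for x using conv_moll_norm_le[OF r fm f1, of x] by (simp add: \<xi>_def)
    show "0 \<le> \<xi> x" for x unfolding \<xi>_def conv_def
      by (intro integral_nonneg_AE AE_I2) (auto simp: moll_props(1)[OF r])
    show "open (\<Union>x\<in>C. ball x r)" by (intro open_UN) auto
    show "C \<subseteq> (\<Union>x\<in>C. ball x r)" using r by auto
    show "\<xi> x = 1" if x: "x \<in> (\<Union>x\<in>C. ball x r)" for x
    proof -
      obtain c where c: "c \<in> C" "dist c x < r" using x by auto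
      have "\<xi> x = conv (moll r) (\<lambda>_. 1) x" unfolding \<xi>_def
      proof (rule conv_cong)
        fix z assume "moll r (x - z) \<noteq> 0"
        then have "dist x z < 2 * r" using near[of x z] by (simp add: dist_norm)
        then have "dist c z < 4 * r" using c dist_triangle[of c z x] r by simp
        then have "z \<in> N" using c by (auto simp: N_def)
        then show "?f z = 1" by simp
      qed
      then show ?thesis using moll_integral_reflect[OF r, of x] by (simp add: conv_def)
    qed
    show "compact D" unfolding D_def by (intro compact_sums C) auto
    show "D \<subseteq> W"
    proof
      fix p assume "p \<in> D"
      then obtain x y where "x \<in> C" "y \<in> cball 0 e" "p = x + y" by (auto simp: D_def)
      then have "p \<in> cball x e" by (auto simp: dist_norm)
      then show "p \<in> W" using e(2) \<open>x \<in> C\<close> by blast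
    qed
    show "\<xi> x = 0" if x: "x \<notin> D" for x unfolding \<xi>_def
    proof (rule conv_zero)
      fix z assume "moll r (x - z) \<noteq> 0"
      then have 1: "norm (x - z) < 2 * r" by (rule near)
      show "?f z = 0"
      proof (rule ccontr)
        assume "?f z \<noteq> 0"
        then obtain c where c: "c \<in> C" "dist c z < 4 * r" by (auto simp: N_def indicator_def split: if_splits)
        have "norm (x - c) \<le> norm (x - z) + dist c z"
          using dist_triangle[of x c z] by (simp add: dist_norm[symmetric] dist_commute)
        then have "x - c \<in> cball 0 e" using 1 c(2) by (simp add: r_def)
        moreover have "x = c + (x - c)" by simp
        ultimately have "x \<in> D" using c(1) unfolding D_def by blast
        then show False using x by simp
      qed
    qed
  qed
qed

text \<open>A cutoff splits each field into a part supported in \<open>W\<close> and a part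
  vanishing near \<open>C\<close>; the second cannot tell \<open>A\<close> from \<open>B\<close>.
  This gives locally finite perimeter to competitors that differ from an admissible set in a compact
  part of \<open>W\<close>.\<close>

lemma perimeter_glue_finite:
  fixes A B :: "'a::euclidean_space set"
  assumes C: "compact C" "open W" "C \<subseteq> W" and AB: "A \<in> sets lebesgue" "B \<in> sets lebesgue" "A - C = B - C"
    and fin: "perimeter A W < \<infinity>" "perimeter B V < \<infinity>"
  shows "perimeter A V < \<infinity>"
proof -
  obtain \<xi> :: "'a \<Rightarrow> real" and N D where \<xi>: "C1 \<xi>" "\<And>x. 0 \<le> \<xi> x" "\<And>x. \<xi> x \<le> 1"
    and N: "open N" "C \<subseteq> N" "\<And>x. x \<in> N \<Longrightarrow> \<xi> x = 1"
    and D: "compact D" "D \<subseteq> W" "\<And>x. x \<notin> D \<Longrightarrow> \<xi> x = 0"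
    using smooth_cutoff[OF C] by metis
  have "perimeter A V \<le> perimeter A W + perimeter B V"
    unfolding perimeter_def[of A V]
  proof (rule SUP_least)
    fix \<phi> :: "'a \<Rightarrow> 'a" assume \<phi>: "\<phi> \<in> test_fields V"
    then have cp: "C1 \<phi>" "\<And>x. norm (\<phi> x) \<le> 1" by (auto simp: test_fields_iff)
    define \<phi>1 where "\<phi>1 x = \<xi> x *\<^sub>R \<phi> x" for x
    define \<phi>2 where "\<phi>2 x = (1 - \<xi> x) *\<^sub>R \<phi> x" for x
    have t1: "\<phi>1 \<in> test_fields W"
      unfolding \<phi>1_def[abs_def] by (rule test_fieldsI[of _ D]) (use D \<xi> cp in \<open>auto intro!: C1_scaleR mult_le_one\<close>)
    have t2: "\<phi>2 \<in> test_fields V"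
      unfolding \<phi>2_def[abs_def]
    proof (rule test_fieldsI[of _ "closure {x. \<phi> x \<noteq> 0}"])
      show "(1 - \<xi> x) *\<^sub>R \<phi> x = 0" if "x \<notin> closure {x. \<phi> x \<noteq> 0}" for x
        using that subsetD[OF closure_subset, of x "{x. \<phi> x \<noteq> 0}"] by auto
    qed (use \<phi> \<xi> cp in \<open>auto intro!: C1_scaleR C1_diff mult_le_one simp: test_fields_iff\<close>)
    have "\<phi>1 x + \<phi>2 x = \<phi> x" for x by (simp add: \<phi>1_def \<phi>2_def algebra_simps)
    then have "(LINT x:A|lebesgue. divergence \<phi> x) = (LINT x:A|lebesgue. divergence \<phi>1 x) + (LINT x:A|lebesgue. divergence \<phi>2 x)"
      using divergence_set_integral_add[OF t1 t2 AB(1)] by simp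
    also have "(LINT x:A|lebesgue. divergence \<phi>2 x) = (LINT x:B|lebesgue. divergence \<phi>2 x)"
    proof -
      \<comment> \<open>The cutoff is 1 on a whole open neighbourhood of \<open>C\<close>, so the
        divergence of \<phi>2 vanishes there together with \<phi>2.\<close>
      have "divergence \<phi>2 x = 0" if x: "x \<in> N" for x
      proof (rule divergence_zero_outside)
        have "N \<inter> {x. \<phi>2 x \<noteq> 0} = {}" using N(3) by (auto simp: \<phi>2_def)
        then have "N \<inter> closure {x. \<phi>2 x \<noteq> 0} = {}" using N(1) by (simp add: open_Int_closure_eq_empty)
        then show "x \<notin> closure {x. \<phi>2 x \<noteq> 0}" using x by auto
      qed
      then have "indicator A x *\<^sub>R divergence \<phi>2 x = indicator B x *\<^sub>R divergence \<phi>2 x" for x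
        using AB(3) N(2) by (cases "x \<in> N") (auto simp: indicator_def)
      then show ?thesis unfolding set_lebesgue_integral_def by (rule Bochner_Integration.integral_cong[OF refl])
    qed
    also have "ereal ((LINT x:A|lebesgue. divergence \<phi>1 x) + (LINT x:B|lebesgue. divergence \<phi>2 x)) \<le> perimeter A W + perimeter B V"
      unfolding plus_ereal.simps(1)[symmetric] by (intro add_mono perimeter_upper t1 t2)
    finally show "ereal (LINT x:A|lebesgue. divergence \<phi> x) \<le> perimeter A W + perimeter B V" .
  qed
  also have "\<dots> < \<infinity>" using fin by (simp add: less_top[symmetric])
  finally show ?thesis .
qed

subsection \<open>Normalized representatives\<close>

text \<open>The density ratio is required to equal 1 exactly for all small radii, and not merely in
  the limit. This forces a whole ball to be filled up to a null set.\<close>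

lemma density_points_1_iff:
  fixes G :: "'a::euclidean_space set"
  assumes G: "G \<in> sets lebesgue"
  shows "x \<in> density_points G 1 \<longleftrightarrow> (\<exists>r>0. ball x r - G \<in> null_sets lebesgue)"
proof -
  have 1: "measure lebesgue (G \<inter> ball x r) / measure lebesgue (ball x r) = 1 \<longleftrightarrow> ball x r - G \<in> null_sets lebesgue" if r: "r > 0" for r
  proof -
    have b: "ball x r \<in> lmeasurable" by simp
    then have b': "ball x r - G \<in> lmeasurable" by (rule fmeasurableI2) (use G in auto)
    have "0 < measure lebesgue (ball x r)" using content_ball_pos[OF r, of x] by simp
    moreover have "measure lebesgue (ball x r - G) = measure lebesgue (ball x r) - measure lebesgue (G \<inter> ball x r)"
    proof -
      have "ball x r - G = ball x r - (G \<inter> ball x r)" by auto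
      then show ?thesis using measurable_measure_Diff[OF b, of "G \<inter> ball x r"] sets.Int[OF G, of "ball x r"] by simp
    qed
    moreover have "ball x r - G \<in> null_sets lebesgue \<longleftrightarrow> measure lebesgue (ball x r - G) = 0"
      using b' by (auto simp: negligible_iff_measure negligible_iff_null_sets[symmetric])
    ultimately show ?thesis by (auto simp: field_simps)
  qed
  show ?thesis
  proof
    assume "x \<in> density_points G 1"
    then obtain r0 where r0: "r0 > 0" "\<And>r. 0 < r \<Longrightarrow> r < r0 \<Longrightarrow> measure lebesgue (G \<inter> ball x r) / measure lebesgue (ball x r) = 1"
      by (auto simp: density_points_def)
    have "ball x (r0/2) - G \<in> null_sets lebesgue" by (rule iffD1[OF 1 r0(2)]) (use r0(1) in auto)
    then show "\<exists>r>0. ball x r - G \<in> null_sets lebesgue" using r0(1) by (intro exI[of _ "r0/2"]) auto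
  next
    assume "\<exists>r>0. ball x r - G \<in> null_sets lebesgue"
    then obtain r0 where r0: "r0 > 0" "ball x r0 - G \<in> null_sets lebesgue" by auto
    have "ball x r - G \<in> null_sets lebesgue" if "r < r0" for r
    proof (rule null_sets_subset[OF r0(2)])
      show "ball x r - G \<in> sets lebesgue" using G by auto
      show "ball x r - G \<subseteq> ball x r0 - G" using that by auto
    qed
    then show "x \<in> density_points G 1" using 1 r0(1) by (auto simp: density_points_def intro!: exI[of _ r0])
  qed
qed

lemma density_points_0_iff:
  fixes G :: "'a::euclidean_space set"
  assumes G: "G \<in> sets lebesgue"
  shows "x \<in> density_points G 0 \<longleftrightarrow> (\<exists>r>0. ball x r \<inter> G \<in> null_sets lebesgue)"
proof -
  have 1: "measure lebesgue (G \<inter> ball x r) / measure lebesgue (ball x r) = 0 \<longleftrightarrow> ball x r \<inter> G \<in> null_sets lebesgue" if r: "r > 0" for r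
  proof -
    have "ball x r \<in> lmeasurable" by simp
    then have b: "ball x r \<inter> G \<in> lmeasurable" by (rule fmeasurableI2) (use G in auto)
    have "0 < measure lebesgue (ball x r)" using content_ball_pos[OF r, of x] by simp
    moreover have "ball x r \<inter> G \<in> null_sets lebesgue \<longleftrightarrow> measure lebesgue (ball x r \<inter> G) = 0"
      using b by (auto simp: negligible_iff_measure negligible_iff_null_sets[symmetric])
    ultimately show ?thesis by (auto simp: Int_commute)
  qed
  show ?thesis
  proof
    assume "x \<in> density_points G 0"
    then obtain r0 where r0: "r0 > 0" "\<And>r. 0 < r \<Longrightarrow> r < r0 \<Longrightarrow> measure lebesgue (G \<inter> ball x r) / measure lebesgue (ball x r) = 0"
      by (auto simp: density_points_def)
    then show "\<exists>r>0. ball x r \<inter> G \<in> null_sets lebesgue" using 1[of "r0/2"] by (intro exI[of _ "r0/2"]) auto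
  next
    assume "\<exists>r>0. ball x r \<inter> G \<in> null_sets lebesgue"
    then obtain r0 where r0: "r0 > 0" "ball x r0 \<inter> G \<in> null_sets lebesgue" by auto
    have "ball x r \<inter> G \<in> null_sets lebesgue" if "r < r0" for r
    proof (rule null_sets_subset[OF r0(2)])
      show "ball x r \<inter> G \<in> sets lebesgue" using G by auto
      show "ball x r \<inter> G \<subseteq> ball x r0 \<inter> G" using that by auto
    qed
    then show "x \<in> density_points G 0" using 1 r0(1) by (auto simp: density_points_def intro!: exI[of _ r0])
  qed
qed

text \<open>By the Lindelof property countably many of the balls already cover
  \<open>P\<close>.\<close>

lemma null_union_of_locally_null:
  fixes S :: "'a::euclidean_space set"
  assumes "\<And>x. x \<in> P \<Longrightarrow> \<exists>r>0. ball x r \<inter> S \<in> null_sets lebesgue"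
  shows "P \<inter> S \<in> null_sets lebesgue"
proof -
  obtain r where r: "\<And>x. x \<in> P \<Longrightarrow> r x > 0 \<and> ball x (r x) \<inter> S \<in> null_sets lebesgue"
    using assms by metis
  obtain F' where F': "F' \<subseteq> (\<lambda>x. ball x (r x)) ` P" "countable F'" "\<Union>F' = \<Union>((\<lambda>x. ball x (r x)) ` P)"
    by (rule Lindelof[of "(\<lambda>x. ball x (r x)) ` P"]) auto
  have "(\<Union>B\<in>F'. B \<inter> S) \<in> null_sets lebesgue"
    using F'(1,2) r by (intro null_sets_UN') auto
  moreover have "P \<inter> S \<subseteq> (\<Union>B\<in>F'. B \<inter> S)" using F'(3) r by fastforce
  ultimately show ?thesis by (meson null_sets_completion_subset)
qed

text \<open>Competitors in the minimality conditions have to be normalized; this is the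
  representative of an arbitrary measurable set that is used for them.\<close>

definition normal_rep :: "'a::euclidean_space set \<Rightarrow> 'a set" where
  "normal_rep G = (G \<union> density_points G 1) - density_points G 0"

lemma normal_rep_AE:
  assumes G: "G \<in> sets lebesgue"
  shows "AE x in lebesgue. x \<in> normal_rep G \<longleftrightarrow> x \<in> G" "normal_rep G \<in> sets lebesgue"
proof -
  have n1: "density_points G 1 \<inter> - G \<in> null_sets lebesgue"
    by (rule null_union_of_locally_null) (simp add: density_points_1_iff[OF G] Diff_eq)
  have n0: "density_points G 0 \<inter> G \<in> null_sets lebesgue"
    by (rule null_union_of_locally_null) (simp add: density_points_0_iff[OF G])
  show "AE x in lebesgue. x \<in> normal_rep G \<longleftrightarrow> x \<in> G"
    using AE_not_in[OF n1] AE_not_in[OF n0] by eventually_elim (auto simp: normal_rep_def)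
  have disj: "density_points G 1 \<inter> density_points G 0 = {}"
  proof -
    have False if "x \<in> density_points G 1" "x \<in> density_points G 0" for x
    proof -
      obtain r0 r1 where "r0 > 0" "\<forall>r. 0 < r \<and> r < r0 \<longrightarrow> measure lebesgue (G \<inter> ball x r) / measure lebesgue (ball x r) = 1"
        "r1 > 0" "\<forall>r. 0 < r \<and> r < r1 \<longrightarrow> measure lebesgue (G \<inter> ball x r) / measure lebesgue (ball x r) = 0"
        using \<open>x \<in> density_points G 1\<close> \<open>x \<in> density_points G 0\<close> unfolding density_points_def by blast
      then show False by (auto dest!: spec[of _ "min r0 r1 / 2"])
    qed
    then show ?thesis by blast
  qed
  have "normal_rep G = (G - (density_points G 0 \<inter> G)) \<union> (density_points G 1 \<inter> - G)"
    using disj by (auto simp: normal_rep_def)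
  then show "normal_rep G \<in> sets lebesgue" using G n0 n1 by auto
qed

text \<open>Only small balls around \<open>x\<close> matter, and only up to null sets. The open set
  \<open>S\<close> makes this locality available, so that normalizing a competitor changes nothing
  away from the region where it was modified.\<close>

lemma density_points_cong:
  fixes G :: "'a::euclidean_space set"
  assumes G: "G \<in> sets lebesgue" "G' \<in> sets lebesgue" and ae: "AE x in lebesgue. x \<in> S \<longrightarrow> (x \<in> G \<longleftrightarrow> x \<in> G')" and S: "open S" "x \<in> S"
  shows "x \<in> density_points G t \<longleftrightarrow> x \<in> density_points G' t"
proof -
  have *: "x \<in> density_points G' t" if G: "G \<in> sets lebesgue" "G' \<in> sets lebesgue"
    and ae: "AE x in lebesgue. x \<in> S \<longrightarrow> (x \<in> G \<longleftrightarrow> x \<in> G')" and x: "x \<in> density_points G t" for G G'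
  proof -
    obtain e where e: "e > 0" "ball x e \<subseteq> S" using S open_contains_ball by metis
    obtain r0 where r0: "r0 > 0" "\<And>r. 0 < r \<Longrightarrow> r < r0 \<Longrightarrow> measure lebesgue (G \<inter> ball x r) / measure lebesgue (ball x r) = t"
      using x unfolding density_points_def by blast
    have m: "measure lebesgue (G \<inter> ball x r) = measure lebesgue (G' \<inter> ball x r)" if "r < e" for r
      unfolding measure_def
    proof (intro arg_cong[of _ _ enn2real] emeasure_eq_AE)
      have "ball x r \<subseteq> S" using e that by auto
      show "AE y in lebesgue. y \<in> G \<inter> ball x r \<longleftrightarrow> y \<in> G' \<inter> ball x r"
        using ae by eventually_elim (use \<open>ball x r \<subseteq> S\<close> in auto)
    qed (use G in auto)
    have "measure lebesgue (G' \<inter> ball x r) / measure lebesgue (ball x r) = t" if "0 < r" "r < min r0 e" for r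
      using r0(2)[of r] m[of r] that by simp
    then show ?thesis using r0(1) e(1) unfolding density_points_def by (intro CollectI exI[of _ "min r0 e"]) auto
  qed
  have "AE x in lebesgue. x \<in> S \<longrightarrow> (x \<in> G' \<longleftrightarrow> x \<in> G)" using ae by eventually_elim auto
  then show ?thesis using *[OF G ae] *[OF G(2,1)] by blast
qed

lemma normalized_normal_rep:
  assumes G: "G \<in> sets lebesgue" shows "normalized (normal_rep G)"
proof -
  have "density_points (normal_rep G) t = density_points G t" for t
    using density_points_cong[OF normal_rep_AE(2)[OF G] G, of UNIV] normal_rep_AE(1)[OF G] by auto
  then show ?thesis unfolding normalized_def by (auto simp: normal_rep_def)
qed

lemma admissible_normal_rep:
  assumes G: "locally_finite_perimeter G" shows "admissible (normal_rep G)"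
proof -
  have G': "G \<in> sets lebesgue" using G by (simp add: locally_finite_perimeter_def)
  have "perimeter (normal_rep G) V = perimeter G V" for V
    using normal_rep_AE[OF G'] by (intro perimeter_cong_AE G') auto
  then show ?thesis using G normalized_normal_rep[OF G'] normal_rep_AE(2)[OF G']
    by (simp add: admissible_def locally_finite_perimeter_def)
qed

section \<open>Complements and comparison with measurable competitors\<close>

lemma admissible_lebesgue: "admissible E \<Longrightarrow> E \<in> sets lebesgue"
  by (simp add: admissible_def locally_finite_perimeter_def)

lemma density_points_complement:
  assumes "E \<in> sets lebesgue"
  shows "density_points (- E) 1 = density_points E 0" "density_points (- E) 0 = density_points E 1"
  by (auto simp: density_points_1_iff density_points_0_iff lebesgue_compl assms Diff_eq Int_commute)

lemma normalized_ball:
  assumes E: "E \<in> sets lebesgue" "normalized E" and r: "r > 0"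
  shows "ball x r - E \<in> null_sets lebesgue \<Longrightarrow> x \<in> E" "ball x r \<inter> E \<in> null_sets lebesgue \<Longrightarrow> x \<notin> E"
proof -
  have e: "E = normal_rep E" using E(2) by (simp add: normalized_def normal_rep_def)
  show "x \<notin> E" if "ball x r \<inter> E \<in> null_sets lebesgue"
    using that r density_points_0_iff[OF E(1), of x] by (subst e) (auto simp: normal_rep_def)
  show "x \<in> E" if n: "ball x r - E \<in> null_sets lebesgue"
  proof -
    have "x \<notin> density_points E 0"
    proof
      assume "x \<in> density_points E 0"
      then obtain s where s: "s > 0" "ball x s \<inter> E \<in> null_sets lebesgue" using density_points_0_iff[OF E(1)] by auto
      have "(ball x s \<inter> E) \<union> (ball x r - E) \<in> null_sets lebesgue" using s(2) n by (rule null_sets.Un)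
      then have "negligible ((ball x s \<inter> E) \<union> (ball x r - E))" by (simp add: negligible_iff_null_sets)
      then have "negligible (ball x (min r s))" by (rule negligible_subset) auto
      then show False using open_not_negligible[of "ball x (min r s)"] r s(1) by auto
    qed
    then show ?thesis using n r density_points_1_iff[OF E(1), of x] by (subst e) (auto simp: normal_rep_def)
  qed
qed

lemma normalized_complement:
  assumes "E \<in> sets lebesgue" "normalized E" shows "normalized (- E)"
proof -
  have "x \<in> - E \<longleftrightarrow> x \<in> normal_rep (- E)" for x
    using normalized_ball[OF assms] unfolding normal_rep_def density_points_complement[OF assms(1)]
      density_points_1_iff[OF assms(1)] density_points_0_iff[OF assms(1)]
    by (auto simp: density_points_1_iff density_points_0_iff assms)
  then have "- E = normal_rep (- E)" by blast
  then show ?thesis by (simp add: normalized_def normal_rep_def)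
qed

lemma admissible_complement:
  assumes "admissible E" shows "admissible (- E)"
  using assms normalized_complement[of E] perimeter_complement[of E] lebesgue_compl[of E]
  by (auto simp: admissible_def locally_finite_perimeter_def)

text \<open>Complements preserve perimeters and symmetric differences and exchange unions with
  intersections.\<close>

lemma sub_area_minimizing_complement:
  assumes "super_area_minimizing F U" "admissible F" shows "sub_area_minimizing (- F) U"
  unfolding sub_area_minimizing_def
proof (intro allI impI, elim conjE)
  fix G W assume a: "admissible G" "open W" "bounded W" "W \<subseteq> U" "compactly_contained ((- F - G) \<union> (G - - F)) W"
  have L: "F \<in> sets lebesgue" "G \<in> sets lebesgue" using a assms(2) admissible_lebesgue by auto
  have e: "(F - - G) \<union> (- G - F) = (- F - G) \<union> (G - - F)" by auto
  have "perimeter F W \<le> perimeter (F \<union> - G) W"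
    using assms(1) admissible_complement[OF a(1)] a unfolding super_area_minimizing_def e[symmetric] by blast
  also have "F \<union> - G = - (- F \<inter> G)" by auto
  finally show "perimeter (- F) W \<le> perimeter (- F \<inter> G) W"
    using perimeter_complement[of F W] perimeter_complement[of "- F \<inter> G" W] L lebesgue_compl[OF L(1)] by auto
qed

lemma super_area_minimizing_complement:
  assumes "sub_area_minimizing F U" "admissible F" shows "super_area_minimizing (- F) U"
  unfolding super_area_minimizing_def
proof (intro allI impI, elim conjE)
  fix G W assume a: "admissible G" "open W" "bounded W" "W \<subseteq> U" "compactly_contained ((- F - G) \<union> (G - - F)) W"
  have L: "F \<in> sets lebesgue" "G \<in> sets lebesgue" using a assms(2) admissible_lebesgue by auto
  have e: "(F - - G) \<union> (- G - F) = (- F - G) \<union> (G - - F)" by auto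
  have "perimeter F W \<le> perimeter (F \<inter> - G) W"
    using assms(1) admissible_complement[OF a(1)] a unfolding sub_area_minimizing_def e[symmetric] by blast
  also have "F \<inter> - G = - (- F \<union> G)" by auto
  finally show "perimeter (- F) W \<le> perimeter (- F \<union> G) W"
    using perimeter_complement[of F W] perimeter_complement[of "- F \<union> G" W] L lebesgue_compl[OF L(1)] by auto
qed

text \<open>Comparison with an arbitrary measurable competitor: its normal representative still agrees
  with \<open>F\<close> off the closure of the difference, because normalization is local.\<close>
lemma super_area_minimizing_compare:
  assumes F: "super_area_minimizing F U" "admissible F" and G: "G \<in> sets lebesgue" "F \<subseteq> G"
    and W: "open W" "bounded W" "W \<subseteq> U" and C: "compact (closure (G - F))" "closure (G - F) \<subseteq> W"
  shows "perimeter F W \<le> perimeter G W"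
\<comment> \<open>If the competitor has infinite perimeter in \<open>W\<close> the inequality is
  immediate; otherwise gluing with \<open>F\<close> makes its perimeter locally finite everywhere,
  as admissibility demands.\<close>
proof (cases "perimeter G W < \<infinity>")
  case True
  have FL: "F \<in> sets lebesgue" using F(2) by (rule admissible_lebesgue)
  let ?C = "closure (G - F)"
  have GF: "x \<in> G \<longleftrightarrow> x \<in> F" if "x \<notin> ?C" for x using that G(2) subsetD[OF closure_subset, of x "G - F"] by auto
  have "locally_finite_perimeter G" unfolding locally_finite_perimeter_def
  proof (intro conjI allI impI)
    fix V :: "'a set" assume "open V \<and> bounded V"
    then have "perimeter F V < \<infinity>" using F(2) by (simp add: admissible_def locally_finite_perimeter_def)
    then show "perimeter G V < \<infinity>"
      using GF by (intro perimeter_glue_finite[OF C(1) W(1) C(2) G(1) FL _ True]) auto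
  qed (rule G(1))
  then have adm: "admissible (normal_rep G)" by (rule admissible_normal_rep)
  have Fn: "F = normal_rep F" using F(2) by (auto simp: admissible_def normalized_def normal_rep_def)
  have "x \<in> normal_rep G \<longleftrightarrow> x \<in> F" if x: "x \<notin> ?C" for x
  proof -
    have "x \<in> density_points G t \<longleftrightarrow> x \<in> density_points F t" for t
      by (rule density_points_cong[OF G(1) FL, of "- ?C"]) (use GF x in auto)
    then show ?thesis by (subst Fn) (auto simp: normal_rep_def GF[OF x])
  qed
  then have "(F - normal_rep G) \<union> (normal_rep G - F) \<subseteq> ?C" by blast
  then have c: "closure ((F - normal_rep G) \<union> (normal_rep G - F)) \<subseteq> ?C" by (rule closure_minimal) simp
  then have "compactly_contained ((F - normal_rep G) \<union> (normal_rep G - F)) W"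
    unfolding compactly_contained_def using C W
    by (metis (no_types, lifting) bounded_subset closed_closure compact_eq_bounded_closed interior_open order_trans)
  then have "perimeter F W \<le> perimeter (F \<union> normal_rep G) W"
    using F(1) adm W unfolding super_area_minimizing_def by blast
  also have "\<dots> = perimeter G W"
  proof (rule perimeter_cong_AE)
    show "AE x in lebesgue. x \<in> W \<longrightarrow> (x \<in> F \<union> normal_rep G) = (x \<in> G)"
      using normal_rep_AE(1)[OF G(1)] by eventually_elim (use G(2) in auto)
  qed (use G FL normal_rep_AE(2)[OF G(1)] in auto)
  finally show ?thesis .
qed auto

lemma sub_area_minimizing_compare:
  assumes E: "sub_area_minimizing E U" "admissible E" and G: "G \<in> sets lebesgue" "G \<subseteq> E"
    and W: "open W" "bounded W" "W \<subseteq> U" and C: "compact (closure (E - G))" "closure (E - G) \<subseteq> W"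
  shows "perimeter E W \<le> perimeter G W"
proof -
  have e: "- G - - E = E - G" by auto
  have "perimeter (- E) W \<le> perimeter (- G) W"
    using super_area_minimizing_compare[OF super_area_minimizing_complement[OF E] admissible_complement[OF E(2)]
        lebesgue_compl[OF G(1)] _ W] C G(2) unfolding e by auto
  then show ?thesis using perimeter_complement[OF G(1)] perimeter_complement[OF admissible_lebesgue[OF E(2)]] by simp
qed

subsection \<open>Translation\<close>

lemma test_field_translate:
  assumes "\<phi> \<in> test_fields W"
  shows "(\<lambda>x. \<phi> (x + v)) \<in> test_fields {x. x + v \<in> W}"
proof -
  let ?C = "closure {x. \<phi> x \<noteq> 0}"
  have C: "compact ?C" "?C \<subseteq> W" "C1 \<phi>" "\<And>x. norm (\<phi> x) \<le> 1" using assms by (auto simp: test_fields_iff)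
  show ?thesis
  proof (rule test_fieldsI[of _ "(\<lambda>x. x - v) ` ?C"])
    show "compact ((\<lambda>x. x - v) ` ?C)" using C(1) by (intro compact_continuous_image continuous_intros)
    show "(\<lambda>x. x - v) ` ?C \<subseteq> {x. x + v \<in> W}" using C(2) by auto
    show "\<phi> (x + v) = 0" if "x \<notin> (\<lambda>x. x - v) ` ?C" for x
    proof (rule ccontr)
      assume "\<phi> (x + v) \<noteq> 0"
      then have "x + v \<in> ?C" by (intro subsetD[OF closure_subset]) simp
      then have "x + v - v \<in> (\<lambda>x. x - v) ` ?C" by blast
      then show False using that by simp
    qed
  qed (use C in \<open>auto intro: C1_translate\<close>)
qed

lemma perimeter_translate_le:
  fixes E :: "'a::euclidean_space set"
  assumes E: "E \<in> sets borel"
  shows "perimeter E W \<le> perimeter {x. x + v \<in> E} {x. x + v \<in> W}"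
  unfolding perimeter_def[of E]
proof (rule SUP_least)
  fix \<phi> :: "'a \<Rightarrow> 'a" assume \<phi>: "\<phi> \<in> test_fields W"
  then have C: "C1 \<phi>" by (simp add: test_fields_iff)
  have [measurable]: "divergence \<phi> \<in> borel_measurable borel" "E \<in> sets borel" using divergence_measurable[OF C] E by auto
  have Ev: "{x. x + v \<in> E} \<in> sets borel" by measurable
  have "(LINT x:{x. x + v \<in> E}|lebesgue. divergence (\<lambda>x. \<phi> (x + v)) x)
     = (LBINT x. indicator E (v + x) * divergence \<phi> (v + x))"
    unfolding divergence_set_integral_lborel[OF test_field_translate[OF \<phi>] Ev]
    by (simp add: divergence_translate[OF C] indicator_def add.commute)
  also have "\<dots> = (LINT x:E|lebesgue. divergence \<phi> x)"
    unfolding divergence_set_integral_lborel[OF \<phi> E] by (rule lborel_integral_translate) measurable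
  finally show "ereal (LINT x:E|lebesgue. divergence \<phi> x) \<le> perimeter {x. x + v \<in> E} {x. x + v \<in> W}"
    using perimeter_upper[OF test_field_translate[OF \<phi>], of "{x. x + v \<in> E}" v] by simp
qed

lemma lebesgue_translate:
  fixes E :: "'a::euclidean_space set"
  assumes "E \<in> sets lebesgue" shows "{x. x + v \<in> E} \<in> sets lebesgue"
proof -
  have "{x. x + v \<in> E} = (+) (- v) ` E" by (force simp: image_iff)
  then show ?thesis using lebesgue_sets_translation[OF assms, of "- v"] by (simp only:)
qed

lemma AE_lebesgue_translate:
  fixes P :: "'a::euclidean_space \<Rightarrow> bool"
  assumes "AE x in lebesgue. P x" shows "AE x in lebesgue. P (x + v)"
proof -
  obtain N where N: "N \<in> null_sets lebesgue" "\<And>x. \<not> P x \<Longrightarrow> x \<in> N" using assms by (auto simp: eventually_ae_filter)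
  have "{x. x + v \<in> N} = (+) (- v) ` N" by (force simp: image_iff)
  then have "{x. x + v \<in> N} \<in> null_sets lebesgue"
    using negligible_translation[of N "- v"] N(1) by (simp only: negligible_iff_null_sets)
  then show ?thesis by (rule AE_I') (use N(2) in auto)
qed

lemma perimeter_translate:
  fixes E :: "'a::euclidean_space set"
  assumes E: "E \<in> sets lebesgue"
  shows "perimeter {x. x + v \<in> E} {x. x + v \<in> W} = perimeter E W"
proof -
  have le: "perimeter E W \<le> perimeter {x. x + v \<in> E} {x. x + v \<in> W}" if E: "E \<in> sets lebesgue" for E W :: "'a set" and v
  proof -
    obtain E' where E': "E' \<in> sets borel" "AE x in lebesgue. x \<in> E \<longleftrightarrow> x \<in> E'" using lebesgue_borel_AE[OF E] by metis
    have [measurable]: "E' \<in> sets borel" by fact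
    have "perimeter E W = perimeter E' W" using E E' by (intro perimeter_cong_AE) auto
    also have "\<dots> \<le> perimeter {x. x + v \<in> E'} {x. x + v \<in> W}" by (rule perimeter_translate_le[OF E'(1)])
    also have "\<dots> = perimeter {x. x + v \<in> E} {x. x + v \<in> W}"
      using E E'(1) AE_lebesgue_translate[OF E'(2), of v]
      by (intro perimeter_cong_AE lebesgue_translate) auto
    finally show ?thesis .
  qed
  show ?thesis
    using le[OF E, of W v] le[OF lebesgue_translate[OF E], of v "{x. x + v \<in> W}" "- v"] by simp
qed

subsection \<open>Averaging over translations\<close>

lemma frechet_derivative_bump:
  "frechet_derivative (\<lambda>y. bump \<rho> (y - a)) (at y) h = bump_grad \<rho> (y - a) \<bullet> h"
  "C1 (\<lambda>y. bump \<rho> (y - a))"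
proof -
  have C: "C1 (bump \<rho>)" by (rule C1_kernel[OF kernel_bump])
  show "C1 (\<lambda>y. bump \<rho> (y - a))" using C1_translate[OF C, of "- a"] by simp
  have "frechet_derivative (\<lambda>y. bump \<rho> (y - a)) (at y) = frechet_derivative (bump \<rho>) (at (y - a))"
    using frechet_derivative_translate[OF C, of "- a" y] by simp
  also have "\<dots> = (\<lambda>h. bump_grad \<rho> (y - a) \<bullet> h)"
    using frechet_derivative_at[OF kernel_deriv[OF kernel_bump]] by metis
  finally show "frechet_derivative (\<lambda>y. bump \<rho> (y - a)) (at y) h = bump_grad \<rho> (y - a) \<bullet> h" by simp
qed

lemma norm_convex_comb_le_1:
  fixes a b :: "'a::real_normed_vector"
  assumes "norm a \<le> 1" "norm b \<le> 1" "0 \<le> t" "t \<le> 1"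
  shows "norm (a + t *\<^sub>R (b - a)) \<le> 1"
proof -
  have "a + t *\<^sub>R (b - a) = (1 - t) *\<^sub>R a + t *\<^sub>R b" by (simp add: algebra_simps)
  also have "norm \<dots> \<le> (1 - t) * 1 + t * 1"
    using assms by (intro order_trans[OF norm_triangle_ineq] add_mono) (auto simp: mult_left_le)
  finally show ?thesis by simp
qed

text \<open>The perturbation argument: \<open>w\<close> is the average of the sets \<open>F \<union> (E + v)\<close>, each of perimeter at
  most \<open>p\<close>, yet has variation at least \<open>p\<close>. Hence a near-optimal field \<open>\<phi>\<close> for \<open>w\<close> is near-optimal
  for almost all translates, and modifying it near \<open>x0\<close> by \<open>e + \<tau>(y - v)(u - e)\<close> cannot gain. As
  \<open>w\<close> is smooth near \<open>x0\<close>, \<open>\<phi>\<close> is there close to the normal \<open>e\<close> of \<open>w\<close> at \<open>x0\<close>.\<close>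
lemma averaged_translates_flat:
  fixes E F W :: "'a::euclidean_space set"
  assumes W: "open W" and E: "E \<in> sets borel" and F: "F \<in> sets borel" and r: "r > 0"
    and p1: "\<And>v. norm v < 2 * r \<Longrightarrow> var_le (indicator (F \<union> {x. x - v \<in> E})) W p"
    and p2: "\<And>c. var_le (\<lambda>x. max (indicator F x) (conv (bump r) (indicator E) x / bump_mass TYPE('a) r)) W c \<Longrightarrow> p \<le> c"
    and ball: "\<rho>0 > 0" "ball x0 \<rho>0 \<subseteq> W" "ball x0 \<rho>0 \<inter> F = {}"
  shows "\<exists>e. norm e = 1 \<and> (\<forall>(\<tau> :: 'a \<Rightarrow> real) u. C1 \<tau> \<and> (\<forall>x. 0 \<le> \<tau> x \<and> \<tau> x \<le> 1) \<and> (\<forall>x. r / 2 < norm (x - x0) \<longrightarrow> \<tau> x = 0) \<and> norm u \<le> 1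
      \<longrightarrow> (LBINT z. indicator E z * frechet_derivative \<tau> (at z) (u - e)) \<le> 0)"
proof -
  define iE where "iE = (indicator E :: 'a \<Rightarrow> real)"
  define iF where "iF = (indicator F :: 'a \<Rightarrow> real)"
  define \<Theta> where "\<Theta> = bump_mass TYPE('a) r"
  define g where "g = conv (bump r) iE"
  \<comment> \<open>With \<Theta> the total mass of the kernel, this is the average of the
    indicators of \<open>F \<union> {x. x - v \<in> E}\<close> over \<open>v\<close>: it is 1 on
    \<open>F\<close>, and elsewhere \<open>F\<close> contributes nothing.\<close>
  define w where "w x = max (iF x) (g x / \<Theta>)" for x
  have [measurable]: "iE \<in> borel_measurable borel" "iF \<in> borel_measurable borel"
    unfolding iE_def iF_def using E F by measurable
  have iEm: "iE \<in> borel_measurable lborel" by measurable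
  have iE1: "norm (iE z) \<le> 1" "0 \<le> iE z" "iE z \<le> 1" "\<bar>iE z\<bar> \<le> 1" for z by (auto simp: iE_def indicator_def)
  have iF1: "0 \<le> iF z" "iF z \<le> 1" for z by (auto simp: iF_def indicator_def)
  have \<Theta>: "\<Theta> > 0" using bump_mass_pos[OF r] by (simp add: \<Theta>_def)
  have gC: "C1 g" unfolding g_def by (rule C1_conv[OF kernel_bump iEm iE1(1)])
  have [measurable]: "g \<in> borel_measurable borel" using C1_continuous[OF gC] by (rule borel_measurable_continuous_onI)
  have g0: "0 \<le> g x" for x unfolding g_def conv_def
    by (intro integral_nonneg_AE AE_I2) (auto simp: bump_props[OF r] iE1)
  have br: "integrable lborel (\<lambda>z. bump r (x - z))" "(LBINT z. bump r (x - z)) = \<Theta>" for x :: 'a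
  proof -
    show e: "(LBINT z. bump r (x - z)) = \<Theta>"
      using lborel_integral_reflect[of "bump r" x] by (simp add: \<Theta>_def bump_mass_def)
    show "integrable lborel (\<lambda>z. bump r (x - z))" using not_integrable_integral_eq e \<Theta> by fastforce
  qed
  have bi: "integrable lborel (\<lambda>z. bump r (x - z) * iE z)" for x :: 'a
    using conv_integrable[of "bump r" "2 * r" iE 1 x] bump_continuous(1) bump_props(4)[OF r] iEm iE1(1) by auto
  have g\<Theta>: "g x \<le> \<Theta>" for x
  proof -
    have "g x \<le> (LBINT z. bump r (x - z))" unfolding g_def conv_def real_scaleR_def
      by (intro integral_mono bi br) (auto simp: bump_props[OF r] iE1 mult_left_le)
    then show ?thesis by (simp add: br)
  qed
  have w01: "0 \<le> w x" "w x \<le> 1" "\<bar>w x\<bar> \<le> 1" for x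
    using iF1[of x] g0[of x] g\<Theta>[of x] \<Theta> by (auto simp: w_def max_def)
  have [measurable]: "w \<in> borel_measurable borel" unfolding w_def by measurable
  define N where "N x = (\<Sum>b\<in>Basis. frechet_derivative g (at x) b *\<^sub>R b)" for x
  have DN: "frechet_derivative g (at x) h = N x \<bullet> h" for x h
  proof -
    have L: "linear (frechet_derivative g (at x))" using C1_has_derivative[OF gC] has_derivative_linear by blast
    have "frechet_derivative g (at x) h = frechet_derivative g (at x) (\<Sum>b\<in>Basis. (h \<bullet> b) *\<^sub>R b)"
      by (simp add: euclidean_representation)
    also have "\<dots> = (\<Sum>b\<in>Basis. (h \<bullet> b) * frechet_derivative g (at x) b)"
      by (simp add: linear_sum[OF L] linear_cmul[OF L])
    finally show ?thesis unfolding N_def inner_sum_left inner_scaleR_left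
      by (simp only: inner_commute[of h] mult.commute)
  qed
  have Nc: "continuous_on UNIV N" unfolding N_def[abs_def]
    by (intro continuous_intros C1_gradient_continuous gC)
  \<comment> \<open>Against the gradient \<open>N\<close> a field pairs best in direction
    \<open>- N\<close>, so \<open>e\<close> is the optimal constant field at \<open>x0\<close>; any
    unit vector does when \<open>N x0 = 0\<close>. The loss of \<open>e\<close> at other points is
    the function \<open>K\<close> below, which vanishes at \<open>x0\<close>.\<close>
  obtain e where e: "norm e = 1" "norm (N x0) + N x0 \<bullet> e = 0"
  proof (cases "N x0 = 0")
    case True
    then show ?thesis using that[of "SOME b. b \<in> Basis"] by (simp add: SOME_Basis)
  next
    case False
    then show ?thesis using that[of "(- 1 / norm (N x0)) *\<^sub>R N x0"] by (simp add: dot_square_norm power2_eq_square)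
  qed
  define K where "K y = norm (N y) + N y \<bullet> e" for y
  have Kc: "continuous_on UNIV K" unfolding K_def[abs_def] by (intro continuous_intros Nc)
  have "(LBINT z. iE z * frechet_derivative \<tau> (at z) (u - e)) \<le> 0"
    if \<tau>: "C1 \<tau>" "\<And>x. 0 \<le> \<tau> x" "\<And>x. \<tau> x \<le> 1" "\<And>x. r / 2 < norm (x - x0) \<Longrightarrow> \<tau> x = 0" and u: "norm u \<le> 1" for \<tau> u
  proof -
    define d\<tau> where "d\<tau> z = frechet_derivative \<tau> (at z) (u - e)" for z
    have \<tau>z: "\<tau> z = 0" "d\<tau> z = 0" if "r / 2 < norm (z - x0)" for z
    proof -
      show "\<tau> z = 0" using \<tau>(4)[OF that] .
      have "closure {x. \<tau> x \<noteq> 0} \<subseteq> cball x0 (r / 2)"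
        by (rule closure_minimal) (use \<tau>(4) in \<open>auto simp: not_less[symmetric] dist_norm norm_minus_commute\<close>)
      then have "z \<notin> closure {x. \<tau> x \<noteq> 0}" using that by (auto simp: dist_norm norm_minus_commute)
      then show "d\<tau> z = 0" unfolding d\<tau>_def by (simp add: frechet_derivative_zero_outside)
    qed
    have far: "r / 2 < norm (z - x0)" if "norm x0 + r / 2 < norm z" for z
      using that norm_triangle_ineq2[of z x0] by linarith
    have d\<tau>c: "continuous_on UNIV d\<tau>" unfolding d\<tau>_def by (intro C1_derivative_continuous \<tau>) auto
    have \<tau>c: "continuous_on UNIV \<tau>" by (intro C1_continuous \<tau>)
    have [measurable]: "\<tau> \<in> borel_measurable borel" "d\<tau> \<in> borel_measurable borel"
      using \<tau>c d\<tau>c by (auto intro: borel_measurable_continuous_onI)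
    obtain B\<tau> where B\<tau>: "B\<tau> \<ge> 0" "\<And>z. \<bar>d\<tau> z\<bar> \<le> B\<tau>"
      using continuous_support_bounded(2)[OF d\<tau>c, of "norm x0 + r / 2"] \<tau>z far by blast
    have i\<tau>: "integrable lborel (\<lambda>z. iE z * \<tau> z)"
      by (rule integrable_bounded_support[of _ 1 0 "norm x0 + r / 2"])
         (use \<tau> \<tau>z(1)[OF far] iE1 in \<open>auto simp: abs_mult intro!: mult_le_one\<close>)
    have id\<tau>: "integrable lborel (\<lambda>z. iE z * d\<tau> z)"
    proof (rule integrable_bounded_support[of _ "1 * B\<tau>" 0 "norm x0 + r / 2"])
      show "norm (iE z * d\<tau> z) \<le> 1 * B\<tau>" for z
        unfolding real_norm_def abs_mult using B\<tau> iE1(4) by (intro mult_mono) auto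
    qed (use \<tau>z(2)[OF far] in auto)
    \<comment> \<open>\<open>M\<close> is the quantity to be bounded by 0. The companion
      \<open>T\<close> arises from differentiating the cutoff and drops out after
      integration.\<close>
    define M where "M = (LBINT z. iE z * d\<tau> z)"
    define T where "T = (LBINT z. iE z * \<tau> z)"
    have "M \<le> \<epsilon>" if \<epsilon>: "\<epsilon> > 0" for \<epsilon>
    proof -
      have "isCont K x0" using Kc by (simp add: continuous_on_eq_continuous_at)
      then obtain \<delta> where \<delta>: "\<delta> > 0" "\<And>y. dist y x0 < \<delta> \<Longrightarrow> dist (K y) (K x0) < \<epsilon>"
        unfolding continuous_at_eps_delta using \<epsilon> by blast
      \<comment> \<open>The cutoff \<xi> lives on the ball of radius \<open>2 * \<rho>\<close>.
        There \<delta> keeps the loss \<open>K\<close> below \<epsilon>, \<open>\<rho>0\<close>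
        keeps away from \<open>F\<close>, and \<open>r / 2\<close> keeps the kernel on its
        plateau.\<close>
      define \<rho> where "\<rho> = min \<delta> (min \<rho>0 (r / 2)) / 4"
      have \<rho>: "\<rho> > 0" "2 * \<rho> < \<delta>" "2 * \<rho> < \<rho>0" "2 * \<rho> < r / 2" using \<delta>(1) ball(1) r by (auto simp: \<rho>_def)
      define \<xi> where "\<xi> y = bump \<rho> (y - x0)" for y
      note D\<xi> = frechet_derivative_bump(1)[of \<rho> x0, folded \<xi>_def]
      have \<xi>C: "C1 \<xi>" unfolding \<xi>_def[abs_def] by (rule frechet_derivative_bump(2))
      have \<xi>01: "0 \<le> \<xi> y" "\<xi> y \<le> 1" for y by (auto simp: \<xi>_def bump_props[OF \<rho>(1)])
      have \<xi>z: "\<xi> y = 0" "bump_grad \<rho> (y - x0) = 0" if "2 * \<rho> \<le> norm (y - x0)" for y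
        using bump_props[OF \<rho>(1)] that by (auto simp: \<xi>_def)
      define R\<xi> where "R\<xi> = norm x0 + 2 * \<rho>"
      have farx: "2 * \<rho> \<le> norm (y - x0)" if "R\<xi> < norm y" for y
        using that norm_triangle_ineq2[of y x0] by (simp add: R\<xi>_def)
      have \<xi>c: "continuous_on UNIV \<xi>" by (rule C1_continuous[OF \<xi>C])
      have i\<xi>: "integrable lborel \<xi>"
        by (rule continuous_support_bounded(1)[OF \<xi>c, of R\<xi>]) (use \<xi>z farx in auto)
      have \<xi>pos: "(LBINT y. \<xi> y) > 0"
        using lborel_integral_translate[of "bump \<rho>" "- x0"] bump_mass_pos[where 'a='a, OF \<rho>(1)] by (simp add: \<xi>_def bump_mass_def)
      define a where "a y = bump_grad \<rho> (y - x0) \<bullet> e" for y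
      define b where "b y = bump_grad \<rho> (y - x0) \<bullet> (u - e)" for y
      have abc: "continuous_on UNIV a" "continuous_on UNIV b" unfolding a_def b_def
        by (intro continuous_intros continuous_on_compose2[OF bump_continuous(2)]; simp)+
      have [measurable]: "a \<in> borel_measurable borel" "b \<in> borel_measurable borel" "\<xi> \<in> borel_measurable borel"
        using abc \<xi>c by (auto intro: borel_measurable_continuous_onI)
      have abz: "a y = 0" "b y = 0" "\<xi> y = 0" if "R\<xi> < norm y" for y using \<xi>z[OF farx[OF that]] by (auto simp: a_def b_def)
      obtain Ba where Ba: "Ba \<ge> 0" "\<And>y. \<bar>a y\<bar> \<le> Ba" using continuous_support_bounded(2)[OF abc(1) abz(1)] by blast
      obtain Bb where Bb: "Bb \<ge> 0" "\<And>y. \<bar>b y\<bar> \<le> Bb" using continuous_support_bounded(2)[OF abc(2) abz(2)] by blast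
      have main: "M * (LBINT y. \<xi> y) \<le> (LBINT y. \<xi> y * K y) + \<Theta> * \<eta>" if \<eta>: "\<eta> > 0" for \<eta>
      proof -
        have "\<not> var_le w W (p - \<eta>)"
        proof
          assume "var_le w W (p - \<eta>)"
          then have "p \<le> p - \<eta>" by (intro p2) (simp add: w_def[abs_def] g_def iE_def iF_def \<Theta>_def)
          then show False using \<eta> by simp
        qed
        then obtain \<phi> where \<phi>: "\<phi> \<in> test_fields W" "p - \<eta> < (LBINT x. w x * divergence \<phi> x)"
          by (auto simp: var_le_def not_le)
        obtain R where R: "C1 \<phi>" "\<And>x. norm (\<phi> x) \<le> 1" "\<And>x. x \<notin> W \<Longrightarrow> \<phi> x = 0" "\<And>x. R < norm x \<Longrightarrow> \<phi> x = 0"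
          using test_fieldsE[OF \<phi>(1)] by metis
        \<comment> \<open>Of the near-optimal field \<phi> only the part \<phi>2 is kept; \<phi>1 is
          replaced by a field adapted to each translate.\<close>
        define \<phi>1 where "\<phi>1 y = \<xi> y *\<^sub>R \<phi> y" for y
        define \<phi>2 where "\<phi>2 y = (1 - \<xi> y) *\<^sub>R \<phi> y" for y
        have \<phi>12C: "C1 \<phi>1" "C1 \<phi>2" unfolding \<phi>1_def[abs_def] \<phi>2_def[abs_def] by (intro C1_scaleR C1_diff C1_const \<xi>C R)+
        define \<kappa> where "\<kappa> = divergence \<phi>2"
        have \<kappa>z: "\<kappa> y = 0" if "R < norm y" for y unfolding \<kappa>_def
          by (rule divergence_zero_outside, rule not_in_closure_support[of R]) (use R that in \<open>auto simp: \<phi>2_def\<close>)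
        have \<kappa>c: "continuous_on UNIV \<kappa>" unfolding \<kappa>_def by (rule divergence_continuous[OF \<phi>12C(2)])
        have [measurable]: "\<kappa> \<in> borel_measurable borel" using \<kappa>c by (rule borel_measurable_continuous_onI)
        obtain B\<kappa> where B\<kappa>: "B\<kappa> \<ge> 0" "\<And>y. \<bar>\<kappa> y\<bar> \<le> B\<kappa>" using continuous_support_bounded(2)[OF \<kappa>c \<kappa>z] by blast
        \<comment> \<open>This is the divergence of \<xi> times the field
          \<open>e + \<tau> z *\<^sub>R (u - e)\<close> at \<open>z = y - v\<close>, by the product
          rule. \<open>H1\<close> and \<open>H2\<close> are the weighted contributions of the new
          part and of the kept part.\<close>
        define A where "A y z = \<xi> y * d\<tau> z + a y + \<tau> z * b y" for y z
        define H1 where "H1 v y = bump r v * (iE (y - v) * A y (y - v))" for v y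
        define H2 where "H2 v y = bump r v * (max (iF y) (iE (y - v)) * \<kappa> y)" for v y
        have bz: "bump r v = 0" if "2 * r \<le> norm v" for v :: 'a using bump_props(4)[OF r that] .
        have bb: "0 \<le> bump r v" "bump r v \<le> 1" "\<bar>bump r v\<bar> \<le> 1" for v :: 'a using bump_props[OF r, of v] by auto
        have H1i: "integrable (lborel \<Otimes>\<^sub>M lborel) (case_prod H1)"
        proof (rule integrable_pair_bounded_support[where B="1 * (1 * (1 * B\<tau> + Ba + 1 * Bb))" and R="max (2 * r) R\<xi>"])
          show "case_prod H1 \<in> borel_measurable (borel \<Otimes>\<^sub>M borel)" unfolding H1_def A_def by measurable
          fix v y
          have "\<bar>A y (y - v)\<bar> \<le> \<bar>\<xi> y * d\<tau> (y - v)\<bar> + \<bar>a y\<bar> + \<bar>\<tau> (y - v) * b y\<bar>" unfolding A_def by linarith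
          also have "\<dots> \<le> 1 * B\<tau> + Ba + 1 * Bb" unfolding abs_mult
            using \<xi>01[of y] B\<tau> Ba Bb \<tau>(2,3)[of "y - v"] by (intro add_mono mult_mono) auto
          finally have Ab: "\<bar>A y (y - v)\<bar> \<le> 1 * B\<tau> + Ba + 1 * Bb" .
          show "\<bar>H1 v y\<bar> \<le> 1 * (1 * (1 * B\<tau> + Ba + 1 * Bb))" unfolding H1_def abs_mult
            using bb iE1 Ab B\<tau> Ba Bb by (intro mult_mono) auto
        next
          show "H1 v y = 0" if "max (2 * r) R\<xi> < norm v" for v y using bz[of v] that by (simp add: H1_def)
          show "H1 v y = 0" if "max (2 * r) R\<xi> < norm y" for v y using abz[of y] that by (simp add: H1_def A_def)
        qed
        have H2i: "integrable (lborel \<Otimes>\<^sub>M lborel) (case_prod H2)"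
        proof (rule integrable_pair_bounded_support[where B="1 * (1 * B\<kappa>)" and R="max (2 * r) R"])
          show "case_prod H2 \<in> borel_measurable (borel \<Otimes>\<^sub>M borel)" unfolding H2_def by measurable
          fix v y
          have "\<bar>max (iF y) (iE (y - v))\<bar> \<le> 1" using iF1[of y] iE1(2,3)[of "y - v"] by auto
          then show "\<bar>H2 v y\<bar> \<le> 1 * (1 * B\<kappa>)" unfolding H2_def abs_mult
            using bb B\<kappa> by (intro mult_mono) auto
        next
          show "H2 v y = 0" if "max (2 * r) R < norm v" for v y using bz[of v] that by (simp add: H2_def)
          show "H2 v y = 0" if "max (2 * r) R < norm y" for v y using \<kappa>z[of y] that by (simp add: H2_def)
        qed
        \<comment> \<open>For each \<open>v\<close> the modified field is an admissible test for the
          union of \<open>F\<close> with the translate, which has variation at most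
          \<open>p\<close>; the weight \<open>bump r v\<close> is nonnegative.\<close>
        have inner: "(LBINT y. H1 v y + H2 v y) \<le> p * bump r v" for v
        proof (cases "2 * r \<le> norm v")
          case True
          then show ?thesis by (simp add: H1_def H2_def bz)
        next
          case False
          \<comment> \<open>The perturbation moves along with the translate, so that every
            \<open>v\<close> tests the same piece of \<open>E\<close>.\<close>
          define \<phi>v where "\<phi>v y = e + \<tau> (y - v) *\<^sub>R (u - e)" for y
          have \<tau>vC: "C1 (\<lambda>y. \<tau> (y - v))" using C1_translate[OF \<tau>(1), of "- v"] by simp
          have D\<tau>v: "frechet_derivative (\<lambda>y. \<tau> (y - v)) (at y) = frechet_derivative \<tau> (at (y - v))" for y
            using frechet_derivative_translate[OF \<tau>(1), of "- v" y] by simp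
          have vC: "C1 \<phi>v" unfolding \<phi>v_def[abs_def] by (intro C1_add C1_const C1_scaleR \<tau>vC)
          have v1: "norm (\<phi>v y) \<le> 1" for y unfolding \<phi>v_def
            by (rule norm_convex_comb_le_1) (use e u \<tau> in auto)
          have dc: "divergence (\<lambda>_. c) y = 0" for c y :: 'a
            by (simp add: divergence_def frechet_derivative_const)
          have dv: "divergence \<phi>v y = d\<tau> (y - v)" for y
            unfolding \<phi>v_def[abs_def] d\<tau>_def
            by (subst divergence_add) (simp_all add: C1_scaleR[OF \<tau>vC C1_const] divergence_scaleR[OF \<tau>vC C1_const] dc D\<tau>v)
          define \<Psi> where "\<Psi> y = \<xi> y *\<^sub>R \<phi>v y + \<phi>2 y" for y
          have \<Psi>t: "\<Psi> \<in> test_fields W"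
          proof (rule test_fieldsI[of _ "cball x0 (2 * \<rho>) \<union> closure {x. \<phi> x \<noteq> 0}"])
            show "C1 \<Psi>" unfolding \<Psi>_def[abs_def] by (intro C1_add C1_scaleR \<xi>C vC \<phi>12C)
            show "norm (\<Psi> y) \<le> 1" for y
            proof -
              have "\<Psi> y = \<phi> y + \<xi> y *\<^sub>R (\<phi>v y - \<phi> y)" by (simp add: \<Psi>_def \<phi>2_def algebra_simps)
              then show ?thesis using norm_convex_comb_le_1[OF R(2) v1 \<xi>01] by simp
            qed
            show "\<Psi> y = 0" if "y \<notin> cball x0 (2 * \<rho>) \<union> closure {x. \<phi> x \<noteq> 0}" for y
            proof -
              have "\<phi> y = 0" using that subsetD[OF closure_subset, of y "{x. \<phi> x \<noteq> 0}"] by auto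
              moreover have "\<xi> y = 0" using that by (intro \<xi>z) (auto simp: dist_norm norm_minus_commute)
              ultimately show ?thesis by (simp add: \<Psi>_def \<phi>2_def)
            qed
            show "compact (cball x0 (2 * \<rho>) \<union> closure {x. \<phi> x \<noteq> 0})" using \<phi>(1) by (intro compact_Un) (auto simp: test_fields_iff)
            have "cball x0 (2 * \<rho>) \<subseteq> ball x0 \<rho>0" using \<rho>(3) by auto
            then show "cball x0 (2 * \<rho>) \<union> closure {x. \<phi> x \<noteq> 0} \<subseteq> W" using \<phi>(1) ball(2) by (auto simp: test_fields_iff)
          qed
          have d\<Psi>: "divergence \<Psi> y = A y (y - v) + \<kappa> y" for y
          proof -
            have "divergence \<Psi> y = divergence (\<lambda>y. \<xi> y *\<^sub>R \<phi>v y) y + divergence \<phi>2 y"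
              unfolding \<Psi>_def[abs_def] by (rule divergence_add[OF C1_scaleR[OF \<xi>C vC] \<phi>12C(2)])
            also have "divergence (\<lambda>y. \<xi> y *\<^sub>R \<phi>v y) y = \<xi> y * d\<tau> (y - v) + bump_grad \<rho> (y - x0) \<bullet> \<phi>v y"
              by (simp only: divergence_scaleR[OF \<xi>C vC] dv D\<xi>)
            finally show ?thesis by (simp add: \<kappa>_def A_def a_def b_def \<phi>v_def inner_add_right)
          qed
          have Az: "A y z = 0" if "y \<notin> ball x0 \<rho>0" for y z
          proof -
            have "2 * \<rho> \<le> norm (y - x0)" using that \<rho>(3) by (auto simp: dist_norm norm_minus_commute)
            then show ?thesis using \<xi>z[of y] by (simp add: A_def a_def b_def)
          qed
          have ind: "indicator (F \<union> {x. x - v \<in> E}) y = max (iF y) (iE (y - v))" for y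
            by (auto simp: iF_def iE_def indicator_def)
          have "(LBINT y. max (iF y) (iE (y - v)) * divergence \<Psi> y) \<le> p"
            using p1[of v] \<Psi>t False by (simp add: var_le_def ind)
          then have "bump r v * (LBINT y. max (iF y) (iE (y - v)) * divergence \<Psi> y) \<le> bump r v * p"
            using bb by (intro mult_left_mono) auto
          moreover have "bump r v * (LBINT y. max (iF y) (iE (y - v)) * divergence \<Psi> y) = (LBINT y. H1 v y + H2 v y)"
            unfolding integral_mult_right_zero[symmetric]
          proof (intro Bochner_Integration.integral_cong refl)
            fix y
            show "bump r v * (max (iF y) (iE (y - v)) * divergence \<Psi> y) = H1 v y + H2 v y"
            proof (cases "y \<in> ball x0 \<rho>0")
              case True
              then have "iF y = 0" using ball(3) by (auto simp: iF_def indicator_def)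
              then have "max (iF y) (iE (y - v)) = iE (y - v)" using iE1(2)[of "y - v"] by simp
              then show ?thesis by (simp add: d\<Psi> H1_def H2_def algebra_simps)
            qed (simp add: d\<Psi> H1_def H2_def Az)
          qed
          ultimately show ?thesis by (simp add: mult.commute)
        qed
        have i1: "integrable lborel (\<lambda>v. LBINT y. H1 v y)" "integrable lborel (\<lambda>v. LBINT y. H2 v y)"
          using lborel_pair.integrable_fst[OF H1i] lborel_pair.integrable_fst[OF H2i] by auto
        have "(LBINT v. (LBINT y. H1 v y) + (LBINT y. H2 v y)) \<le> (LBINT v. p * bump r (v::'a))"
        proof (rule integral_mono_AE)
          show "integrable lborel (\<lambda>v. (LBINT y. H1 v y) + (LBINT y. H2 v y))" using i1 by simp
          show "integrable lborel (\<lambda>v::'a. p * bump r v)" using bump_integrable[where 'a='a, OF r] by simp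
          show "AE v in lborel. (LBINT y. H1 v y) + (LBINT y. H2 v y) \<le> p * bump r v"
            using lborel_pair.AE_integrable_fst[OF H1i] lborel_pair.AE_integrable_fst[OF H2i]
          proof eventually_elim
            case (elim v)
            then show ?case using inner[of v] by simp
          qed
        qed
        also have "\<dots> = p * \<Theta>" by (simp add: \<Theta>_def bump_mass_def)
        finally have le1: "(LBINT v. LBINT y. H1 v y) + (LBINT v. LBINT y. H2 v y) \<le> p * \<Theta>"
          using i1 by simp
        \<comment> \<open>The kept part does not depend on \<open>v\<close>, so averaging the
          indicators over \<open>v\<close> restores \<open>w\<close>.\<close>
        have e2: "(LBINT v. LBINT y. H2 v y) = \<Theta> * (LBINT y. w y * \<kappa> y)"
        proof -
          have "(LBINT v. LBINT y. H2 v y) = (LBINT y. LBINT v. H2 v y)"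
            using lborel_pair.Fubini_integral[OF H2i] by simp
          also have "\<dots> = (LBINT y. \<Theta> * (w y * \<kappa> y))"
          proof (intro Bochner_Integration.integral_cong refl)
            fix y
            have "(LBINT v. H2 v y) = (LBINT z. H2 (y - z) y)"
              by (rule lborel_integral_reflect[symmetric]) (simp add: H2_def)
            also have "\<dots> = (LBINT z. (bump r (y - z) * max (iF y) (iE z)) * \<kappa> y)"
              by (simp add: H2_def mult.assoc)
            also have "\<dots> = (LBINT z. bump r (y - z) * max (iF y) (iE z)) * \<kappa> y" by simp
            also have "(LBINT z. bump r (y - z) * max (iF y) (iE z)) = \<Theta> * w y"
            proof (cases "y \<in> F")
              case True
              then have "iF y = 1" by (simp add: iF_def)
              then have "max (iF y) (iE z) = 1" for z using iE1(3)[of z] by (simp add: max_absorb1)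
              moreover have "w y = 1" using \<open>iF y = 1\<close> g\<Theta>[of y] \<Theta> by (simp add: w_def max_absorb1)
              ultimately show ?thesis using br[of y] by simp
            next
              case False
              then have "iF y = 0" by (simp add: iF_def)
              then show ?thesis using iE1(2) g0[of y] \<Theta> by (simp add: w_def max_absorb2 g_def conv_def)
            qed
            finally show "(LBINT v. H2 v y) = \<Theta> * (w y * \<kappa> y)" by simp
          qed
          finally show ?thesis by simp
        qed
        \<comment> \<open>After the substitution \<open>z = y - v\<close> the terms containing
          \<tau> lose the kernel, because it equals 1 wherever they matter, and become products of a
          function of \<open>y\<close> with \<open>M\<close> or \<open>T\<close>. Only the constant
          field \<open>e\<close> still sees the mollification \<open>g\<close>.\<close>
        have e1: "(LBINT v. LBINT y. H1 v y) = M * (LBINT y. \<xi> y) - (LBINT y. \<xi> y * (N y \<bullet> e))"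
        proof -
          have "(LBINT v. LBINT y. H1 v y) = (LBINT y. LBINT v. H1 v y)"
            using lborel_pair.Fubini_integral[OF H1i] by simp
          also have "\<dots> = (LBINT y. M * \<xi> y + g y * a y + T * b y)"
          proof (intro Bochner_Integration.integral_cong refl)
            fix y
            have "(LBINT v. H1 v y) = (LBINT z. H1 (y - z) y)"
              by (rule lborel_integral_reflect[symmetric]) (simp add: H1_def A_def)
            also have "\<dots> = (LBINT z. \<xi> y * (iE z * d\<tau> z) + a y * (bump r (y - z) * iE z) + b y * (iE z * \<tau> z))"
            proof (cases "2 * \<rho> \<le> norm (y - x0)")
              case True
              then show ?thesis using \<xi>z[OF True] by (simp add: H1_def A_def a_def b_def)
            next
              case False
              \<comment> \<open>Both \<open>y\<close> and \<open>z\<close> are within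
                \<open>r / 2\<close> of \<open>x0\<close>, hence within \<open>r\<close> of each
                other.\<close>
              have plateau: "bump r (y - z) * d\<tau> z = d\<tau> z \<and> bump r (y - z) * \<tau> z = \<tau> z" for z
              proof (cases "r / 2 < norm (z - x0)")
                case True
                then show ?thesis using \<tau>z by simp
              next
                case f: False
                have "norm (y - z) \<le> norm (y - x0) + norm (z - x0)"
                  using norm_triangle_ineq4[of "y - x0" "z - x0"] by simp
                then have "norm (y - z) \<le> r" using f False \<rho>(4) by linarith
                then show ?thesis using bump_props(3)[OF r, of "y - z"] by simp
              qed
              show ?thesis
              proof (intro Bochner_Integration.integral_cong refl)
                fix z
                have "H1 (y - z) y = iE z * (\<xi> y * (bump r (y - z) * d\<tau> z) + a y * bump r (y - z) + b y * (bump r (y - z) * \<tau> z))"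
                  by (simp add: H1_def A_def algebra_simps)
                then show "H1 (y - z) y = \<xi> y * (iE z * d\<tau> z) + a y * (bump r (y - z) * iE z) + b y * (iE z * \<tau> z)"
                  unfolding plateau[THEN conjunct1] plateau[THEN conjunct2] by (simp add: algebra_simps)
              qed
            qed
            also have "\<dots> = M * \<xi> y + g y * a y + T * b y"
              using id\<tau> bi[of y] i\<tau> by (simp add: M_def T_def g_def conv_def)
            finally show "(LBINT v. H1 v y) = M * \<xi> y + g y * a y + T * b y" .
          qed
          also have "\<dots> = M * (LBINT y. \<xi> y) - (LBINT y. \<xi> y * (N y \<bullet> e))"
          proof -
            have Ce: "C1 (\<lambda>y. \<xi> y *\<^sub>R c)" for c by (intro C1_scaleR \<xi>C C1_const)
            have ze: "\<xi> y *\<^sub>R c = 0" if "R\<xi> < norm y" for y and c :: 'a using abz(3)[OF that] by simp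
            have de: "divergence (\<lambda>y. \<xi> y *\<^sub>R c) y = bump_grad \<rho> (y - x0) \<bullet> c" for c y
              by (simp add: divergence_scaleR[OF \<xi>C C1_const] D\<xi> divergence_def frechet_derivative_const)
            \<comment> \<open>\<open>b\<close> is the divergence of \<xi> times a constant vector,
              so the unknown \<open>T\<close> disappears.\<close>
            have b0: "(LBINT y. b y) = 0"
              using integral_divergence_zero[OF Ce ze, of R\<xi> "u - e"] by (simp add: de b_def)
            note ip = integration_by_parts[OF gC Ce ze, of R\<xi> e, unfolded de a_def[symmetric]]
            have ib: "integrable lborel b" by (rule continuous_support_bounded(1)[OF abc(2) abz(2)])
            have "(LBINT y. M * \<xi> y + g y * a y + T * b y) = M * (LBINT y. \<xi> y) + (LBINT y. g y * a y) + T * (LBINT y. b y)"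
              using i\<xi> ip(2) ib by simp
            then show ?thesis using ip(1) b0 by (simp add: DN)
          qed
          finally show ?thesis .
        qed
        \<comment> \<open>Dropping \<phi>1 costs at most the variation of \<open>w\<close> weighted
          by \<xi>, since \<phi> has norm at most 1 and \<open>w\<close> equals
          \<open>g / \<Theta>\<close> near \<open>x0\<close>.\<close>
        have e3: "(LBINT y. w y * \<kappa> y) \<ge> (LBINT y. w y * divergence \<phi> y) - (1 / \<Theta>) * (LBINT y. \<xi> y * norm (N y))"
        proof -
          have \<phi>1z: "\<phi>1 y = 0" if "R\<xi> < norm y" for y using abz(3)[OF that] by (simp add: \<phi>1_def)
          note ip = integration_by_parts[OF gC \<phi>12C(1) \<phi>1z, of R\<xi>, simplified]
          have dz: "divergence \<phi>1 y = 0" if "y \<notin> ball x0 \<rho>0" for y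
          proof (rule divergence_zero_outside)
            have "x \<in> cball x0 (2 * \<rho>)" if "\<phi>1 x \<noteq> 0" for x
              using that \<xi>z(1)[of x] by (force simp: \<phi>1_def dist_norm norm_minus_commute)
            then have "closure {x. \<phi>1 x \<noteq> 0} \<subseteq> cball x0 (2 * \<rho>)" by (intro closure_minimal) auto
            then show "y \<notin> closure {x. \<phi>1 x \<noteq> 0}" using that \<rho>(3) by auto
          qed
          have wg: "w y * divergence \<phi>1 y = (1 / \<Theta>) * (g y * divergence \<phi>1 y)" for y
          proof (cases "y \<in> ball x0 \<rho>0")
            case True
            then have "iF y = 0" using ball(3) by (auto simp: iF_def indicator_def)
            then show ?thesis using g0[of y] \<Theta> by (simp add: w_def max_absorb2)
          qed (simp add: dz)
          have "(\<lambda>y. \<phi>1 y + \<phi>2 y) = \<phi>" by (auto simp: \<phi>1_def \<phi>2_def algebra_simps)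
          then have dd: "divergence \<phi> y = divergence \<phi>1 y + \<kappa> y" for y
            using divergence_add[OF \<phi>12C, of y] by (simp add: \<kappa>_def)
          have iw: "integrable lborel (\<lambda>y. w y * divergence \<phi>1 y)" unfolding wg using ip(2) by simp
          have iwk: "integrable lborel (\<lambda>y. w y * \<kappa> y)"
          proof (rule integrable_bounded_support[of _ "1 * B\<kappa>" 0 R])
            show "norm (w y * \<kappa> y) \<le> 1 * B\<kappa>" for y unfolding real_norm_def abs_mult using w01(3) B\<kappa> by (intro mult_mono) auto
          qed (use \<kappa>z in auto)
          have "(LBINT y. w y * divergence \<phi> y) = (LBINT y. w y * divergence \<phi>1 y) + (LBINT y. w y * \<kappa> y)"
            unfolding dd distrib_left by (rule Bochner_Integration.integral_add[OF iw iwk])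
          also have "(LBINT y. w y * divergence \<phi>1 y) = (1 / \<Theta>) * - (LBINT y. N y \<bullet> \<phi>1 y)"
            unfolding wg using ip(1) by (simp add: DN)
          also have "- (LBINT y. N y \<bullet> \<phi>1 y) \<le> (LBINT y. \<xi> y * norm (N y))"
          proof -
            have "- (LBINT y. N y \<bullet> \<phi>1 y) = (LBINT y. - (N y \<bullet> \<phi>1 y))" by simp
            also have "\<dots> \<le> (LBINT y. \<xi> y * norm (N y))"
            proof (rule integral_mono)
              show "integrable lborel (\<lambda>y. - (N y \<bullet> \<phi>1 y))" using ip(3) by (simp add: DN)
              show "integrable lborel (\<lambda>y. \<xi> y * norm (N y))"
                by (rule continuous_support_bounded(1)[of _ R\<xi>]) (use abz(3) in \<open>auto intro!: continuous_intros \<xi>c Nc\<close>)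
              fix y
              have "- (N y \<bullet> \<phi> y) \<le> norm (N y) * norm (\<phi> y)" using Cauchy_Schwarz_ineq2[of "N y" "\<phi> y"] by linarith
              also have "\<dots> \<le> norm (N y) * 1" using R(2)[of y] by (intro mult_left_mono) auto
              finally have "\<xi> y * (- (N y \<bullet> \<phi> y)) \<le> \<xi> y * norm (N y)" using \<xi>01[of y] by (intro mult_left_mono) auto
              then show "- (N y \<bullet> \<phi>1 y) \<le> \<xi> y * norm (N y)" by (simp add: \<phi>1_def)
            qed
            finally show ?thesis .
          qed
          finally show ?thesis using \<Theta> by (simp add: field_simps)
        qed
        have "\<Theta> * (p - \<eta>) - (LBINT y. \<xi> y * norm (N y)) \<le> \<Theta> * (LBINT y. w y * \<kappa> y)"
        proof -
          have "\<Theta> * (p - \<eta> - (1 / \<Theta>) * (LBINT y. \<xi> y * norm (N y))) \<le> \<Theta> * (LBINT y. w y * \<kappa> y)"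
            using e3 \<phi>(2) \<Theta> by (intro mult_left_mono) auto
          then show ?thesis using \<Theta> by (simp add: right_diff_distrib)
        qed
        then have "M * (LBINT y. \<xi> y) \<le> (LBINT y. \<xi> y * (N y \<bullet> e)) + (LBINT y. \<xi> y * norm (N y)) + \<Theta> * \<eta>"
          using le1 e1 e2 by (simp add: algebra_simps)
        also have "(LBINT y. \<xi> y * (N y \<bullet> e)) + (LBINT y. \<xi> y * norm (N y)) = (LBINT y. \<xi> y * K y)"
        proof -
          have "integrable lborel (\<lambda>y. \<xi> y * norm (N y))" "integrable lborel (\<lambda>y. \<xi> y * (N y \<bullet> e))"
            by (rule continuous_support_bounded(1)[of _ R\<xi>]; use abz(3) in \<open>auto intro!: continuous_intros \<xi>c Nc\<close>)+
          then show ?thesis by (simp add: K_def distrib_left)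
        qed
        finally show ?thesis .
      qed
      \<comment> \<open>The optimality gap \<eta> tends to 0 while \<xi> stays fixed. Since
        \<open>K\<close> is at most \<epsilon> on the support of \<xi>, the positive integral of
        \<xi> can then be divided out.\<close>
      have "M * (LBINT y. \<xi> y) \<le> (LBINT y. \<xi> y * K y)"
      proof (rule field_le_epsilon)
        fix \<eta> :: real assume "\<eta> > 0"
        then show "M * (LBINT y. \<xi> y) \<le> (LBINT y. \<xi> y * K y) + \<eta>" using main[of "\<eta> / \<Theta>"] \<Theta> by simp
      qed
      also have "\<dots> \<le> (LBINT y. \<epsilon> * \<xi> y)"
      proof (rule integral_mono)
        show "integrable lborel (\<lambda>y. \<xi> y * K y)"
          by (rule continuous_support_bounded(1)[of _ R\<xi>]) (use abz(3) in \<open>auto intro!: continuous_intros \<xi>c Kc\<close>)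
        show "integrable lborel (\<lambda>y. \<epsilon> * \<xi> y)" using i\<xi> by simp
        fix y
        show "\<xi> y * K y \<le> \<epsilon> * \<xi> y"
        proof (cases "2 * \<rho> \<le> norm (y - x0)")
          case True
          then show ?thesis using \<xi>z(1) by simp
        next
          case False
          then have "dist y x0 < \<delta>" using \<rho>(2) by (simp add: dist_norm)
          then have "K y \<le> \<epsilon>" using \<delta>(2)[of y] e(2) by (simp add: K_def dist_real_def)
          then show ?thesis using \<xi>01[of y] by (simp add: mult.commute mult_right_mono)
        qed
      qed
      also have "\<dots> = \<epsilon> * (LBINT y. \<xi> y)" by simp
      finally show ?thesis using \<xi>pos by simp
    qed
    then have "M \<le> 0" by (meson dense_ge)
    then show ?thesis by (simp add: M_def d\<tau>_def)
  qed
  then show ?thesis using e(1) unfolding iE_def by blast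
qed

subsection \<open>Flatness\<close>

text \<open>Testing with the unit vector in direction \<open>m\<close> yields equality in the
  Cauchy-Schwarz inequality.\<close>

lemma aligned_if_inner_le:
  fixes m e :: "'a::real_inner"
  assumes e: "norm e = 1" and m: "\<And>u. norm u \<le> 1 \<Longrightarrow> m \<bullet> (u - e) \<le> 0"
  shows "m = norm m *\<^sub>R e"
proof (cases "m = 0")
  case False
  have "m \<bullet> ((1 / norm m) *\<^sub>R m) \<le> m \<bullet> e"
    using m[of "(1 / norm m) *\<^sub>R m"] False by (simp add: inner_diff_right)
  moreover have "m \<bullet> ((1 / norm m) *\<^sub>R m) = norm m"
    using False by (simp add: dot_square_norm power2_eq_square)
  moreover have "m \<bullet> e \<le> norm m" using norm_cauchy_schwarz[of m e] e by simp
  ultimately have "m \<bullet> e = norm m * norm e" using e by simp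
  then have "norm m *\<^sub>R e = norm e *\<^sub>R m" using norm_cauchy_schwarz_eq by blast
  then show ?thesis using e by simp
qed simp

text \<open>Bump functions as \<tau> show that near \<open>x0\<close> the gradients of all fine
  mollifications of \<open>E\<close> are nonpositive multiples of \<open>e\<close>, so these
  mollifications decrease in direction \<open>e\<close>. If \<open>E\<close> missed mass in the
  lower ball and had mass in the upper one, each mollification would be separated there by one level
  and keep a fixed L1 distance from the indicator.\<close>

lemma flat_imp_half_space:
  fixes E :: "'a::euclidean_space set"
  assumes E: "E \<in> sets borel" and s: "s > 0" and e: "norm e = 1"
    and flat: "\<And>(\<tau> :: 'a \<Rightarrow> real) u. C1 \<tau> \<Longrightarrow> (\<And>x. 0 \<le> \<tau> x \<and> \<tau> x \<le> 1) \<Longrightarrow> (\<And>x. s < norm (x - x0) \<Longrightarrow> \<tau> x = 0) \<Longrightarrow> norm u \<le> 1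
      \<Longrightarrow> (LBINT z. indicator E z * frechet_derivative \<tau> (at z) (u - e)) \<le> 0"
    and balls: "ball y \<rho> \<subseteq> ball x0 (s / 2)" "ball y' \<rho> \<subseteq> ball x0 (s / 2)" "\<rho> > 0"
    and below: "\<And>z z'. z \<in> ball y \<rho> \<Longrightarrow> z' \<in> ball y' \<rho> \<Longrightarrow> z \<bullet> e \<le> z' \<bullet> e"
  shows "ball y \<rho> - E \<in> null_sets lborel \<or> ball y' \<rho> \<inter> E \<in> null_sets lborel"
proof (rule ccontr)
  assume n: "\<not> ?thesis"
  have [measurable]: "E \<in> sets borel" by fact
  define iE where "iE = (indicator E :: 'a \<Rightarrow> real)"
  have [measurable]: "iE \<in> borel_measurable borel" unfolding iE_def by measurable
  have iEm: "iE \<in> borel_measurable lborel" by measurable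
  have iE1: "norm (iE z) \<le> 1" for z by (auto simp: iE_def indicator_def)
  have mono: "conv (bump t) iE z' \<le> conv (bump t) iE z"
    if t: "0 < t" "t < s / 4" and z: "z \<in> ball x0 (s / 2)" "z' \<in> ball x0 (s / 2)" "z \<bullet> e \<le> z' \<bullet> e" for t z z'
  proof -
    let ?g = "conv (bump t) iE"
    have gC: "C1 ?g" by (rule C1_conv[OF kernel_bump iEm iE1])
    have D: "frechet_derivative ?g (at q) (z' - z) \<le> 0" if q: "q \<in> ball x0 (s / 2)" for q
    proof -
      define m where "m = (LBINT x. iE x *\<^sub>R bump_grad t (x - q))"
      have mi: "integrable lborel (\<lambda>x. iE x *\<^sub>R bump_grad t (x - q))"
      proof -
        obtain B where B: "\<And>z. \<bar>norm (bump_grad t (z::'a))\<bar> \<le> B"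
          by (rule compactly_supported_bounded[of "\<lambda>z::'a. norm (bump_grad t z)" "2*t"])
             (use bump_continuous(2)[of t] bump_props(5)[OF t(1)] in \<open>auto intro!: continuous_intros\<close>)
        show ?thesis
        proof (rule integrable_bounded_support[of _ "1 * B" q "2 * t"])
          show "norm (iE x *\<^sub>R bump_grad t (x - q)) \<le> 1 * B" for x
            using B[of "x - q"] iE1[of x] unfolding norm_scaleR by (intro mult_mono) auto
          show "iE x *\<^sub>R bump_grad t (x - q) = 0" if "x \<notin> cball q (2 * t)" for x
            using that bump_props(5)[OF t(1), of "x - q"] by (auto simp: dist_norm norm_minus_commute)
        qed measurable
      qed
      have mh: "(LBINT x. iE x * (bump_grad t (x - q) \<bullet> h)) = m \<bullet> h" for h
        unfolding m_def using integral_inner_left[OF mi, of h] by simp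
      \<comment> \<open>The bump centred at \<open>q\<close> has support radius
        \<open>2 * t < s / 2\<close>, so it stays in the ball of radius \<open>s\<close> where
        \<open>flat\<close> applies.\<close>
      have "m = norm m *\<^sub>R e"
      proof (rule aligned_if_inner_le[OF e])
        fix u :: 'a assume u: "norm u \<le> 1"
        have "(LBINT x. indicator E x * frechet_derivative (\<lambda>x. bump t (x - q)) (at x) (u - e)) \<le> 0"
        proof (rule flat[OF frechet_derivative_bump(2) _ _ u])
          show "0 \<le> bump t (x - q) \<and> bump t (x - q) \<le> 1" for x by (simp add: bump_props[OF t(1)])
          show "bump t (x - q) = 0" if "s < norm (x - x0)" for x
          proof (rule bump_props(4)[OF t(1)])
            have "norm (x - x0) \<le> norm (x - q) + norm (q - x0)" using norm_triangle_ineq[of "x - q" "q - x0"] by simp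
            moreover have "norm (q - x0) < s / 2" using q by (simp add: dist_norm norm_minus_commute)
            ultimately show "2 * t \<le> norm (x - q)" using that t(2) by linarith
          qed
        qed
        then show "m \<bullet> (u - e) \<le> 0" unfolding frechet_derivative_bump(1) mh[symmetric] iE_def .
      qed
      moreover have "frechet_derivative ?g (at q) (z' - z) = - (m \<bullet> (z' - z))"
      proof -
        have "frechet_derivative ?g (at q) (z' - z) = (LBINT x. - (iE x * (bump_grad t (x - q) \<bullet> (z' - z))))"
          unfolding frechet_derivative_conv[OF kernel_bump iEm iE1] conv_def
        proof (intro Bochner_Integration.integral_cong refl)
          show "(bump_grad t (q - x) \<bullet> (z' - z)) *\<^sub>R iE x = - (iE x * (bump_grad t (x - q) \<bullet> (z' - z)))" for x
            using bump_commute(2)[of t q x] by simp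
        qed
        then show ?thesis using mh by simp
      qed
      ultimately have "frechet_derivative ?g (at q) (z' - z) = - (norm m * (e \<bullet> (z' - z)))" by (metis inner_scaleR_left)
      moreover have "0 \<le> norm m * (e \<bullet> (z' - z))" using z(3) by (simp add: inner_diff_right inner_commute)
      ultimately show ?thesis by simp
    qed
    have "?g (z + 1 *\<^sub>R (z' - z)) \<le> ?g (z + 0 *\<^sub>R (z' - z))"
    proof (rule DERIV_nonpos_imp_nonincreasing[of 0 1 "\<lambda>k. ?g (z + k *\<^sub>R (z' - z))"])
      fix k :: real assume k: "0 \<le> k" "k \<le> 1"
      have "((\<lambda>k. ?g (z + k *\<^sub>R (z' - z))) has_derivative (\<lambda>h. frechet_derivative ?g (at (z + k *\<^sub>R (z' - z))) (h *\<^sub>R (z' - z)))) (at k)"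
        by (rule has_derivative_compose[of "\<lambda>k. z + k *\<^sub>R (z' - z)" "\<lambda>h. h *\<^sub>R (z' - z)" k UNIV ?g])
           (auto intro!: derivative_eq_intros C1_has_derivative[OF gC])
      moreover have "linear (frechet_derivative ?g (at (z + k *\<^sub>R (z' - z))))"
        using C1_has_derivative[OF gC] has_derivative_linear by blast
      ultimately have "((\<lambda>k. ?g (z + k *\<^sub>R (z' - z))) has_real_derivative frechet_derivative ?g (at (z + k *\<^sub>R (z' - z))) (z' - z)) (at k)"
        unfolding has_field_derivative_def by (simp add: linear_cmul mult_commute_abs)
      moreover have "z + k *\<^sub>R (z' - z) \<in> ball x0 (s / 2)"
      proof -
        have "(1 - k) *\<^sub>R z + k *\<^sub>R z' \<in> ball x0 (s / 2)"
          using convex_ball z(1,2) k by (intro convexD) auto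
        then show ?thesis by (simp add: algebra_simps)
      qed
      ultimately show "\<exists>y. ((\<lambda>k. ?g (z + k *\<^sub>R (z' - z))) has_real_derivative y) (at k) \<and> y \<le> 0" using D by blast
    qed simp
    then show ?thesis by simp
  qed
  define Z where "Z = ball y \<rho> - E"
  define Z' where "Z' = ball y' \<rho> \<inter> E"
  have [measurable]: "Z \<in> sets borel" "Z' \<in> sets borel" unfolding Z_def Z'_def by auto
  have fin: "emeasure lborel Z < \<infinity>" "emeasure lborel Z' < \<infinity>"
    using emeasure_bounded_finite[OF bounded_subset[OF bounded_ball, of Z y \<rho>]]
      emeasure_bounded_finite[OF bounded_subset[OF bounded_ball, of Z' y' \<rho>]]
    by (auto simp: Z_def Z'_def)
  have pos: "0 < measure lborel Z" "0 < measure lborel Z'"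
    using n fin unfolding Z_def[symmetric] Z'_def[symmetric]
    by (auto simp: null_sets_def zero_less_measure_iff measure_eq_emeasure_eq_ennreal emeasure_eq_ennreal_measure less_top[symmetric])
  define \<mu> where "\<mu> = min (measure lborel Z) (measure lborel Z')"
  have \<mu>: "\<mu> > 0" using pos by (simp add: \<mu>_def)
  \<comment> \<open>Truncation gives the bounded support that \<open>conv_moll_close\<close>
    requires; mollifications at points of the half-size ball do not notice it.\<close>
  define f where "f x = iE x * indicator (ball x0 s) x" for x
  have [measurable]: "ball x0 s \<in> sets borel" by simp
  have [measurable]: "f \<in> borel_measurable borel" unfolding f_def by measurable
  have fm: "f \<in> borel_measurable lborel" by measurable
  have f1: "\<bar>f x\<bar> \<le> 1" "0 \<le> f x" for x by (auto simp: f_def iE_def indicator_def)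
  have fz: "f x = 0" if "norm x0 + s < norm x" for x
  proof -
    have "norm x \<le> norm x0 + norm (x - x0)" using norm_triangle_ineq[of x0 "x - x0"] by simp
    then show ?thesis using that by (auto simp: f_def indicator_def dist_norm norm_minus_commute)
  qed
  obtain \<delta> where \<delta>: "\<delta> > 0" "\<And>t. 0 < t \<Longrightarrow> t < \<delta> \<Longrightarrow> (LBINT x. \<bar>conv (moll t) f x - f x\<bar>) \<le> \<mu> / 2
       \<and> integrable lborel (\<lambda>x. conv (moll t) f x - f x)"
    using conv_moll_close[of f 1 "norm x0 + s" "\<mu> / 2"] fm f1(1) fz \<mu> by (metis half_gt_zero)
  define t where "t = min (\<delta> / 2) (s / 8)"
  have t: "0 < t" "t < \<delta>" "t < s / 4" using \<delta>(1) s by (auto simp: t_def)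
  let ?h = "conv (moll t) f"
  have hg: "?h z = conv (bump t) iE z / bump_mass TYPE('a) t" if z: "z \<in> ball x0 (s / 2)" for z
  proof -
    have "?h z = conv (moll t) iE z"
    proof (rule conv_cong)
      fix x assume "moll t (z - x) \<noteq> 0"
      then have "norm (z - x) < 2 * t" using moll_props(2)[OF t(1), of "z - x"] by force
      then have "dist x0 x < s" using dist_triangle[of x0 x z] z t(3) by (simp add: dist_norm)
      then show "f x = iE x" by (simp add: f_def)
    qed
    then show ?thesis by (simp add: conv_def moll_eq)
  qed
  have hmono: "?h z' \<le> ?h z" if "z \<in> ball y \<rho>" "z' \<in> ball y' \<rho>" for z z'
  proof -
    have "z \<in> ball x0 (s / 2)" "z' \<in> ball x0 (s / 2)" using that balls by auto
    then show ?thesis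
      unfolding hg[OF \<open>z \<in> ball x0 (s / 2)\<close>] hg[OF \<open>z' \<in> ball x0 (s / 2)\<close>]
      using mono[OF t(1,3)] below[OF that] bump_mass_pos[where 'a='a, OF t(1)] by (simp add: divide_right_mono)
  qed
  have h01: "0 \<le> ?h z" "?h z \<le> 1" for z
  proof -
    show "0 \<le> ?h z" unfolding conv_def
      by (intro integral_nonneg_AE AE_I2) (auto simp: moll_props(1)[OF t(1)] f1)
    show "?h z \<le> 1" using conv_moll_norm_le[OF t(1) fm, of 1 z] f1(1) by simp
  qed
  \<comment> \<open>By monotonicity the level \<open>c\<close> separates the mollification: at most
    \<open>c\<close> on the upper ball, at least \<open>c\<close> on the lower one.\<close>
  define c where "c = (SUP z\<in>ball y' \<rho>. ?h z)"
  have bdd: "bdd_above (?h ` ball y' \<rho>)" using h01 by (auto simp: bdd_above_def)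
  have cu: "?h z \<le> c" if "z \<in> ball y' \<rho>" for z unfolding c_def by (rule cSUP_upper[OF that bdd])
  have ne: "ball y' \<rho> \<noteq> {}" using balls by simp
  have cl: "c \<le> ?h z" if "z \<in> ball y \<rho>" for z unfolding c_def by (rule cSUP_least[OF ne hmono[OF that]])
  have c01: "0 \<le> c" "c \<le> 1" using cu[of y'] cl[of y] h01[of y] h01[of y'] balls by auto
  have Zi: "integrable lborel (\<lambda>x. indicator Z x * c + indicator Z' x * (1 - c))"
    using fin by (intro Bochner_Integration.integrable_add integrable_mult_left) (auto intro!: integrable_real_indicator)
  \<comment> \<open>On \<open>Z\<close> the indicator is 0 and the error at least \<open>c\<close>;
    on \<open>Z'\<close> it is 1 and the error at least \<open>1 - c\<close>. Together the error is
    at least \<mu>, whatever \<open>c\<close> is, although it was chosen below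
    \<open>\<mu> / 2\<close>.\<close>
  have "\<mu> = \<mu> * c + \<mu> * (1 - c)" by (simp add: algebra_simps)
  also have "\<dots> \<le> measure lborel Z * c + measure lborel Z' * (1 - c)"
    using c01 by (intro add_mono mult_right_mono) (auto simp: \<mu>_def)
  also have "\<dots> = (LBINT x. indicator Z x * c + indicator Z' x * (1 - c))"
  proof -
    have "integrable lborel (\<lambda>x. indicator Z x * c)" "integrable lborel (\<lambda>x. indicator Z' x * (1 - c))"
      using fin by (auto intro!: integrable_mult_left integrable_real_indicator)
    then show ?thesis by simp
  qed
  also have "\<dots> \<le> (LBINT x. \<bar>?h x - f x\<bar>)"
  proof (rule integral_mono[OF Zi])
    show "integrable lborel (\<lambda>x. \<bar>?h x - f x\<bar>)" using \<delta>(2)[OF t(1,2)] by auto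
    fix x
    show "indicator Z x * c + indicator Z' x * (1 - c) \<le> \<bar>?h x - f x\<bar>"
    proof -
      consider "x \<in> Z" "x \<notin> Z'" | "x \<in> Z'" "x \<notin> Z" | "x \<notin> Z" "x \<notin> Z'" unfolding Z_def Z'_def by blast
      then show ?thesis
      proof cases
        case 1
        then have "f x = 0" "c \<le> ?h x" using cl by (auto simp: Z_def f_def iE_def)
        then show ?thesis using 1 by simp
      next
        case 2
        then have "x \<in> ball x0 (s / 2)" using balls(2) by (auto simp: Z'_def)
        then have "x \<in> ball x0 s" using s by simp
        then have "f x = 1" "?h x \<le> c" using 2 cu by (auto simp: Z'_def f_def iE_def)
        then show ?thesis using 2 by simp
      qed simp
    qed
  qed
  also have "\<dots> \<le> \<mu> / 2" using \<delta>(2)[OF t(1,2)] by simp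
  finally show False using \<mu> by simp
qed

text \<open>A ball filled up to a null set would lie in \<open>E\<close> by normalization, and
  dually an almost empty one would miss it. So \<open>E\<close> and its complement both have
  positive measure near each boundary point, which decides the alternative left open by
  \<open>flat_imp_half_space\<close>.\<close>

lemma frontier_normalized:
  fixes E :: "'a::euclidean_space set"
  assumes E: "E \<in> sets lebesgue" "normalized E" and x: "x \<in> frontier E" and r: "r > 0"
  shows "ball x r - E \<notin> null_sets lebesgue" "ball x r \<inter> E \<notin> null_sets lebesgue"
proof -
  have sub: "\<exists>s>0. ball z s \<subseteq> ball x r" if "z \<in> ball x r" for z
    using that open_contains_ball[of "ball x r"] by auto
  show "ball x r - E \<notin> null_sets lebesgue"
  proof
    assume n: "ball x r - E \<in> null_sets lebesgue"
    have "ball x r \<subseteq> E"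
    proof
      fix z assume "z \<in> ball x r"
      then obtain s where s: "s > 0" "ball z s \<subseteq> ball x r" using sub by blast
      then have "ball z s - E \<in> null_sets lebesgue" by (intro null_sets_subset[OF n]) (use E in auto)
      then show "z \<in> E" using normalized_ball(1)[OF E s(1)] by blast
    qed
    then show False using x r by (auto simp: frontier_def mem_interior)
  qed
  show "ball x r \<inter> E \<notin> null_sets lebesgue"
  proof
    assume n: "ball x r \<inter> E \<in> null_sets lebesgue"
    have "ball x r \<inter> E = {}"
    proof (rule ccontr)
      assume "ball x r \<inter> E \<noteq> {}"
      then obtain z where z: "z \<in> ball x r" "z \<in> E" by blast
      then obtain s where s: "s > 0" "ball z s \<subseteq> ball x r" using sub by blast
      then have "ball z s \<inter> E \<in> null_sets lebesgue" by (intro null_sets_subset[OF n]) (use E in auto)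
      then show False using normalized_ball(2)[OF E s(1)] z by blast
    qed
    then have "x \<notin> closure E" using centre_in_ball[of x r] r open_Int_closure_eq_empty[of "ball x r" E] by blast
    then show False using x by (simp add: frontier_def)
  qed
qed

subsection \<open>The contact set\<close>

text \<open>A point of the closures of both \<open>E\<close> and \<open>- F\<close> lies on both
  boundaries because \<open>E \<subseteq> F\<close>, hence in \<open>K\<close>. In the compact shell
  between distances \<open>d\<close> and \<open>3 * d\<close> from \<open>K\<close> these closures
  are disjoint, so they have a positive distance there that a small translation of \<open>E\<close>
  cannot bridge.\<close>

lemma contact_separation:
  fixes E F U :: "'a::euclidean_space set"
  assumes U: "open U" and EF: "E \<subseteq> F" and cc: "compactly_contained (frontier E \<inter> frontier F) U"
    and ne: "frontier E \<inter> frontier F \<noteq> {}"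
  defines "K \<equiv> frontier E \<inter> frontier F"
  obtains d r where "d > 0" "r > 0" "2 * r \<le> d" "{x. infdist x K < 4 * d} \<subseteq> U" "compact K"
    "\<And>x v. norm v < 2 * r \<Longrightarrow> x - v \<in> E \<Longrightarrow> x \<notin> F \<Longrightarrow> infdist x K < 3 * d \<Longrightarrow> infdist x K < d"
proof -
  have Kc: "closed K" by (auto simp: K_def intro: closed_Int)
  then have K: "compact K" "K \<subseteq> U" using cc U by (auto simp: compactly_contained_def K_def closure_closed interior_open)
  obtain e0 where e0: "e0 > 0" "(\<Union>x\<in>K. cball x e0) \<subseteq> U"
    using compact_subset_open_imp_cball_epsilon_subset[OF K(1) U K(2)] by blast
  \<comment> \<open>Four layers are needed inside \<open>U\<close>: translates leave
    \<open>F\<close> only below distance \<open>d\<close>, pieces are cut out below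
    \<open>2 * d\<close>, fields live below \<open>3 * d\<close>, and the translated window stays
    below \<open>4 * d\<close>.\<close>
  define d where "d = e0 / 4"
  have d: "d > 0" using e0 by (simp add: d_def)
  have att: "\<exists>k\<in>K. dist x k = infdist x K" for x
    using infdist_attains_inf[OF Kc, of x] ne by (metis K_def)
  define S where "S = {x. d \<le> infdist x K \<and> infdist x K \<le> 3 * d}"
  have "closed S" unfolding S_def by (intro closed_Collect_conj closed_Collect_le continuous_intros)
  moreover have "bounded S"
  proof -
    obtain B where B: "\<And>k. k \<in> K \<Longrightarrow> norm k \<le> B" using compact_imp_bounded[OF K(1)] by (auto simp: bounded_iff)
    have "norm x \<le> B + 3 * d" if x: "x \<in> S" for x
    proof -
      obtain k where k: "k \<in> K" "dist x k = infdist x K" using att by blast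
      have "norm x \<le> norm k + dist x k" using norm_triangle_ineq[of k "x - k"] by (simp add: dist_norm)
      then show ?thesis using B[OF k(1)] k(2) x by (simp add: S_def)
    qed
    then show ?thesis by (auto simp: bounded_iff)
  qed
  ultimately have "compact (S \<inter> closure (- F))" by (simp add: closed_Int bounded_Int compact_eq_bounded_closed)
  moreover have "(S \<inter> closure (- F)) \<inter> closure E = {}"
  proof -
    have False if x: "x \<in> S" "x \<in> closure (- F)" "x \<in> closure E" for x
    proof -
      have "x \<notin> interior F" using x(2) by (simp add: closure_complement)
      moreover have "x \<notin> interior E" using \<open>x \<notin> interior F\<close> interior_mono[OF EF] by blast
      ultimately have "x \<in> K" using x(3) closure_mono[OF EF] by (auto simp: K_def frontier_def)
      then show False using x(1) d by (simp add: S_def)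
    qed
    then show ?thesis by blast
  qed
  ultimately obtain \<delta> where \<delta>: "\<delta> > 0" "\<And>x y. x \<in> S \<inter> closure (- F) \<Longrightarrow> y \<in> closure E \<Longrightarrow> \<delta> \<le> dist x y"
    using separate_compact_closed[of "S \<inter> closure (- F)" "closure E"] by (metis closed_closure)
  show thesis
  proof (rule that[of d "min \<delta> d / 2"])
    show "{x. infdist x K < 4 * d} \<subseteq> U"
    proof
      fix x assume x: "x \<in> {x. infdist x K < 4 * d}"
      obtain k where "k \<in> K" "dist x k = infdist x K" using att by blast
      then have "x \<in> cball k e0" using x by (simp add: d_def dist_commute)
      then show "x \<in> U" using e0(2) \<open>k \<in> K\<close> by blast
    qed
    fix x v assume v: "norm v < 2 * (min \<delta> d / 2)" "x - v \<in> E" "x \<notin> F" "infdist x K < 3 * d"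
    show "infdist x K < d"
    proof (rule ccontr)
      assume "\<not> infdist x K < d"
      then have "x \<in> S \<inter> closure (- F)" using v subsetD[OF closure_subset, of x "- F"] by (simp add: S_def)
      then have "\<delta> \<le> dist x (x - v)" using v(2) \<delta>(2) closure_subset by blast
      then show False using v(1) by (simp add: dist_norm)
    qed
  qed (use d \<delta>(1) K in auto)
qed

lemma translate_borel_AE:
  fixes E F :: "'a::euclidean_space set"
  assumes "E \<in> sets lebesgue" "F \<in> sets lebesgue" "E' \<in> sets borel" "F' \<in> sets borel"
    "AE x in lebesgue. x \<in> E \<longleftrightarrow> x \<in> E'" "AE x in lebesgue. x \<in> F \<longleftrightarrow> x \<in> F'"
  shows "perimeter (F \<union> {x. x - v \<in> E}) W = perimeter (F' \<union> {x. x - v \<in> E'}) W"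
proof (rule perimeter_cong_AE)
  have "E' \<in> sets lebesgue" "F' \<in> sets lebesgue" using assms by auto
  then show "F \<union> {x. x - v \<in> E} \<in> sets lebesgue" "F' \<union> {x. x - v \<in> E'} \<in> sets lebesgue"
    using lebesgue_translate[of E "- v"] lebesgue_translate[of E' "- v"] assms by auto
  have "AE x in lebesgue. x - v \<in> E \<longleftrightarrow> x - v \<in> E'" using AE_lebesgue_translate[OF assms(5), of "- v"] by simp
  then show "AE x in lebesgue. x \<in> W \<longrightarrow> (x \<in> F \<union> {x. x - v \<in> E}) = (x \<in> F' \<union> {x. x - v \<in> E'})"
    using assms(6) by eventually_elim auto
qed

text \<open>Subminimality of \<open>E\<close>, applied to its translates, bounds the variation of
  each union by \<open>p\<close>; superminimality of \<open>F\<close> bounds the superlevel sets of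
  the average from below, and coarea carries this to the average. These are the inputs of
  \<open>averaged_translates_flat\<close>, whose base point is taken so close to \<open>x1\<close>
  that the flat region contains a ball around \<open>x1\<close>.\<close>

lemma contact_half_space:
  fixes U E F :: "'a::euclidean_space set"
  assumes U: "open U" and adm: "admissible E" "admissible F"
    and sub: "sub_area_minimizing E U" and super: "super_area_minimizing F U"
    and EF: "E \<subseteq> F" and cc: "compactly_contained (frontier E \<inter> frontier F) U"
    and x1: "x1 \<in> frontier E \<inter> frontier F" "x1 \<in> closure (interior (- F))"
  shows "\<exists>\<rho>>0. \<exists>e. norm e = 1 \<and> (\<forall>y\<in>ball x1 \<rho>. ((y - x1) \<bullet> e < 0 \<longrightarrow> y \<in> E) \<and> ((y - x1) \<bullet> e > 0 \<longrightarrow> y \<notin> E))"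
proof -
  define K where "K = frontier E \<inter> frontier F"
  have "frontier E \<inter> frontier F \<noteq> {}" using x1 by blast
  from contact_separation[OF U EF cc this, folded K_def]
  obtain d r where dr: "d > 0" "r > 0" "2 * r \<le> d" "{x. infdist x K < 4 * d} \<subseteq> U" "compact K"
    and gap: "\<And>x v. norm v < 2 * r \<Longrightarrow> x - v \<in> E \<Longrightarrow> x \<notin> F \<Longrightarrow> infdist x K < 3 * d \<Longrightarrow> infdist x K < d"
    by blast
  have Kne: "K \<noteq> {}" using x1 by (auto simp: K_def)
  define W where "W = {x. infdist x K < 3 * d}"
  have W: "open W" unfolding W_def by (intro open_Collect_less continuous_intros)
  have bdd: "bounded {x. infdist x K \<le> 3 * d}"
  proof -
    obtain B where B: "\<And>k. k \<in> K \<Longrightarrow> norm k \<le> B" using compact_imp_bounded[OF dr(5)] by (auto simp: bounded_iff)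
    have "norm x \<le> B + 3 * d" if x: "infdist x K \<le> 3 * d" for x
    proof -
      obtain k where k: "k \<in> K" "dist x k = infdist x K"
        using infdist_attains_inf[OF compact_imp_closed[OF dr(5)] Kne, of x] by metis
      have "norm x \<le> norm k + dist x k" using norm_triangle_ineq[of k "x - k"] by (simp add: dist_norm)
      then show ?thesis using B[OF k(1)] k(2) x by simp
    qed
    then show ?thesis by (auto simp: bounded_iff)
  qed
  have Wb: "bounded W" by (rule bounded_subset[OF bdd]) (auto simp: W_def)
  have WU: "W \<subseteq> U" using dr by (auto simp: W_def)
  have Cc: "compact {x. infdist x K \<le> d}"
    unfolding compact_eq_bounded_closed
    by (intro conjI bounded_subset[OF bdd] closed_Collect_le continuous_intros) (use dr in auto)
  have CW: "{x. infdist x K \<le> d} \<subseteq> W" using dr by (auto simp: W_def)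
  have L: "E \<in> sets lebesgue" "F \<in> sets lebesgue" using adm admissible_lebesgue by auto
  have fin: "perimeter E V < \<infinity>" "perimeter F V < \<infinity>" if "open V" "bounded V" for V
    using adm that by (auto simp: admissible_def locally_finite_perimeter_def)
  obtain p where p: "perimeter F W = ereal p"
    using fin(2)[OF W Wb] perimeter_nonneg[of F W] by (cases "perimeter F W") auto
  obtain E' where E': "E' \<in> sets borel" "E' \<subseteq> E" "E - E' \<in> null_sets lebesgue" "AE x in lebesgue. x \<in> E \<longleftrightarrow> x \<in> E'"
    using lebesgue_borel_AE[OF L(1)] by metis
  obtain F' where F': "F' \<in> sets borel" "F' \<subseteq> F" "AE x in lebesgue. x \<in> F \<longleftrightarrow> x \<in> F'"
    using lebesgue_borel_AE[OF L(2)] by metis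
  have [measurable]: "E' \<in> sets borel" "F' \<in> sets borel" "W \<in> sets borel" using E' F' W by auto
  \<comment> \<open>A neighbourhood strictly between the region where translates leave
    \<open>F\<close> and the window \<open>W\<close>. Modifications are confined to it because, far
    from \<open>K\<close>, the translate may leave \<open>F\<close> elsewhere.\<close>
  define B where "B = {x. infdist x K < 2 * d}"
  have B: "open B" unfolding B_def by (intro open_Collect_less continuous_intros)
  have BL: "B \<in> sets lebesgue" using B by auto

  have union: "perimeter (F \<union> {x. x - v \<in> E}) W \<le> perimeter F W" if v: "norm v < 2 * r" for v
  proof -
    define Ev where "Ev = {x. x - v \<in> E}"
    define Wv where "Wv = {x. x + v \<in> W}"
    have EvL: "Ev \<in> sets lebesgue" using lebesgue_translate[OF L(1), of "- v"] by (simp add: Ev_def)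
    \<comment> \<open>Minimality is known for \<open>E\<close> and not for its translate, so the
      competitor is built from the translate and moved back by \<open>v\<close>, and the comparison
      takes place on the shifted window \<open>Wv\<close>.\<close>
    define G' where "G' = Ev - (B - F)"
    define G where "G = {x. x + v \<in> G'}"
    have G'L: "G' \<in> sets lebesgue" unfolding G'_def using EvL BL L by auto
    have Wv: "open Wv" "bounded Wv" "Wv \<subseteq> U"
    proof -
      have e: "Wv = (+) (- v) ` W" unfolding Wv_def by (force simp: image_iff)
      show "open Wv" "bounded Wv" unfolding e using open_translation[OF W, of "- v"] bounded_translation[OF Wb, of "- v"] by simp_all
      show "Wv \<subseteq> U"
      proof
        fix x assume "x \<in> Wv"
        then have "infdist (x + v) K < 3 * d" by (simp add: Wv_def W_def)
        moreover have "infdist x K \<le> infdist (x + v) K + dist x (x + v)" by (rule infdist_triangle)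
        ultimately have "infdist x K < 4 * d" using v dr(3) by (simp add: dist_norm)
        then show "x \<in> U" using dr(4) by blast
      qed
    qed
    have "E - G \<subseteq> {x. infdist (x + v) K \<le> d}"
    proof
      fix x assume x: "x \<in> E - G"
      then have "x + v \<in> B - F" by (auto simp: G_def G'_def Ev_def)
      then have "infdist (x + v) K < d" using gap[OF v, of "x + v"] x dr(1) by (auto simp: B_def)
      then show "x \<in> {x. infdist (x + v) K \<le> d}" by simp
    qed
    moreover have e: "{x. infdist (x + v) K \<le> d} = (+) (- v) ` {x. infdist x K \<le> d}" by (force simp: image_iff)
    moreover have cD: "compact {x. infdist (x + v) K \<le> d}" unfolding e by (rule compact_translation[OF Cc])
    ultimately have cl: "closure (E - G) \<subseteq> {x. infdist (x + v) K \<le> d}"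
      by (intro closure_minimal) (auto intro: compact_imp_closed)
    then have cpt: "compact (closure (E - G))" using cD
      by (meson bounded_subset closed_closure compact_eq_bounded_closed)
    have "perimeter E Wv \<le> perimeter G Wv"
    proof (rule sub_area_minimizing_compare[OF sub adm(1) _ _ Wv cpt])
      show "G \<in> sets lebesgue" unfolding G_def by (rule lebesgue_translate[OF G'L])
      show "G \<subseteq> E" by (auto simp: G_def G'_def Ev_def)
      show "closure (E - G) \<subseteq> Wv" using cl CW by (auto simp: Wv_def)
    qed
    moreover have "perimeter E Wv = perimeter Ev W"
      using perimeter_translate[OF EvL, of v W] by (simp add: Ev_def Wv_def)
    moreover have "perimeter G Wv = perimeter G' W"
      unfolding G_def Wv_def by (rule perimeter_translate[OF G'L])
    \<comment> \<open>Inside \<open>W\<close>, every point of the translate outside \<open>F\<close>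
      lies in \<open>B\<close> by \<open>gap\<close>, so cutting there removes all of it.\<close>
    moreover have "perimeter G' W = perimeter (Ev \<inter> F) W"
    proof (rule perimeter_cong_AE[OF G'L])
      show "AE x in lebesgue. x \<in> W \<longrightarrow> (x \<in> G') = (x \<in> Ev \<inter> F)"
      proof (intro AE_I2 impI)
        fix x assume "x \<in> W"
        then have "x \<in> B" if "x \<in> Ev" "x \<notin> F"
          using gap[OF v, of x] that dr(1) by (simp add: Ev_def B_def W_def)
        then show "(x \<in> G') = (x \<in> Ev \<inter> F)" by (auto simp: G'_def)
      qed
    qed (use EvL L in auto)
    ultimately have "perimeter Ev W \<le> perimeter (Ev \<inter> F) W" "perimeter Ev W < \<infinity>"
      using fin(1)[OF Wv(1,2)] by auto
    then have "perimeter (Ev \<union> F) W \<le> perimeter F W"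
      by (intro perimeter_union_le[OF W Wb EvL L(2)] fin(2)[OF W Wb])
    then show ?thesis by (simp add: Ev_def Un_commute)
  qed

  have p1: "var_le (indicator (F' \<union> {x. x - v \<in> E'})) W p" if v: "norm v < 2 * r" for v
  proof -
    have [measurable]: "{x. x - v \<in> E'} \<in> sets borel" by measurable
    have "perimeter (F' \<union> {x. x - v \<in> E'}) W \<le> ereal p"
      using union[OF v] unfolding p translate_borel_AE[OF L E'(1) F'(1) E'(4) F'(3)] .
    then show ?thesis by (subst (asm) perimeter_le_iff) auto
  qed

  define f where "f x = conv (bump r) (indicator E') x / bump_mass TYPE('a) r" for x
  have iE: "indicator E' \<in> borel_measurable lborel" "\<And>z. norm (indicator E' z :: real) \<le> 1" by (auto simp: indicator_def)
  have bm: "bump_mass TYPE('a) r > 0" by (rule bump_mass_pos[OF dr(2)])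
  have [measurable]: "f \<in> borel_measurable borel"
    unfolding f_def using C1_continuous[OF C1_conv[OF kernel_bump iE]]
    by (intro borel_measurable_divide borel_measurable_continuous_onI) auto
  have f01: "0 \<le> f x" "f x \<le> 1" for x
  proof -
    show "0 \<le> f x" unfolding f_def conv_def using bm
      by (intro divide_nonneg_pos integral_nonneg_AE AE_I2) (auto simp: bump_props[OF dr(2)])
    have "f x = conv (moll r) (indicator E') x" by (simp add: f_def conv_def moll_eq)
    then show "f x \<le> 1" using conv_moll_norm_le[OF dr(2) iE, of x] by simp
  qed
  \<comment> \<open>A positive average at \<open>x\<close> means that some admissible translate of
    \<open>E\<close> reaches \<open>x\<close>; outside \<open>F\<close> this happens only near
    \<open>K\<close>.\<close>
  have fpos: "infdist x K < d" if x: "x \<notin> F" "x \<in> W" "0 < f x" for x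
  proof -
    have "conv (bump r) (indicator E') x \<noteq> (0::real)" using x(3) by (auto simp: f_def)
    then obtain z where z: "bump r (x - z) \<noteq> 0" "indicator E' z \<noteq> (0::real)"
      using conv_zero[of "bump r" x "indicator E' :: 'a \<Rightarrow> real"] by blast
    have "norm (x - z) < 2 * r" using bump_props(4)[OF dr(2), of "x - z"] z(1) by force
    moreover have "z \<in> E" using z(2) E'(2) by (auto simp: indicator_def split: if_splits)
    ultimately show ?thesis using gap[of "x - z" x] x by (simp add: W_def)
  qed
  have p2: "p \<le> c" if c: "var_le (\<lambda>x. max (indicator F' x) (f x)) W c" for c
  proof -
    \<comment> \<open>Restriction to \<open>W\<close> provides bounded support for
      \<open>coarea_inequality\<close> and is invisible to fields supported in
      \<open>W\<close>.\<close>
    define w where "w x = indicator W x * max (indicator F' x) (f x)" for x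
    have [measurable]: "w \<in> borel_measurable borel" unfolding w_def by measurable
    have wm: "w \<in> borel_measurable lborel" by measurable
    have w01: "0 \<le> w x" "w x \<le> 1" for x using f01[of x] by (auto simp: w_def indicator_def)
    obtain R where R: "\<And>x. x \<in> W \<Longrightarrow> norm x \<le> R" using Wb by (auto simp: bounded_iff)
    have wz: "w x = 0" if "R < norm x" for x using R[of x] that by (auto simp: w_def indicator_def)
    have wc: "var_le w W c" unfolding var_le_def
    proof
      fix \<phi> assume \<phi>: "\<phi> \<in> test_fields W"
      then have "divergence \<phi> x = 0" if "x \<notin> W" for x using test_fieldsE[OF \<phi>] that by metis
      then have "(LBINT x. w x * divergence \<phi> x) = (LBINT x. max (indicator F' x) (f x) * divergence \<phi> x)"
        by (intro Bochner_Integration.integral_cong) (auto simp: w_def indicator_def)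
      then show "(LBINT x. w x * divergence \<phi> x) \<le> c" using c \<phi> by (simp add: var_le_def)
    qed
    have lev: "ereal p \<le> perimeter {x. s < w x} W" if s: "0 \<le> s" "s < 1" for s
    proof -
      \<comment> \<open>In \<open>W\<close> this is the superlevel set of \<open>w\<close> up to a
        null set, but it agrees with \<open>F\<close> away from \<open>K\<close> on the whole space
        and is therefore a legitimate competitor for \<open>F\<close>.\<close>
      define G where "G = F \<union> {x\<in>B. s < f x}"
      have "{x\<in>B. s < f x} \<in> sets borel" using B by measurable
      then have GL: "G \<in> sets lebesgue" unfolding G_def using L by auto
      have BW: "B \<subseteq> W" using dr(1) by (auto simp: B_def W_def)
      have "G - F \<subseteq> {x. infdist x K \<le> d}" using fpos s BW by (force simp: G_def)
      then have cl: "closure (G - F) \<subseteq> {x. infdist x K \<le> d}"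
        by (intro closure_minimal compact_imp_closed[OF Cc])
      then have cpt: "compact (closure (G - F))" using Cc
        by (meson bounded_subset closed_closure compact_eq_bounded_closed)
      have "perimeter F W \<le> perimeter G W"
        by (rule super_area_minimizing_compare[OF super adm(2) GL _ W Wb WU cpt]) (use cl CW in \<open>auto simp: G_def\<close>)
      also have "perimeter G W = perimeter {x. s < w x} W"
      proof (rule perimeter_cong_AE[OF GL])
        have "{x. s < w x} \<in> sets borel" by measurable
        then show "{x. s < w x} \<in> sets lebesgue" by auto
        show "AE x in lebesgue. x \<in> W \<longrightarrow> (x \<in> G) = (x \<in> {x. s < w x})"
          using F'(3)
        proof eventually_elim
          case (elim x)
          show ?case
          proof
            assume x: "x \<in> W"
            have "x \<in> B" if "x \<notin> F" "s < f x" using fpos[OF that(1) x] that s dr(1) by (simp add: B_def)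
            moreover have "w x = max (indicator F' x) (f x)" using x by (simp add: w_def)
            ultimately show "(x \<in> G) = (x \<in> {x. s < w x})"
              using elim s f01[of x] by (auto simp: G_def indicator_def max_def split: if_splits)
          qed
        qed
      qed
      finally show ?thesis unfolding p .
    qed
    have c0: "0 \<le> c" using wc zero_test_field[of W] by (force simp: var_le_def)
    \<comment> \<open>The coarea inequality asks that the bound \<open>q\<close> fail on every level
      set, whereas the levels have perimeter at least \<open>p\<close>; hence \<open>q\<close> is
      taken strictly below \<open>p\<close> first.\<close>
    have "q \<le> c" if q: "0 \<le> q" "q < p" for q
    proof (rule coarea_inequality[OF W wm w01 wz wc q(1)])
      fix s :: real assume s: "0 \<le> s" "s < 1"
      have m: "{x. s < w x} \<in> sets borel" by measurable
      show "\<not> var_le (indicator {x. s < w x}) W q"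
        unfolding perimeter_le_iff[OF m, symmetric] using q(2) order_trans[OF lev[OF s], of "ereal q"] by auto
    qed
    then have qc: "q \<le> c" if "0 \<le> q" "q < p" for q using that by blast
    show "p \<le> c"
    proof (rule ccontr)
      assume "\<not> p \<le> c"
      then show False using qc[of "(p + c) / 2"] c0 by simp
    qed
  qed

  have x1K: "x1 \<in> K" using x1 by (simp add: K_def)
  \<comment> \<open>The bound \<open>r / 8\<close> puts the ball of that radius around
    \<open>x1\<close> inside the flat ball of radius \<open>r / 4\<close> around \<open>x0\<close>;
    the bound \<open>d\<close> puts \<open>x0\<close> into \<open>W\<close>.\<close>
  obtain x0 where x0: "x0 \<in> interior (- F)" "dist x0 x1 < min (r / 8) d"
    using x1(2) dr unfolding closure_approachable by (metis min_less_iff_conj zero_less_divide_iff zero_less_numeral)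
  have "infdist x0 K < 3 * d" using infdist_le[OF x1K, of x0] x0(2) dr(1) by simp
  then have "x0 \<in> interior (- F) \<inter> W" using x0 by (simp add: W_def)
  then obtain \<rho>0 where \<rho>0: "\<rho>0 > 0" "ball x0 \<rho>0 \<subseteq> interior (- F) \<inter> W"
    using open_contains_ball[of "interior (- F) \<inter> W"] W by (meson open_Int open_interior)
  have b0: "ball x0 \<rho>0 \<subseteq> W" "ball x0 \<rho>0 \<inter> F' = {}" using \<rho>0(2) interior_subset[of "- F"] F'(2) by blast+
  obtain e where e: "norm e = 1" and flat: "\<And>(\<tau> :: 'a \<Rightarrow> real) u. C1 \<tau> \<Longrightarrow> (\<And>x. 0 \<le> \<tau> x \<and> \<tau> x \<le> 1) \<Longrightarrow>
      (\<And>x. r / 2 < norm (x - x0) \<Longrightarrow> \<tau> x = 0) \<Longrightarrow> norm u \<le> 1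
      \<Longrightarrow> (LBINT z. indicator E' z * frechet_derivative \<tau> (at z) (u - e)) \<le> 0"
    using averaged_translates_flat[OF W E'(1) F'(1) dr(2) p1 p2[unfolded f_def] \<rho>0(1) b0] by blast
  have nE: "normalized E" using adm by (simp add: admissible_def)
  have x1E: "x1 \<in> frontier E" using x1 by simp
  \<comment> \<open>Centres that differ by at least \<open>2 * \<eta>\<close> in direction
    \<open>e\<close> give balls that are completely ordered in that direction.\<close>
  have dich: "ball y \<eta> - E \<in> null_sets lebesgue \<or> ball y' \<eta> \<inter> E \<in> null_sets lebesgue"
    if y: "\<eta> > 0" "ball y \<eta> \<subseteq> ball x1 (r / 8)" "ball y' \<eta> \<subseteq> ball x1 (r / 8)" "(y' - y) \<bullet> e \<ge> 2 * \<eta>" for y y' \<eta>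
  proof -
    have b: "ball x1 (r / 8) \<subseteq> ball x0 (r / 2 / 2)"
    proof
      fix z assume "z \<in> ball x1 (r / 8)"
      then show "z \<in> ball x0 (r / 2 / 2)" using x0(2) dist_triangle[of x0 z x1] by simp
    qed
    have "ball y \<eta> - E' \<in> null_sets lborel \<or> ball y' \<eta> \<inter> E' \<in> null_sets lborel"
    proof (rule flat_imp_half_space[where s="r / 2" and ?x0.0=x0, OF E'(1) _ e flat])
      fix z z' assume z: "z \<in> ball y \<eta>" "z' \<in> ball y' \<eta>"
      have "(z - y) \<bullet> e \<le> \<eta>" using norm_cauchy_schwarz[of "z - y" e] z(1) e by (simp add: dist_norm norm_minus_commute)
      moreover have "(y' - z') \<bullet> e \<le> \<eta>" using norm_cauchy_schwarz[of "y' - z'" e] z(2) e by (simp add: dist_norm)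
      ultimately show "z \<bullet> e \<le> z' \<bullet> e" using y(4) by (simp add: inner_diff_left)
    qed (use y b dr(2) in auto)
    then show ?thesis
    proof
      assume "ball y \<eta> - E' \<in> null_sets lborel"
      then have "ball y \<eta> - E' \<in> null_sets lebesgue" by (auto intro: null_sets_completionI)
      then have "ball y \<eta> - E \<in> null_sets lebesgue" by (rule null_sets_subset) (use L E'(2) in auto)
      then show ?thesis ..
    next
      assume "ball y' \<eta> \<inter> E' \<in> null_sets lborel"
      then have "(ball y' \<eta> \<inter> E') \<union> (E - E') \<in> null_sets lebesgue" using E'(3) by (auto intro: null_sets_completionI)
      then have "ball y' \<eta> \<inter> E \<in> null_sets lebesgue" by (rule null_sets_subset) (use L in auto)
      then show ?thesis ..
    qed
  qed
  \<comment> \<open>A ball around \<open>x1\<close> plays the upper one: it meets \<open>E\<close>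
    in positive measure because \<open>x1\<close> is a boundary point, so the ball around
    \<open>y\<close> must be full. On the other side of \<open>x1\<close> the roles are
    exchanged.\<close>
  have "y \<in> E" if y: "y \<in> ball x1 (r / 8)" "(y - x1) \<bullet> e < 0" for y
  proof -
    obtain \<eta>0 where \<eta>0: "\<eta>0 > 0" "ball y \<eta>0 \<subseteq> ball x1 (r / 8)" by (rule openE[OF open_ball y(1)])
    define \<eta> where "\<eta> = min \<eta>0 (min (r / 8) (- ((y - x1) \<bullet> e) / 2))"
    have \<eta>: "\<eta> > 0" "ball y \<eta> \<subseteq> ball x1 (r / 8)" "ball x1 \<eta> \<subseteq> ball x1 (r / 8)" "2 * \<eta> \<le> - ((y - x1) \<bullet> e)"
      using \<eta>0 dr(2) y(2) by (auto simp: \<eta>_def)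
    have "ball y \<eta> - E \<in> null_sets lebesgue"
      using dich[OF \<eta>(1,2,3)] \<eta>(4) frontier_normalized(2)[OF L(1) nE x1E \<eta>(1)] by (simp add: inner_diff_left)
    then show "y \<in> E" by (rule normalized_ball(1)[OF L(1) nE \<eta>(1)])
  qed
  moreover have "y \<notin> E" if y: "y \<in> ball x1 (r / 8)" "(y - x1) \<bullet> e > 0" for y
  proof -
    obtain \<eta>0 where \<eta>0: "\<eta>0 > 0" "ball y \<eta>0 \<subseteq> ball x1 (r / 8)" by (rule openE[OF open_ball y(1)])
    define \<eta> where "\<eta> = min \<eta>0 (min (r / 8) ((y - x1) \<bullet> e / 2))"
    have \<eta>: "\<eta> > 0" "ball y \<eta> \<subseteq> ball x1 (r / 8)" "ball x1 \<eta> \<subseteq> ball x1 (r / 8)" "2 * \<eta> \<le> (y - x1) \<bullet> e"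
      using \<eta>0 dr(2) y(2) by (auto simp: \<eta>_def)
    have "ball y \<eta> \<inter> E \<in> null_sets lebesgue"
      using dich[OF \<eta>(1,3,2)] \<eta>(4) frontier_normalized(1)[OF L(1) nE x1E \<eta>(1)] by simp
    then show "y \<notin> E" by (rule normalized_ball(2)[OF L(1) nE \<eta>(1)])
  qed
  ultimately show ?thesis using dr(2) e by (intro exI[of _ "r / 8"]) auto
qed

section \<open>Matching the two half-spaces\<close>

lemma half_space_frontier:
  fixes E :: "'a::euclidean_space set"
  assumes e: "norm e = 1" and h: "\<And>y. y \<in> ball a \<rho> \<Longrightarrow> (y - a) \<bullet> e < 0 \<Longrightarrow> y \<in> E" "\<And>y. y \<in> ball a \<rho> \<Longrightarrow> (y - a) \<bullet> e > 0 \<Longrightarrow> y \<notin> E"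
    and y: "y \<in> ball a \<rho>"
  shows "y \<in> frontier E \<longleftrightarrow> (y - a) \<bullet> e = 0"
proof -
  have o: "open (ball a \<rho> \<inter> {y. (y - a) \<bullet> e < 0})" "open (ball a \<rho> \<inter> {y. (y - a) \<bullet> e > 0})"
    by (intro open_Int open_ball open_Collect_less continuous_intros)+
  have 1: "y \<in> interior E" if "(y - a) \<bullet> e < 0"
    by (rule interiorI[OF o(1)]) (use that y h in auto)
  have 2: "y \<in> interior (- E)" if "(y - a) \<bullet> e > 0"
    by (rule interiorI[OF o(2)]) (use that y h in auto)
  have 3: "y \<in> frontier E" if z: "(y - a) \<bullet> e = 0"
  proof -
    have "\<exists>p\<in>E. dist p y < \<epsilon>" "\<exists>p\<in>-E. dist p y < \<epsilon>" if \<epsilon>: "\<epsilon> > 0" for \<epsilon>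
    proof -
      obtain \<eta>0 where \<eta>0: "\<eta>0 > 0" "ball y \<eta>0 \<subseteq> ball a \<rho>" by (rule openE[OF open_ball y])
      define \<eta> where "\<eta> = min \<epsilon> \<eta>0 / 2"
      have \<eta>: "\<eta> > 0" "\<eta> < \<epsilon>" "\<eta> < \<eta>0" using \<epsilon> \<eta>0 by (auto simp: \<eta>_def)
      have ee: "e \<bullet> e = 1" using e by (simp add: dot_square_norm)
      have "y - \<eta> *\<^sub>R e \<in> ball y \<eta>0" "y + \<eta> *\<^sub>R e \<in> ball y \<eta>0"
        using \<eta> e by (auto simp: dist_norm)
      then have "y - \<eta> *\<^sub>R e \<in> ball a \<rho>" "y + \<eta> *\<^sub>R e \<in> ball a \<rho>" using \<eta>0(2) by blast+
      moreover have "(y - \<eta> *\<^sub>R e - a) \<bullet> e = - \<eta>" "(y + \<eta> *\<^sub>R e - a) \<bullet> e = \<eta>"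
        using z ee by (simp_all add: inner_diff_left inner_add_left)
      ultimately have "y - \<eta> *\<^sub>R e \<in> E" "y + \<eta> *\<^sub>R e \<in> - E" using h \<eta>(1) by auto
      moreover have "dist (y - \<eta> *\<^sub>R e) y < \<epsilon>" "dist (y + \<eta> *\<^sub>R e) y < \<epsilon>" using \<eta> e by (auto simp: dist_norm)
      ultimately show "\<exists>p\<in>E. dist p y < \<epsilon>" "\<exists>p\<in>-E. dist p y < \<epsilon>" by blast+
    qed
    then show ?thesis by (simp add: frontier_closures closure_approachable)
  qed
  show ?thesis
  proof
    assume "y \<in> frontier E"
    then have "y \<notin> interior E" "y \<notin> interior (- E)" by (auto simp: frontier_def interior_complement)
    then show "(y - a) \<bullet> e = 0" using 1 2 by fastforce
  qed (rule 3)
qed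

theorem mainTheorem2:
  fixes U E F :: "'a::euclidean_space set"
  assumes "open U"
    and "admissible E" and "admissible F"
    and "sub_area_minimizing E U"
    and "super_area_minimizing F U"
    and "E \<subseteq> F"
    and "compactly_contained (frontier E \<inter> frontier F) U"
    and "closure E \<inter> U = closure (interior E) \<inter> U"
  shows "frontier E \<inter> frontier F \<inter> U = {} \<or>
         (\<exists>N. open N \<and> N \<subseteq> U \<and> frontier E \<inter> frontier F \<inter> U \<subseteq> N \<and>
              N \<inter> frontier E = N \<inter> frontier F)"
proof -
  have "\<exists>\<rho>>0. ball x \<rho> \<subseteq> U \<and> ball x \<rho> \<inter> frontier E = ball x \<rho> \<inter> frontier F"
    if x: "x \<in> frontier E \<inter> frontier F \<inter> U" for x
  proof -
    have "x \<in> closure E \<inter> U" using x by (auto simp: frontier_def)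
    then have xE: "x \<in> closure (interior E)" using assms(8) by blast
    \<comment> \<open>The pair \<open>- F\<close>, \<open>- E\<close> takes the place of
      \<open>E\<close>, \<open>F\<close>: inclusion and minimality reverse, the boundaries are
      unchanged, and the exterior of \<open>- E\<close> is the interior of \<open>E\<close>, which
      has \<open>x\<close> in its closure.\<close>
    obtain \<rho>F n where F: "\<rho>F > 0" "norm n = 1"
      "\<And>y. y \<in> ball x \<rho>F \<Longrightarrow> (y - x) \<bullet> n < 0 \<Longrightarrow> y \<in> - F" "\<And>y. y \<in> ball x \<rho>F \<Longrightarrow> (y - x) \<bullet> n > 0 \<Longrightarrow> y \<notin> - F"
      using contact_half_space[OF assms(1) admissible_complement[OF assms(3)] admissible_complement[OF assms(2)]
        sub_area_minimizing_complement[OF assms(5,3)] super_area_minimizing_complement[OF assms(4,2)], of x]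
        assms(6,7) x xE by (auto simp: frontier_complement Int_commute)
    have op: "open (ball x \<rho>F \<inter> {y. (y - x) \<bullet> n < 0})" by (intro open_Int open_ball open_Collect_less continuous_intros)
    have nn: "n \<bullet> n = 1" using F(2) by (simp add: dot_square_norm)
    \<comment> \<open>The half-space just found for \<open>- F\<close> has interior points
      arbitrarily close to \<open>x\<close>, in direction \<open>- n\<close>; this opens the way for
      the original pair.\<close>
    have xF: "x \<in> closure (interior (- F))"
      unfolding closure_approachable
    proof (intro allI impI)
      fix \<epsilon> :: real assume \<epsilon>: "\<epsilon> > 0"
      define \<eta> where "\<eta> = min \<epsilon> \<rho>F / 2"
      have \<eta>: "\<eta> > 0" "\<eta> < \<epsilon>" "\<eta> < \<rho>F" using \<epsilon> F(1) by (auto simp: \<eta>_def)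
      have "x - \<eta> *\<^sub>R n \<in> interior (- F)"
        by (rule interiorI[OF op]) (use \<eta> F nn in \<open>auto simp: dist_norm\<close>)
      moreover have "dist (x - \<eta> *\<^sub>R n) x < \<epsilon>" using \<eta> F(2) by (simp add: dist_norm)
      ultimately show "\<exists>y\<in>interior (- F). dist y x < \<epsilon>" by blast
    qed
    obtain \<rho>E m where E: "\<rho>E > 0" "norm m = 1"
      "\<And>y. y \<in> ball x \<rho>E \<Longrightarrow> (y - x) \<bullet> m < 0 \<Longrightarrow> y \<in> E" "\<And>y. y \<in> ball x \<rho>E \<Longrightarrow> (y - x) \<bullet> m > 0 \<Longrightarrow> y \<notin> E"
      using contact_half_space[OF assms(1-7) _ xF] x by auto
    obtain \<rho>U where U: "\<rho>U > 0" "ball x \<rho>U \<subseteq> U" using x assms(1) open_contains_ball by blast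
    define \<rho> where "\<rho> = min \<rho>E (min \<rho>F \<rho>U)"
    have \<rho>: "\<rho> > 0" "ball x \<rho> \<subseteq> ball x \<rho>E" "ball x \<rho> \<subseteq> ball x \<rho>F" "ball x \<rho> \<subseteq> U" using E F U by (auto simp: \<rho>_def)
    have mm: "m \<bullet> m = 1" using E(2) by (simp add: dot_square_norm)
    \<comment> \<open>The half-space of \<open>m\<close> lies in \<open>E\<close> and that of
      \<open>n\<close> in \<open>- F\<close>. Unless they are opposite, the direction
      \<open>- (m + n)\<close> enters both at once, which contradicts
      \<open>E \<subseteq> F\<close>.\<close>
    have mn: "m = - n"
    proof (rule ccontr)
      assume ne: "m \<noteq> - n"
      have lt: "- 1 < m \<bullet> n"
      proof -
        have "0 < (m + n) \<bullet> (m + n)" using ne by (simp add: eq_neg_iff_add_eq_0)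
        then show ?thesis using mm nn by (simp add: inner_add_left inner_add_right inner_commute)
      qed
      define c where "c = norm (m + n) + 1"
      define k where "k = \<rho> / (2 * c)"
      have pos: "c > 0" using norm_ge_zero[of "m + n"] unfolding c_def by linarith
      have k: "k > 0" using \<rho>(1) pos by (simp add: k_def)
      have "k * norm (m + n) < \<rho>"
      proof -
        have "k * norm (m + n) \<le> k * c" using k by (intro mult_left_mono) (auto simp: c_def)
        also have "\<dots> = \<rho> / 2" using pos by (simp add: k_def)
        finally show ?thesis using \<rho>(1) by simp
      qed
      then have b: "x - k *\<^sub>R (m + n) \<in> ball x \<rho>" using k by (simp add: dist_norm)
      have "0 < m \<bullet> (m + n)" "0 < n \<bullet> (m + n)"
        using lt mm nn by (simp_all add: inner_add_right inner_commute[of n m])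
      then have "((x - k *\<^sub>R (m + n)) - x) \<bullet> m < 0" "((x - k *\<^sub>R (m + n)) - x) \<bullet> n < 0"
        using k by (simp_all add: inner_commute[of "m + n"])
      then have "x - k *\<^sub>R (m + n) \<in> E" "x - k *\<^sub>R (m + n) \<in> - F" using b \<rho> E(3) F(3) by blast+
      then show False using assms(6) by blast
    qed
    have "ball x \<rho> \<inter> frontier E = ball x \<rho> \<inter> frontier F"
    proof -
      have "y \<in> frontier E \<longleftrightarrow> y \<in> frontier F" if y: "y \<in> ball x \<rho>" for y
      proof -
        have "y \<in> frontier E \<longleftrightarrow> (y - x) \<bullet> m = 0"
          by (rule half_space_frontier[OF E(2-4)]) (use y \<rho> in auto)
        moreover have "y \<in> frontier (- F) \<longleftrightarrow> (y - x) \<bullet> n = 0"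
          by (rule half_space_frontier[OF F(2-4)]) (use y \<rho> in auto)
        ultimately show ?thesis by (simp add: mn frontier_complement)
      qed
      then show ?thesis by blast
    qed
    then show ?thesis using \<rho> by blast
  qed
  then obtain \<rho> where \<rho>: "\<And>x. x \<in> frontier E \<inter> frontier F \<inter> U \<Longrightarrow>
      \<rho> x > 0 \<and> ball x (\<rho> x) \<subseteq> U \<and> ball x (\<rho> x) \<inter> frontier E = ball x (\<rho> x) \<inter> frontier F" by metis
  let ?N = "\<Union>x\<in>frontier E \<inter> frontier F \<inter> U. ball x (\<rho> x)"
  have "open ?N" by (intro open_UN) auto
  moreover have "?N \<subseteq> U" using \<rho> by blast
  moreover have "frontier E \<inter> frontier F \<inter> U \<subseteq> ?N" using \<rho> by fastforce
  moreover have "?N \<inter> frontier E = ?N \<inter> frontier F" using \<rho> by blast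
  ultimately show ?thesis by blast
qed

end
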